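(* Let $k$ be a positive integer. There is an algorithm that takes as input an $n$-vertex graph $G$ and checks in time $2^{O(k^3)}\cdot 2^{O(k^2\cdot 2^{2k})}\cdot n^3$ whether $G$ has lettericity at most $k$, and if so outputs a $k$-letter realisation of $G$.
   Context: All graphs are finite, simple and undirected. A decoder is a directed graph $D=(\Sigma,A)$ (loops allowed) on a finite alphabet $\Sigma$. An $n$-vertex graph $G=(V,E)$ is a letter graph over $D$ if there exist a map $\ell:V\to\Sigma$ and a bijection $c:V\to[n]$ such that two distinct vertices $x,y$ are adjacent iff either $(\ell(x),\ell(y))\in A$ and $c(x)<c(y)$, or $(\ell(y),\ell(x))\in A$ and $c(y)<c(x)$; $(\ell,c)$ is then a letter realisation of $G$ over $D$, and a $k$-letter realisation if $|\Sigma|=k$. The lettericity of $G$ is the least $k$ such that $G$ admits a $k$-letter realisation. *)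

theory Defs
  imports "Graph_Theory.Pair_Digraph" "HOL-Library.Landau_Symbols"
begin

section \<open>Letter graphs\<close>

text \<open>
  Finite simple undirected graphs are \<^locale>\<open>pair_graph\<close>s, that is, finite loop-free digraphs
  without parallel arcs whose arc set is symmetric. A decoder is a \<^locale>\<open>pair_fin_digraph\<close>,
  which may have loops; its vertices are the letters.
\<close>

definition letter_realisation ::
    "'a pair_pre_digraph \<Rightarrow> 'b pair_pre_digraph \<Rightarrow> ('a \<Rightarrow> 'b) \<Rightarrow> ('a \<Rightarrow> nat) \<Rightarrow> bool" where
  "letter_realisation G D l c \<longleftrightarrow>
     pair_fin_digraph D \<and>
     l ` pverts G \<subseteq> pverts D \<and>
     bij_betw c (pverts G) {1..card (pverts G)} \<and>
     (\<forall>x \<in> pverts G. \<forall>y \<in> pverts G. x \<noteq> y \<longrightarrow>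
        ((x, y) \<in> parcs G \<longleftrightarrow>
          (l x, l y) \<in> parcs D \<and> c x < c y \<or> (l y, l x) \<in> parcs D \<and> c y < c x))"

definition k_letter_realisation ::
    "nat \<Rightarrow> 'a pair_pre_digraph \<Rightarrow> 'b pair_pre_digraph \<Rightarrow> ('a \<Rightarrow> 'b) \<Rightarrow> ('a \<Rightarrow> nat) \<Rightarrow> bool" where
  "k_letter_realisation k G D l c \<longleftrightarrow> letter_realisation G D l c \<and> card (pverts D) = k"

text \<open>
  A finite alphabet can be renamed into the natural numbers, so letters of type \<^typ>\<open>nat\<close>
  suffice. The minimum exists for finite graphs, since every vertex may receive its own letter.
\<close>

definition lettericity :: "'a pair_pre_digraph \<Rightarrow> nat" where
  "lettericity G =
     (LEAST k. \<exists>(D :: nat pair_pre_digraph) l c. k_letter_realisation k G D l c)"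


section \<open>Word RAM programs\<close>

text \<open>
  The machine is a unit-cost RAM with word length \<open>w\<close>, programmed by while programs. A state
  \<open>(R, M)\<close> consists of registers \<open>R\<close>, of which a program can name only finitely many, and of an
  indirectly addressed memory \<open>M\<close>. Every elementary command and every evaluation of a guard
  costs one time unit. A command that would write a value outside of \<open>{0..<2 ^ w}\<close> has no
  execution, so a terminating run never overflows.
\<close>

datatype aop = Add | Sub | Mul | Div

primrec aop_val :: "aop \<Rightarrow> nat \<Rightarrow> nat \<Rightarrow> nat" where
  "aop_val Add x y = x + y"
| "aop_val Sub x y = x - y"
| "aop_val Mul x y = x * y"
| "aop_val Div x y = x div y"

datatype com =
    Skip
  | Const nat nat         \<comment> \<open>\<open>Const r n\<close>: \<open>R r := n\<close>\<close>
  | Op aop nat nat nat    \<comment> \<open>\<open>Op op r a b\<close>: \<open>R r := R a op R b\<close>\<close>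
  | Load nat nat          \<comment> \<open>\<open>Load r a\<close>: \<open>R r := M (R a)\<close>\<close>
  | Store nat nat         \<comment> \<open>\<open>Store a r\<close>: \<open>M (R a) := R r\<close>\<close>
  | Seq com com
  | Cond nat com com        \<comment> \<open>\<open>Cond r P Q\<close>: \<open>if R r \<noteq> 0 then P else Q\<close>\<close>
  | While nat com         \<comment> \<open>\<open>While r P\<close>: \<open>while R r \<noteq> 0 do P\<close>\<close>

primrec com_length :: "com \<Rightarrow> nat" where
  "com_length Skip = 1"
| "com_length (Const r n) = 1"
| "com_length (Op f r a b) = 1"
| "com_length (Load r a) = 1"
| "com_length (Store a r) = 1"
| "com_length (Seq P Q) = com_length P + com_length Q"
| "com_length (Cond r P Q) = 1 + com_length P + com_length Q"
| "com_length (While r P) = 1 + com_length P"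

type_synonym state = "(nat \<Rightarrow> nat) \<times> (nat \<Rightarrow> nat)"

text \<open>\<open>exec w P s t s'\<close>: on word length \<open>w\<close>, program \<open>P\<close> takes \<open>s\<close> to \<open>s'\<close> in time \<open>t\<close>.\<close>

inductive exec :: "nat \<Rightarrow> com \<Rightarrow> state \<Rightarrow> nat \<Rightarrow> state \<Rightarrow> bool" for w where
  Skip: "exec w Skip s 1 s"
| Const: "n < 2 ^ w \<Longrightarrow> exec w (Const r n) (R, M) 1 (R(r := n), M)"
| Op: "aop_val f (R a) (R b) < 2 ^ w \<Longrightarrow>
    exec w (Op f r a b) (R, M) 1 (R(r := aop_val f (R a) (R b)), M)"
| Load: "M (R a) < 2 ^ w \<Longrightarrow> exec w (Load r a) (R, M) 1 (R(r := M (R a)), M)"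
| Store: "R r < 2 ^ w \<Longrightarrow> exec w (Store a r) (R, M) 1 (R, M(R a := R r))"
| Seq: "exec w P s t s' \<Longrightarrow> exec w Q s' u s'' \<Longrightarrow> exec w (Seq P Q) s (t + u) s''"
| CondTrue: "fst s r \<noteq> 0 \<Longrightarrow> exec w P s t s' \<Longrightarrow> exec w (Cond r P Q) s (1 + t) s'"
| CondFalse: "fst s r = 0 \<Longrightarrow> exec w Q s t s' \<Longrightarrow> exec w (Cond r P Q) s (1 + t) s'"
| WhileTrue: "fst s r \<noteq> 0 \<Longrightarrow> exec w P s t s' \<Longrightarrow> exec w (While r P) s' u s'' \<Longrightarrow>
    exec w (While r P) s (1 + t + u) s''"
| WhileFalse: "fst s r = 0 \<Longrightarrow> exec w (While r P) s 1 s"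

inductive_cases exec_SkipE: "exec w Skip s t s'"
inductive_cases exec_ConstE: "exec w (Const r n) s t s'"
inductive_cases exec_OpE: "exec w (Op f r a b) s t s'"
inductive_cases exec_LoadE: "exec w (Load r a) s t s'"
inductive_cases exec_StoreE: "exec w (Store a r) s t s'"
inductive_cases exec_SeqE: "exec w (Seq P Q) s t s'"
inductive_cases exec_CondE: "exec w (Cond r P Q) s t s'"
inductive_cases exec_WhileE: "exec w (While r P) s t s'"

text \<open>
  Determinism: exhibiting one terminating execution determines the outcome and the running time.
  Both are also independent of the word length, as long as no overflow occurs.
\<close>

lemma exec_deterministic:
  "exec w P s t s' \<Longrightarrow> exec v P s u s'' \<Longrightarrow> u = t \<and> s'' = s'"
proof (induction arbitrary: u s'' rule: exec.induct)
  case Skip then show ?case by (auto elim: exec_SkipE)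
next
  case Const then show ?case by (auto elim: exec_ConstE)
next
  case Op then show ?case by (auto elim: exec_OpE)
next
  case Load then show ?case by (auto elim: exec_LoadE)
next
  case Store then show ?case by (auto elim: exec_StoreE)
next
  case (Seq P s t1 s1 Q t2 s2)
  from Seq.prems show ?case
  proof (rule exec_SeqE)
    fix u1 z u2 assume "u = u1 + u2" "exec v P s u1 z" "exec v Q z u2 s''"
    with Seq.IH(1)[of u1 z] Seq.IH(2)[of u2 s''] show ?case by simp
  qed
next
  case (CondTrue s r P t1 s1 Q)
  from CondTrue.prems show ?case
  proof (rule exec_CondE)
    fix u1 assume "u = Suc u1" "exec v P s u1 s''"
    with CondTrue.IH[of u1 s''] show ?case by simp
  next
    assume "fst s r = 0"
    with CondTrue.hyps show ?case by simp
  qed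
next
  case (CondFalse s r Q t1 s1 P)
  from CondFalse.prems show ?case
  proof (rule exec_CondE)
    fix u1 assume "u = Suc u1" "exec v Q s u1 s''"
    with CondFalse.IH[of u1 s''] show ?case by simp
  next
    assume "0 < fst s r"
    with CondFalse.hyps show ?case by simp
  qed
next
  case (WhileTrue s r P t1 s1 t2 s2)
  from WhileTrue.prems show ?case
  proof (rule exec_WhileE)
    fix u1 z u2
    assume "u = Suc (u1 + u2)" "exec v P s u1 z" "exec v (While r P) z u2 s''"
    with WhileTrue.IH(1)[of u1 z] WhileTrue.IH(2)[of u2 s''] show ?case by simp
  next
    assume "fst s r = 0"
    with WhileTrue.hyps show ?case by simp
  qed
next
  case (WhileFalse s r P)
  from WhileFalse.prems show ?case
  proof (rule exec_WhileE)
    assume "0 < fst s r"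
    with WhileFalse.hyps show ?case by simp
  next
    assume "s'' = s" "u = Suc 0"
    then show ?case by simp
  qed
qed

text \<open>
  \<open>halts_within c P s T s'\<close>: started in \<open>s\<close>, the program \<open>P\<close> halts in \<open>s'\<close> after at most \<open>T\<close>
  steps, on a machine whose word length is at most \<open>c\<close> times the logarithm of the time bound.
  Unit cost is only a meaningful measure for such word lengths: otherwise a single word could hold
  an unbounded amount of data. The input has to fit into words, and so do the positions within the
  program, as they would in a program counter. In particular, a program that depends on a parameter
  cannot contain lookup tables that are too large for the time bound.
\<close>

definition halts_within :: "real \<Rightarrow> com \<Rightarrow> state \<Rightarrow> real \<Rightarrow> state \<Rightarrow> bool" where
  "halts_within c P s T s' \<longleftrightarrow>
     (\<exists>w t. exec w P s t s' \<and> real t \<le> T \<and> real w \<le> c * log 2 T \<and>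
        com_length P \<le> 2 ^ w \<and> (\<forall>i. fst s i < 2 ^ w) \<and> (\<forall>i. snd s i < 2 ^ w))"


section \<open>Encoding of inputs and outputs\<close>

text \<open>
  Input: the number \<open>n\<close> of vertices in register 0, and the adjacency matrix of a graph
  on \<open>{0..<n}\<close>, row by row, in the memory; everything else is 0.
\<close>

definition graph_input :: "nat \<Rightarrow> nat pair_pre_digraph \<Rightarrow> state" where
  "graph_input n G =
     ((\<lambda>r. if r = 0 then n else 0),
      (\<lambda>a. if a < n * n \<and> (a div n, a mod n) \<in> parcs G then 1 else 0))"

text \<open>
  Output of a realisation over the alphabet \<open>{0..<k}\<close>: the \<open>k \<times> k\<close> adjacency matrix of the decoder,
  then the letters of the \<open>n\<close> vertices, then their positions.
\<close>

definition output_decoder :: "nat \<Rightarrow> (nat \<Rightarrow> nat) \<Rightarrow> nat pair_pre_digraph" where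
  "output_decoder k M =
     \<lparr> pverts = {0..<k}, parcs = {(a, b). a < k \<and> b < k \<and> M (a * k + b) \<noteq> 0} \<rparr>"

definition output_letter :: "nat \<Rightarrow> (nat \<Rightarrow> nat) \<Rightarrow> nat \<Rightarrow> nat" where
  "output_letter k M v = M (k * k + v)"

definition output_position :: "nat \<Rightarrow> nat \<Rightarrow> (nat \<Rightarrow> nat) \<Rightarrow> nat \<Rightarrow> nat" where
  "output_position k n M v = M (k * k + n + v)"

end

(*
  Iterative compression: the vertices are added one at a time, and a k-letter realisation of the
  graph seen so far is maintained. For a decoder D and letters l, call (x, y) forced if x after y
  would give the wrong adjacency; the letters extend to a realisation over D iff the forced relation is
  acyclic, and then any topological order will do. Reading the vertices in the order of the old
  realisation, an automaton guesses the new letters. The adjacency of two vertices is determined by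
  their types (old letter, adjacency to the new vertex, new letter), so the automaton only has to
  remember which types reach which along forced pairs. It has 2^O(k^4) states, and k^4 is at most
  k^2 * 2^(2k). Finding an accepting run by dynamic programming and sorting topologically both take
  O(n^2) steps per vertex for fixed k. The program contains the transition table of the automaton as a
  nested case distinction.
*)

theory Submission
  imports Defs
begin

section \<open>Expressions and loops on the word RAM\<close>

text \<open>The old realisation is what makes a bounded summary possible: read in its order, all
  vertices of one type behave alike towards every vertex still to be read. A path of forced pairs
  therefore matters only through the types of its ends, and any further vertex can be charged to
  types instead of vertices. The new decoder, letters and order are chosen afresh and owe nothing
  else to the old ones. If none exist for the vertices seen so far, none exist for the whole graph,
  because deleting vertices keeps the forced pairs acyclic; a failure is therefore final. The cost
  model shapes the rest. The program text and all addresses have to fit into words of length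
  logarithmic in the time bound, so the tables compiled into the program must be bounded together
  with the running time. All these quantities are measured in powers of Y = 2^(k^4): there are at
  most Y^12 automaton states, and everything stays below Y^60.\<close>

definition bnd :: "nat \<Rightarrow> (nat \<Rightarrow> nat) \<Rightarrow> (nat \<Rightarrow> nat) \<Rightarrow> bool" where
  "bnd w R M \<longleftrightarrow> (\<forall>i. R i < 2 ^ w) \<and> (\<forall>i. M i < 2 ^ w)"

lemma exec_bnd:
  "exec w P s t s' \<Longrightarrow> bnd w (fst s) (snd s) \<Longrightarrow> bnd w (fst s') (snd s')"
  by (induction rule: exec.induct) (auto simp: bnd_def)

text \<open>The border between program variables and scratch space: expressions mention only
  registers below it, and compiled expressions use the registers from it upwards as a stack. The
  program needs the variables 0 to 12.\<close>

definition zz :: nat where "zz = 20"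

lemma less_zz [simp]: "0 < zz" "numeral m < zz \<longleftrightarrow> (numeral m :: nat) < 20" "Suc 0 < zz"
  by (auto simp: zz_def)

text \<open>\<open>Tab l e\<close> is a lookup in a list fixed with the program. The machine offers
  no constant data, so the list has to become program text, and a lookup costs time linear in its
  length.\<close>

datatype expr =
    Cn nat
  | Vr nat
  | Bi aop expr expr
  | Ld expr
  | Tab "nat list" expr

primrec eval :: "expr \<Rightarrow> (nat \<Rightarrow> nat) \<Rightarrow> (nat \<Rightarrow> nat) \<Rightarrow> nat" where
  "eval (Cn n) R M = n"
| "eval (Vr x) R M = R x"
| "eval (Bi f a b) R M = aop_val f (eval a R M) (eval b R M)"
| "eval (Ld e) R M = M (eval e R M)"
| "eval (Tab l e) R M = l ! eval e R M"

primrec well :: "expr \<Rightarrow> bool" where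
  "well (Cn n) \<longleftrightarrow> True"
| "well (Vr x) \<longleftrightarrow> x < zz"
| "well (Bi f a b) \<longleftrightarrow> well a \<and> well b"
| "well (Ld e) \<longleftrightarrow> well e"
| "well (Tab l e) \<longleftrightarrow> well e"

text \<open>Only addition and multiplication need an overflow check: truncated subtraction and
  division do not exceed their first operand, and loaded values are words already by
  \<open>bnd\<close>.\<close>

primrec safe :: "nat \<Rightarrow> expr \<Rightarrow> (nat \<Rightarrow> nat) \<Rightarrow> (nat \<Rightarrow> nat) \<Rightarrow> bool" where
  "safe w (Cn n) R M \<longleftrightarrow> n < 2 ^ w"
| "safe w (Vr x) R M \<longleftrightarrow> True"
| "safe w (Bi f a b) R M \<longleftrightarrow> safe w a R M \<and> safe w b R M \<and>
     (f = Add \<or> f = Mul \<longrightarrow> eval (Bi f a b) R M < 2 ^ w)"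
| "safe w (Ld e) R M \<longleftrightarrow> safe w e R M"
| "safe w (Tab l e) R M \<longleftrightarrow> safe w e R M \<and> eval e R M < length l \<and> l ! eval e R M < 2 ^ w"

primrec cost :: "expr \<Rightarrow> nat" where
  "cost (Cn n) = 1"
| "cost (Vr x) = 2"
| "cost (Bi f a b) = cost a + cost b + 1"
| "cost (Ld e) = cost e + 1"
| "cost (Tab l e) = cost e + 4 * length l + 2"

text \<open>A cascade of tests that counts the index down to 0. The index is consumed and replaced
  by the entry; \<open>Suc r\<close> only holds the constant 1.\<close>

primrec tab :: "nat list \<Rightarrow> nat \<Rightarrow> com" where
  "tab [] r = Skip"
| "tab (v # vs) r =
     Cond r (Seq (Const (Suc r) 1) (Seq (Op Sub r r (Suc r)) (tab vs r))) (Const r v)"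

primrec ecomp :: "expr \<Rightarrow> nat \<Rightarrow> com" where
  "ecomp (Cn n) r = Const r n"
| "ecomp (Vr x) r = Seq (Const r 0) (Op Add r r x)"
| "ecomp (Bi f a b) r = Seq (ecomp a r) (Seq (ecomp b (Suc r)) (Op f r r (Suc r)))"
| "ecomp (Ld e) r = Seq (ecomp e r) (Load r r)"
| "ecomp (Tab l e) r = Seq (ecomp e r) (tab l r)"

lemma eval_cong: "well e \<Longrightarrow> \<forall>x<zz. R x = R' x \<Longrightarrow> eval e R M = eval e R' M"
  by (induction e) auto

lemma safe_cong: "well e \<Longrightarrow> \<forall>x<zz. R x = R' x \<Longrightarrow> safe w e R M = safe w e R' M"
  by (induction e) (auto simp: eval_cong[of _ R R'])

lemma exec_Const': "n < 2 ^ w \<Longrightarrow> s' = (R(r := n), M) \<Longrightarrow> exec w (Const r n) (R, M) 1 s'"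
  using exec.Const by blast

lemma exec_Op': "aop_val f (R a) (R b) < 2 ^ w \<Longrightarrow> s' = (R(r := aop_val f (R a) (R b)), M) \<Longrightarrow>
    exec w (Op f r a b) (R, M) 1 s'"
  using exec.Op by blast

lemma tab_exec:
  assumes "bnd w R M" "1 \<le> w" "R r < length l" "l ! R r < 2 ^ w"
  shows "\<exists>t R'. exec w (tab l r) (R, M) t (R', M) \<and> t \<le> 4 * length l + 1 \<and> R' r = l ! R r \<and>
    (\<forall>x<r. R' x = R x)"
  using assms
proof (induction l arbitrary: R)
  case Nil
  then show ?case by simp
next
  case (Cons v vs)
  have one: "(1::nat) < 2 ^ w" using Cons.prems(2) one_less_power[of "2::nat" w] by simp
  show ?case
  proof (cases "R r = 0")
    case True
    have "exec w (tab (v # vs) r) (R, M) (1 + 1) (R(r := v), M)"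
      unfolding tab.simps
      by (rule exec.CondFalse, simp add: True, rule exec_Const') (use True Cons.prems in auto)
    then show ?thesis using True by - (intro exI conjI, assumption, auto)
  next
    case False
    let ?R1 = "R(Suc r := 1)"
    let ?R2 = "?R1(r := R r - 1)"
    have e1: "exec w (Const (Suc r) 1) (R, M) 1 (?R1, M)" using one by (intro exec_Const') auto
    have rb: "R r - 1 < 2 ^ w" using Cons.prems(1) unfolding bnd_def by (meson less_imp_diff_less)
    have e2: "exec w (Op Sub r r (Suc r)) (?R1, M) 1 (?R2, M)"
      using rb by (intro exec_Op') auto
    have "bnd w ?R2 M" using Cons.prems(1) one rb by (auto simp: bnd_def)
    moreover have "?R2 r < length vs" "vs ! ?R2 r < 2 ^ w" using False Cons.prems by (auto simp: nth_Cons')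
    ultimately obtain t R' where t: "exec w (tab vs r) (?R2, M) t (R', M)" "t \<le> 4 * length vs + 1"
      "R' r = vs ! ?R2 r" "\<forall>x<r. R' x = ?R2 x" using Cons.IH[of ?R2] Cons.prems(2) by metis
    have "exec w (tab (v # vs) r) (R, M) (1 + (1 + (1 + t))) (R', M)"
      unfolding tab.simps
      by (rule exec.CondTrue[OF _ exec.Seq[OF e1 exec.Seq[OF e2 t(1)]]]) (use False in simp)
    then show ?thesis using t False by (intro exI[of _ "1 + (1 + (1 + t))"] exI[of _ R']) (auto simp: nth_Cons')
  qed
qed

text \<open>Registers below \<open>r\<close> survive, so the second operand of a binary operation,
  evaluated at \<open>Suc r\<close>, leaves the first one in place; for the same reason
  \<open>zz \<le> r\<close> protects the program variables. The induction has to be general in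
  \<open>r\<close>.\<close>

lemma comp_exec:
  assumes "bnd w R M" "1 \<le> w" "well e" "zz \<le> r" "safe w e R M"
  shows "\<exists>t R'. exec w (ecomp e r) (R, M) t (R', M) \<and> t \<le> cost e \<and> R' r = eval e R M \<and>
    (\<forall>x<r. R' x = R x)"
  using assms
proof (induction e arbitrary: R r)
  case (Cn n)
  have "exec w (ecomp (Cn n) r) (R, M) 1 (R(r := n), M)" unfolding ecomp.simps by (rule exec_Const') (use Cn in auto)
  then show ?case by - (intro exI conjI, assumption, auto)
next
  case (Vr x)
  have "exec w (ecomp (Vr x) r) (R, M) (1 + 1) (R(r := R x), M)"
    unfolding ecomp.simps
    by (rule exec.Seq, rule exec.Const, simp, rule exec_Op')
       (use Vr in \<open>auto simp: bnd_def zz_def\<close>)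
  then show ?case by - (intro exI conjI, assumption, auto)
next
  case (Bi f a b)
  obtain t1 R1 where 1: "exec w (ecomp a r) (R, M) t1 (R1, M)" "t1 \<le> cost a" "R1 r = eval a R M"
    "\<forall>x<r. R1 x = R x" using Bi.IH(1)[of R r] Bi.prems by auto
  have b1: "bnd w R1 M" using exec_bnd[OF 1(1)] Bi.prems by simp
  have ag: "\<forall>x<zz. R1 x = R x" using 1(4) Bi.prems by auto
  have "safe w b R1 M" using safe_cong[OF _ ag] Bi.prems by simp
  then obtain t2 R2 where 2: "exec w (ecomp b (Suc r)) (R1, M) t2 (R2, M)" "t2 \<le> cost b"
    "R2 (Suc r) = eval b R1 M" "\<forall>x<Suc r. R2 x = R1 x"
    using Bi.IH(2)[of R1 "Suc r"] Bi.prems b1 by auto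
  have b2: "bnd w R2 M" using exec_bnd[OF 2(1)] b1 by simp
  have v: "R2 r = eval a R M" "R2 (Suc r) = eval b R M"
    using 1 2 eval_cong[OF _ ag] Bi.prems by auto
  have "aop_val f (R2 r) (R2 (Suc r)) < 2 ^ w"
  proof (cases f)
    case Sub
    then show ?thesis using b2 by (auto simp: bnd_def intro: less_imp_diff_less)
  next
    case Div
    then show ?thesis using b2 by (auto simp: bnd_def intro: le_less_trans[OF div_le_dividend])
  qed (use v Bi.prems in auto)
  then have 3: "exec w (Op f r r (Suc r)) (R2, M) 1 (R2(r := aop_val f (R2 r) (R2 (Suc r))), M)"
    by (rule exec.Op)
  have "exec w (ecomp (Bi f a b) r) (R, M) (t1 + (t2 + 1)) (R2(r := aop_val f (R2 r) (R2 (Suc r))), M)"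
    unfolding ecomp.simps by (intro exec.Seq[OF 1(1)] exec.Seq[OF 2(1)] 3)
  then show ?case using 1 2 v
    by - (intro exI conjI, assumption, auto)
next
  case (Ld e)
  obtain t1 R1 where 1: "exec w (ecomp e r) (R, M) t1 (R1, M)" "t1 \<le> cost e" "R1 r = eval e R M"
    "\<forall>x<r. R1 x = R x" using Ld.IH(1)[of R r] Ld.prems by auto
  have "exec w (Load r r) (R1, M) 1 (R1(r := M (R1 r)), M)"
    using Ld.prems by (intro exec.Load) (auto simp: bnd_def)
  then have "exec w (ecomp (Ld e) r) (R, M) (t1 + 1) (R1(r := M (R1 r)), M)"
    unfolding ecomp.simps by (intro exec.Seq[OF 1(1)])
  then show ?case using 1 by - (intro exI conjI, assumption, auto)
next
  case (Tab l e)
  obtain t1 R1 where 1: "exec w (ecomp e r) (R, M) t1 (R1, M)" "t1 \<le> cost e" "R1 r = eval e R M"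
    "\<forall>x<r. R1 x = R x" using Tab.IH[of R r] Tab.prems by auto
  have b1: "bnd w R1 M" using exec_bnd[OF 1(1)] Tab.prems by simp
  obtain t2 R2 where 2: "exec w (tab l r) (R1, M) t2 (R2, M)" "t2 \<le> 4 * length l + 1"
    "R2 r = l ! R1 r" "\<forall>x<r. R2 x = R1 x"
    using tab_exec[OF b1, of r l] Tab.prems 1 by auto
  then have "exec w (ecomp (Tab l e) r) (R, M) (t1 + t2) (R2, M)"
    unfolding ecomp.simps by (intro exec.Seq[OF 1(1)])
  then show ?case using 1 2 by (intro exI[of _ "t1 + t2"] exI[of _ R2]) auto
qed

lemma com_length_tab [simp]: "com_length (tab l r) \<le> 4 * length l + 1"
  by (induction l) auto

lemma com_length_comp: "com_length (ecomp e r) \<le> cost e"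
proof (induction e arbitrary: r)
  case (Bi f a b)
  show ?case using Bi(1)[of r] Bi(2)[of "Suc r"] by simp
next
  case (Ld e)
  show ?case using Ld[of r] by simp
next
  case (Tab l e)
  show ?case using Tab[of r] com_length_tab[of l r] by (simp del: com_length_tab)
qed auto

section \<open>Derived commands and a Hoare logic with running times\<close>

definition Asg :: "nat \<Rightarrow> expr \<Rightarrow> com" where
  "Asg x e = Seq (ecomp e zz) (Seq (Const x 0) (Op Add x x zz))"

definition St :: "expr \<Rightarrow> expr \<Rightarrow> com" where
  "St a e = Seq (ecomp a zz) (Seq (ecomp e (Suc zz)) (Store zz (Suc zz)))"

definition Ite :: "expr \<Rightarrow> com \<Rightarrow> com \<Rightarrow> com" where
  "Ite e P Q = Seq (ecomp e zz) (Cond zz P Q)"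

text \<open>The guard register is scratch space, so it is recomputed after every round. Truncated
  subtraction makes it the number of rounds left and 0 at the end.\<close>

definition For :: "nat \<Rightarrow> expr \<Rightarrow> com \<Rightarrow> com" where
  "For x e P = Seq (Asg x (Cn 0)) (Seq (ecomp (Bi Sub e (Vr x)) zz)
     (While zz (Seq P (Seq (Asg x (Bi Add (Vr x) (Cn 1))) (ecomp (Bi Sub e (Vr x)) zz)))))"

lemma com_length_Asg: "com_length (Asg x e) \<le> cost e + 2"
  using com_length_comp[of e zz] by (simp add: Asg_def)

lemma com_length_St: "com_length (St a e) \<le> cost a + cost e + 1"
  using com_length_comp[of a zz] com_length_comp[of e "Suc zz"] by (simp add: St_def)

lemma com_length_Ite: "com_length (Ite e P Q) \<le> cost e + 1 + com_length P + com_length Q"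
  using com_length_comp[of e zz] by (simp add: Ite_def)

lemma com_length_For: "com_length (For x e P) \<le> 2 * cost e + com_length P + 18"
  using com_length_comp[of "Bi Sub e (Vr x)" zz] com_length_Asg[of x "Cn 0"]
    com_length_Asg[of x "Bi Add (Vr x) (Cn 1)"]
  by (simp add: For_def)

definition clr :: "(nat \<Rightarrow> nat) \<Rightarrow> (nat \<Rightarrow> nat)" where
  "clr R = (\<lambda>x. if x < zz then R x else 0)"

lemma clr_eq_iff: "clr R = clr R' \<longleftrightarrow> (\<forall>x<zz. R x = R' x)"
  by (auto simp: clr_def fun_eq_iff)

lemma clr_cong: "\<forall>x<zz. R x = R' x \<Longrightarrow> clr R = clr R'"
  by (simp add: clr_eq_iff)

lemma clr_upd: "x < zz \<Longrightarrow> clr (R(x := v)) = (clr R)(x := v)"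
  by (auto simp: clr_def fun_eq_iff)

lemma eval_clr: "well e \<Longrightarrow> eval e (clr R) M = eval e R M"
  by (rule eval_cong) (auto simp: clr_def)

lemma safe_clr: "well e \<Longrightarrow> safe w e (clr R) M = safe w e R M"
  by (rule safe_cong) (auto simp: clr_def)

text \<open>
  Registers from \<open>zz\<close> on hold intermediate results; assertions see them as 0.
\<close>

definition hoare :: "nat \<Rightarrow> com \<Rightarrow> nat \<Rightarrow> ((nat \<Rightarrow> nat) \<Rightarrow> (nat \<Rightarrow> nat) \<Rightarrow> bool) \<Rightarrow>
    ((nat \<Rightarrow> nat) \<Rightarrow> (nat \<Rightarrow> nat) \<Rightarrow> bool) \<Rightarrow> bool" where
  "hoare w P T Pre Post \<longleftrightarrow> (\<forall>R M. bnd w R M \<longrightarrow> Pre (clr R) M \<longrightarrow>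
     (\<exists>t R' M'. exec w P (R, M) t (R', M') \<and> t \<le> T \<and> Post (clr R') M'))"

abbreviation (input) start :: "(nat \<Rightarrow> nat) \<Rightarrow> (nat \<Rightarrow> nat) \<Rightarrow> (nat \<Rightarrow> nat) \<Rightarrow> (nat \<Rightarrow> nat) \<Rightarrow> bool" where
  "start R0 M0 \<equiv> \<lambda>R M. R = R0 \<and> M = M0"

text \<open>The premise for the second command comes first: applied backwards, it fixes the
  intermediate assertion \<open>B\<close> from the postcondition, in weakest-precondition
  style.\<close>

lemma hoare_Seq:
  assumes "hoare w Q u B C" "hoare w P t A B"
  shows "hoare w (Seq P Q) (t + u) A C"
  unfolding hoare_def
proof (intro allI impI)
  fix R M assume 0: "bnd w R M" "A (clr R) M"
  obtain t1 R1 M1 where 1: "exec w P (R, M) t1 (R1, M1)" "t1 \<le> t" "B (clr R1) M1"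
    using assms(2) 0 unfolding hoare_def by blast
  have "bnd w R1 M1" using exec_bnd[OF 1(1)] 0 by simp
  then obtain t2 R2 M2 where 2: "exec w Q (R1, M1) t2 (R2, M2)" "t2 \<le> u" "C (clr R2) M2"
    using assms(1) 1 unfolding hoare_def by blast
  show "\<exists>t' R' M'. exec w (Seq P Q) (R, M) t' (R', M') \<and> t' \<le> t + u \<and> C (clr R') M'"
    using exec.Seq[OF 1(1) 2(1)] 1 2 by (meson add_mono)
qed

lemma hoare_conseq:
  assumes "hoare w P t A B" "\<And>R M. A' R M \<Longrightarrow> A R M" "\<And>R M. B R M \<Longrightarrow> B' R M" "t \<le> t'"
  shows "hoare w P t' A' B'"
  using assms unfolding hoare_def by (meson le_trans)

lemma hoare_pre:
  assumes "hoare w P t A B" "\<And>R M. A' R M \<Longrightarrow> A R M" "t \<le> t'"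
  shows "hoare w P t' A' B"
  using hoare_conseq[OF assms(1,2) _ assms(3)] .

lemma hoare_Skip: "hoare w Skip 1 A A"
  unfolding hoare_def by (meson exec.Skip order_refl)

context
  fixes w :: nat
  assumes w: "1 \<le> w"
begin

lemma hoare_Asg:
  assumes "x < zz" "well e"
  shows "hoare w (Asg x e) (cost e + 2)
    (\<lambda>R M. safe w e R M \<and> A (R(x := eval e R M)) M) A"
  unfolding hoare_def
proof (intro allI impI)
  fix R M assume 0: "bnd w R M" "safe w e (clr R) M \<and> A ((clr R)(x := eval e (clr R) M)) M"
  obtain t1 R1 where 1: "exec w (ecomp e zz) (R, M) t1 (R1, M)" "t1 \<le> cost e" "R1 zz = eval e R M"
    "\<forall>x<zz. R1 x = R x"
    using comp_exec[OF 0(1) w assms(2) order_refl] 0 assms by (auto simp: safe_clr)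
  have b1: "bnd w R1 M" using exec_bnd[OF 1(1)] 0 by simp
  have v: "eval e R M < 2 ^ w" using b1 1(3) unfolding bnd_def by metis
  \<comment> \<open>A register move is expressed as an addition to 0. The target is cleared only
    after \<open>e\<close> has been evaluated, so \<open>e\<close> may mention
    \<open>x\<close>.\<close>
  have 2: "exec w (Seq (Const x 0) (Op Add x x zz)) (R1, M) (1 + 1) (R1(x := eval e R M), M)"
    by (rule exec.Seq, rule exec.Const, simp, rule exec_Op')
       (use v b1 1(3) assms in \<open>auto simp: bnd_def\<close>)
  have "clr (R1(x := eval e R M)) = (clr R)(x := eval e (clr R) M)"
    using 1(4) assms by (simp add: clr_upd eval_clr) (metis clr_cong)
  then show "\<exists>t R' M'. exec w (Asg x e) (R, M) t (R', M') \<and> t \<le> cost e + 2 \<and> A (clr R') M'"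
    unfolding Asg_def using exec.Seq[OF 1(1) 2] 0(2) 1(2)
    by (metis add_mono one_add_one order_refl)
qed

lemma hoare_St:
  assumes "well a" "well e"
  shows "hoare w (St a e) (cost a + cost e + 1)
    (\<lambda>R M. safe w a R M \<and> safe w e R M \<and> A R (M(eval a R M := eval e R M))) A"
  unfolding hoare_def
proof (intro allI impI)
  fix R M assume 0: "bnd w R M" "safe w a (clr R) M \<and> safe w e (clr R) M \<and>
    A (clr R) (M(eval a (clr R) M := eval e (clr R) M))"
  obtain t1 R1 where 1: "exec w (ecomp a zz) (R, M) t1 (R1, M)" "t1 \<le> cost a" "R1 zz = eval a R M"
    "\<forall>x<zz. R1 x = R x"
    using comp_exec[OF 0(1) w assms(1) order_refl] 0 assms by (auto simp: safe_clr)
  have b1: "bnd w R1 M" using exec_bnd[OF 1(1)] 0 by simp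
  have s1: "safe w e R1 M" "eval e R1 M = eval e R M"
    using 0 safe_cong[OF assms(2) 1(4)] eval_cong[OF assms(2) 1(4)] assms by (auto simp: safe_clr)
  obtain t2 R2 where 2: "exec w (ecomp e (Suc zz)) (R1, M) t2 (R2, M)" "t2 \<le> cost e"
    "R2 (Suc zz) = eval e R M" "\<forall>x<Suc zz. R2 x = R1 x"
    using comp_exec[OF b1 w assms(2) _ s1(1), of "Suc zz"] s1(2) by auto
  have b2: "bnd w R2 M" using exec_bnd[OF 2(1)] b1 by simp
  have 3: "exec w (Store zz (Suc zz)) (R2, M) 1 (R2, M(R2 zz := R2 (Suc zz)))"
    using b2 by (intro exec.Store) (auto simp: bnd_def)
  have 4: "clr R2 = clr R" using 1(4) 2(4) by (intro clr_cong) auto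
  have 5: "R2 zz = eval a R M" using 1 2 by simp
  have "exec w (St a e) (R, M) (t1 + (t2 + 1)) (R2, M(R2 zz := R2 (Suc zz)))"
    unfolding St_def by (intro exec.Seq[OF 1(1)] exec.Seq[OF 2(1)] 3)
  moreover have "A (clr R2) (M(R2 zz := R2 (Suc zz)))"
    using 0(2) 4 5 2(3) assms by (simp add: eval_clr)
  moreover have "t1 + (t2 + 1) \<le> cost a + cost e + 1" using 1 2 by simp
  ultimately show "\<exists>t R' M'. exec w (St a e) (R, M) t (R', M') \<and> t \<le> cost a + cost e + 1 \<and> A (clr R') M'"
    by blast
qed

lemma hoare_comp:
  assumes "well e" "bnd w R M" "safe w e (clr R) M"
  obtains t R' where "exec w (ecomp e zz) (R, M) t (R', M)" "t \<le> cost e" "R' zz = eval e (clr R) M"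
    "clr R' = clr R" "bnd w R' M"
proof -
  obtain t1 R1 where 1: "exec w (ecomp e zz) (R, M) t1 (R1, M)" "t1 \<le> cost e" "R1 zz = eval e R M"
    "\<forall>x<zz. R1 x = R x"
    using comp_exec[OF assms(2) w assms(1) order_refl] assms by (auto simp: safe_clr)
  moreover have "bnd w R1 M" using exec_bnd[OF 1(1)] assms by simp
  ultimately show ?thesis using that assms by (simp add: eval_clr clr_cong)
qed

lemma hoare_Ite:
  assumes "well e" "hoare w P t A1 B" "hoare w Q u A2 B"
  shows "hoare w (Ite e P Q) (cost e + 1 + max t u)
    (\<lambda>R M. safe w e R M \<and> (if eval e R M \<noteq> 0 then A1 R M else A2 R M)) B"
  unfolding hoare_def
proof (intro allI impI)
  fix R M assume 0: "bnd w R M" "safe w e (clr R) M \<and>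
    (if eval e (clr R) M \<noteq> 0 then A1 (clr R) M else A2 (clr R) M)"
  obtain t1 R1 where 1: "exec w (ecomp e zz) (R, M) t1 (R1, M)" "t1 \<le> cost e"
    "R1 zz = eval e (clr R) M" "clr R1 = clr R" "bnd w R1 M"
    using hoare_comp[OF assms(1) 0(1)] 0(2) by blast
  have "\<exists>t2 R' M'. exec w (Cond zz P Q) (R1, M) (1 + t2) (R', M') \<and> t2 \<le> max t u \<and> B (clr R') M'"
  proof (cases "eval e (clr R) M = 0")
    case True
    then have "A2 (clr R1) M" using 0 1 by simp
    then obtain t2 R' M' where "exec w Q (R1, M) t2 (R', M')" "t2 \<le> u" "B (clr R') M'"
      using assms(3) 1(5) unfolding hoare_def by blast
    then show ?thesis using exec.CondFalse[of "(R1, M)" zz] True 1(3)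
      by (metis fst_conv max.coboundedI2)
  next
    case False
    then have "A1 (clr R1) M" using 0 1 by simp
    then obtain t2 R' M' where "exec w P (R1, M) t2 (R', M')" "t2 \<le> t" "B (clr R') M'"
      using assms(2) 1(5) unfolding hoare_def by blast
    then show ?thesis using exec.CondTrue[of "(R1, M)" zz] False 1(3)
      by (metis fst_conv max.coboundedI1)
  qed
  then obtain t2 R' M' where 2: "exec w (Cond zz P Q) (R1, M) (1 + t2) (R', M')" "t2 \<le> max t u"
    "B (clr R') M'" by blast
  show "\<exists>t' R' M'. exec w (Ite e P Q) (R, M) t' (R', M') \<and> t' \<le> cost e + 1 + max t u \<and> B (clr R') M'"
    unfolding Ite_def using exec.Seq[OF 1(1) 2(1)] 1(2) 2(2,3)
    by (metis add.assoc add_mono le_refl)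
qed

text \<open>The postcondition of the body speaks about the register already incremented, so that the
  rule absorbs the increment. Of the 10 extra units per round, 6 pay for the increment, 3 for the
  rest of the guard expression and 1 for the test.\<close>

lemma hoare_For:
  assumes x: "x < zz" and e: "well e" and cnt: "cnt < 2 ^ w"
    and init: "\<And>R M. A R M \<Longrightarrow> I 0 (R(x := 0)) M"
    and body: "\<And>j. j < cnt \<Longrightarrow> hoare w P b (\<lambda>R M. R x = j \<and> I j R M)
      (\<lambda>R M. R x = j \<and> I (Suc j) (R(x := Suc j)) M)"
    and guard: "\<And>j R M. j \<le> cnt \<Longrightarrow> R x = j \<Longrightarrow> I j R M \<Longrightarrow> safe w e R M \<and> eval e R M = cnt"
    and fin: "\<And>R M. R x = cnt \<Longrightarrow> I cnt R M \<Longrightarrow> Q R M"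
  shows "hoare w (For x e P) (cnt * (b + cost e + 10) + cost e + 7) A Q"
proof -
  let ?g = "Bi Sub e (Vr x)"
  let ?body = "Seq P (Seq (Asg x (Bi Add (Vr x) (Cn 1))) (ecomp ?g zz))"
  have one: "(1::nat) < 2 ^ w" using w one_less_power[of "2::nat" w] by simp
  \<comment> \<open>Induction on the number of rounds left, which is the content of the guard
    register.\<close>
  have loop: "\<exists>t R' M'. exec w (While zz ?body) (R, M) t (R', M') \<and>
      t \<le> (cnt - j) * (b + cost e + 10) + 1 \<and> Q (clr R') M'"
    if "j \<le> cnt" "bnd w R M" "clr R x = j" "I j (clr R) M" "R zz = cnt - j" for j R M
    using that
  proof (induction "cnt - j" arbitrary: j R M)
    case 0
    then have "exec w (While zz ?body) (R, M) 1 (R, M)" by (intro exec.WhileFalse) auto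
    moreover have "Q (clr R) M" using 0 fin[of "clr R" M] by simp
    ultimately show ?case using 0 by (intro exI[of _ 1] exI[of _ R] exI[of _ M]) auto
  next
    case (Suc m)
    have j: "j < cnt" using Suc by simp
    obtain t1 R1 M1 where 1: "exec w P (R, M) t1 (R1, M1)" "t1 \<le> b"
      "clr R1 x = j" "I (Suc j) ((clr R1)(x := Suc j)) M1"
      using body[OF j] Suc.prems unfolding hoare_def by blast
    have b1: "bnd w R1 M1" using exec_bnd[OF 1(1)] Suc.prems by simp
    have "hoare w (Asg x (Bi Add (Vr x) (Cn 1))) (cost (Bi Add (Vr x) (Cn 1)) + 2)
      (\<lambda>R M. safe w (Bi Add (Vr x) (Cn 1)) R M \<and> (R(x := eval (Bi Add (Vr x) (Cn 1)) R M) = (clr R1)(x := Suc j) \<and> M = M1))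
      (\<lambda>R M. R = (clr R1)(x := Suc j) \<and> M = M1)"
      by (rule hoare_Asg) (use x in auto)
    moreover have "Suc j < 2 ^ w" using j cnt by simp
    ultimately obtain t2 R2 M2 where 2: "exec w (Asg x (Bi Add (Vr x) (Cn 1))) (R1, M1) t2 (R2, M2)"
      "t2 \<le> 6" "clr R2 = (clr R1)(x := Suc j)" "M2 = M1"
      unfolding hoare_def using b1 1(3) one by fastforce
    have b2: "bnd w R2 M1" using exec_bnd[OF 2(1)] b1 2(4) by simp
    have g: "safe w e (clr R2) M1 \<and> eval e (clr R2) M1 = cnt"
      by (rule guard[of "Suc j"]) (use j 1 2 in auto)
    obtain t3 R3 where 3: "exec w (ecomp ?g zz) (R2, M1) t3 (R3, M1)" "t3 \<le> cost ?g"
      "R3 zz = eval ?g (clr R2) M1" "clr R3 = clr R2" "bnd w R3 M1"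
      by (rule hoare_comp[OF _ b2, of ?g]) (use g e x in auto)
    have r3: "R3 zz = cnt - Suc j" using 3(3) g 2(3) by simp
    have m: "m = cnt - Suc j" using Suc.hyps(2) by simp
    have "\<exists>t R' M'. exec w (While zz ?body) (R3, M1) t (R', M') \<and>
      t \<le> (cnt - Suc j) * (b + cost e + 10) + 1 \<and> Q (clr R') M'"
      by (rule Suc.hyps(1)[OF m]) (use j 3 2 1 r3 in auto)
    then obtain t4 R4 M4 where 4: "exec w (While zz ?body) (R3, M1) t4 (R4, M4)"
      "t4 \<le> (cnt - Suc j) * (b + cost e + 10) + 1" "Q (clr R4) M4" by blast
    have "exec w ?body (R, M) (t1 + (t2 + t3)) (R3, M1)"
      by (intro exec.Seq[OF 1(1)] exec.Seq[OF 2(1)]) (use 3(1) 2(4) in simp)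
    then have "exec w (While zz ?body) (R, M) (1 + (t1 + (t2 + t3)) + t4) (R4, M4)"
      by (rule exec.WhileTrue[rotated, OF _ 4(1)]) (use Suc.prems j in simp)
    moreover have "cnt - j = Suc (cnt - Suc j)" using j by simp
    then have "1 + (t1 + (t2 + t3)) + t4 \<le> (cnt - j) * (b + cost e + 10) + 1"
      using 1(2) 2(2) 3(2) 4(2) by simp
    ultimately show ?case using 4(3) by blast
  qed
  show ?thesis unfolding hoare_def
  proof (intro allI impI)
    fix R M assume 0: "bnd w R M" "A (clr R) M"
    have "hoare w (Asg x (Cn 0)) (cost (Cn 0) + 2)
      (\<lambda>R' M'. safe w (Cn 0) R' M' \<and> (R'(x := eval (Cn 0) R' M') = (clr R)(x := 0) \<and> M' = M))
      (\<lambda>R' M'. R' = (clr R)(x := 0) \<and> M' = M)"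
      by (rule hoare_Asg) (use x in auto)
    then obtain t2 R2 M2 where 2: "exec w (Asg x (Cn 0)) (R, M) t2 (R2, M2)"
      "t2 \<le> 3" "clr R2 = (clr R)(x := 0)" "M2 = M"
      unfolding hoare_def using 0 by fastforce
    have b2: "bnd w R2 M" using exec_bnd[OF 2(1)] 0 2(4) by simp
    have i2: "I 0 (clr R2) M" using init[OF 0(2)] 2 by simp
    have g: "safe w e (clr R2) M \<and> eval e (clr R2) M = cnt"
      by (rule guard[of 0]) (use i2 2 in auto)
    obtain t3 R3 where 3: "exec w (ecomp ?g zz) (R2, M) t3 (R3, M)" "t3 \<le> cost ?g"
      "R3 zz = eval ?g (clr R2) M" "clr R3 = clr R2" "bnd w R3 M"
      by (rule hoare_comp[OF _ b2, of ?g]) (use g e x in auto)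
    have r3: "R3 zz = cnt - 0" using 3(3) g 2(3) by simp
    have "\<exists>t R' M'. exec w (While zz ?body) (R3, M) t (R', M') \<and>
      t \<le> (cnt - 0) * (b + cost e + 10) + 1 \<and> Q (clr R') M'"
      by (rule loop) (use 3 2 i2 r3 in auto)
    then obtain t4 R4 M4 where 4: "exec w (While zz ?body) (R3, M) t4 (R4, M4)"
      "t4 \<le> cnt * (b + cost e + 10) + 1" "Q (clr R4) M4" by auto
    have "exec w (For x e P) (R, M) (t2 + (t3 + t4)) (R4, M4)"
      unfolding For_def by (intro exec.Seq[OF 2(1)] exec.Seq[OF _ 4(1)]) (use 3(1) 2(4) in simp)
    moreover have "t2 + (t3 + t4) \<le> cnt * (b + cost e + 10) + cost e + 7"
      using 2 3 4 by simp
    ultimately show "\<exists>t R' M'. exec w (For x e P) (R, M) t (R', M') \<and>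
        t \<le> cnt * (b + cost e + 10) + cost e + 7 \<and> Q (clr R') M'"
      using 4(3) by blast
  qed
qed

end

section \<open>Realisations and acyclicity\<close>

text \<open>
  A pair \<open>(x, y)\<close> in this relation forces \<open>x\<close> to come before \<open>y\<close>, because the opposite order
  would give the wrong adjacency. If both orders are wrong, the relation has a 2-cycle.
\<close>

definition forced :: "(nat \<Rightarrow> nat \<Rightarrow> bool) \<Rightarrow> (nat \<times> nat) set \<Rightarrow> (nat \<Rightarrow> nat) \<Rightarrow> (nat \<times> nat) set" where
  "forced adj D l = {(x, y). x \<noteq> y \<and> adj x y \<noteq> ((l y, l x) \<in> D)}"

text \<open>The positions of a realisation increase along forced pairs, which rules out cycles. The
  letters are renamed into \<open>{..<k}\<close> to match the range over which the program
  searches.\<close>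

lemma lettericity_le_imp_acyclic:
  assumes G: "pair_graph G" "pverts G = {0..<n}" and le: "lettericity G \<le> k"
  obtains D l where "D \<subseteq> {..<k} \<times> {..<k}" "\<And>x. x < n \<Longrightarrow> l x < k"
    "acyclic (forced (\<lambda>x y. (x, y) \<in> parcs G) D l \<inter> {..<n} \<times> {..<n})"
proof -
  interpret pair_graph G by fact
  have sym: "(x, y) \<in> parcs G \<longleftrightarrow> (y, x) \<in> parcs G" for x y
    using arcs_symmetric by blast
  have "bij_betw Suc {0..<n} {1..n}"
    by (rule bij_betwI[where g = "\<lambda>x. x - 1"]) auto
  \<comment> \<open>With a letter of its own for every vertex, \<open>G\<close> is its own decoder.
    Hence some realisation exists and the \<open>LEAST\<close> in \<open>lettericity\<close> is
    attained.\<close>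
  then have "k_letter_realisation n G G id Suc"
    unfolding k_letter_realisation_def letter_realisation_def
    using G sym pair_fin_digraph_axioms by (auto simp: nat_neq_iff)
  then have "\<exists>(D :: nat pair_pre_digraph) l c. k_letter_realisation n G D l c" by blast
  then have "\<exists>(D :: nat pair_pre_digraph) l c. k_letter_realisation (lettericity G) G D l c"
    unfolding lettericity_def by (rule LeastI)
  then obtain E :: "nat pair_pre_digraph" and l c where E: "letter_realisation G E l c" "card (pverts E) \<le> k"
    using le unfolding k_letter_realisation_def by auto
  then interpret E: pair_fin_digraph E unfolding letter_realisation_def by simp
  have lE: "\<And>x. x < n \<Longrightarrow> l x \<in> pverts E"
    and adj: "\<And>x y. x < n \<Longrightarrow> y < n \<Longrightarrow> x \<noteq> y \<Longrightarrow> (x, y) \<in> parcs G \<longleftrightarrow>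
      (l x, l y) \<in> parcs E \<and> c x < c y \<or> (l y, l x) \<in> parcs E \<and> c y < c x"
    and c: "inj_on c {0..<n}"
    using E(1) G unfolding letter_realisation_def by (auto simp: bij_betw_def)
  obtain g :: "nat \<Rightarrow> nat" where g: "g ` pverts E \<subseteq> {..<k}" "inj_on g (pverts E)"
    using card_le_inj[of "pverts E" "{..<k}"] E(2) E.pair_finite_verts by auto
  let ?D = "(\<lambda>(a, b). (g a, g b)) ` parcs E"
  have D: "(g a, g b) \<in> ?D \<longleftrightarrow> (a, b) \<in> parcs E" if "a \<in> pverts E" "b \<in> pverts E" for a b
  proof
    assume "(g a, g b) \<in> ?D"
    then obtain a' b' where *: "(a', b') \<in> parcs E" "g a = g a'" "g b = g b'" by auto
    then have "a = a'" "b = b'"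
      using that inj_onD[OF g(2)] E.in_arcsD1[OF *(1)] E.in_arcsD2[OF *(1)] by blast+
    then show "(a, b) \<in> parcs E" using * by simp
  qed force
  \<comment> \<open>The converse appears because \<open>acyclicI_order\<close> expects a measure
    that decreases along the relation, whereas \<open>c\<close> increases along forced
    pairs.\<close>
  have "acyclic ((forced (\<lambda>x y. (x, y) \<in> parcs G) ?D (g \<circ> l) \<inter> {..<n} \<times> {..<n})\<inverse>)"
  proof (rule acyclicI_order[where f = c])
    fix y x assume "(y, x) \<in> (forced (\<lambda>x y. (x, y) \<in> parcs G) ?D (g \<circ> l) \<inter> {..<n} \<times> {..<n})\<inverse>"
    then have *: "x \<noteq> y" "x < n" "y < n" "(x, y) \<in> parcs G \<longleftrightarrow> (l y, l x) \<notin> parcs E"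
      using D lE by (auto simp: forced_def)
    then have "c x \<noteq> c y" using c by (auto dest: inj_onD)
    then show "c x < c y" using adj[of x y] * by auto
  qed
  then have "acyclic (forced (\<lambda>x y. (x, y) \<in> parcs G) ?D (g \<circ> l) \<inter> {..<n} \<times> {..<n})"
    by (simp only: acyclic_converse)
  moreover have "?D \<subseteq> {..<k} \<times> {..<k}"
  proof
    fix z assume "z \<in> ?D"
    then obtain a b where "(a, b) \<in> parcs E" "z = (g a, g b)" by auto
    then show "z \<in> {..<k} \<times> {..<k}" using g(1) E.in_arcsD1[of a b] E.in_arcsD2[of a b] by auto
  qed
  moreover have "(g \<circ> l) x < k" if "x < n" for x using lE[OF that] g(1) by auto
  ultimately show ?thesis using that[of ?D "g \<circ> l"] by blast
qed

section \<open>Reachability between vertex types\<close>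

text \<open>A path can be cut at its first and its last visit to \<open>v\<close>. The outer pieces
  stay inside \<open>V\<close>, and whatever happens in between can be skipped.\<close>

lemma rtrancl_insert_vertex:
  fixes H :: "('a \<times> 'a) set"
  assumes v: "v \<notin> V" "(v, v) \<notin> H"
  defines "E \<equiv> H \<inter> V \<times> V" and "E' \<equiv> H \<inter> insert v V \<times> insert v V"
  shows "x \<in> V \<Longrightarrow> y \<in> V \<Longrightarrow> (x, y) \<in> E'\<^sup>* \<longleftrightarrow> (x, y) \<in> E\<^sup>* \<or>
      (\<exists>u\<in>V. \<exists>u'\<in>V. (x, u) \<in> E\<^sup>* \<and> (u, v) \<in> H \<and> (v, u') \<in> H \<and> (u', y) \<in> E\<^sup>*)"
    and "x \<in> V \<Longrightarrow> (x, v) \<in> E'\<^sup>* \<longleftrightarrow> (\<exists>u\<in>V. (x, u) \<in> E\<^sup>* \<and> (u, v) \<in> H)"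
    and "y \<in> V \<Longrightarrow> (v, y) \<in> E'\<^sup>* \<longleftrightarrow> (\<exists>u\<in>V. (v, u) \<in> H \<and> (u, y) \<in> E\<^sup>*)"
proof -
  have sub: "E\<^sup>* \<subseteq> E'\<^sup>*" by (rule rtrancl_mono) (auto simp: E_def E'_def)
  have to_v: "(u, v) \<in> E'" if "u \<in> V" "(u, v) \<in> H" for u using that by (auto simp: E'_def)
  have from_v: "(v, u) \<in> E'" if "u \<in> V" "(v, u) \<in> H" for u using that by (auto simp: E'_def)
  have estep: "y = v \<and> z \<in> V \<and> (v, z) \<in> H \<or> y \<in> V \<and> z = v \<and> (y, v) \<in> H \<or> y \<in> V \<and> z \<in> V \<and> (y, z) \<in> E"
    if "(y, z) \<in> E'" for y z
    using that v(2) unfolding E_def E'_def by blast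
  have P1: "y = v \<or> y \<in> V \<and> (\<exists>u\<in>V. (v, u) \<in> H \<and> (u, y) \<in> E\<^sup>*)" if "(v, y) \<in> E'\<^sup>*" for y
    using that
  proof (induction rule: rtrancl_induct)
    case (step y z)
    from step.IH \<open>(y, z) \<in> E'\<close>[THEN estep] show ?case
      using v(1) by (elim disjE conjE bexE) (auto intro: rtrancl_into_rtrancl)
  qed simp
  \<comment> \<open>When the path enters \<open>v\<close> again, the old first piece is kept; when
    it leaves \<open>v\<close>, a new last piece begins.\<close>
  have P2: "y = v \<and> (\<exists>u\<in>V. (x, u) \<in> E\<^sup>* \<and> (u, v) \<in> H) \<or> y \<in> V \<and> ((x, y) \<in> E\<^sup>* \<or>
      (\<exists>u\<in>V. \<exists>u'\<in>V. (x, u) \<in> E\<^sup>* \<and> (u, v) \<in> H \<and> (v, u') \<in> H \<and> (u', y) \<in> E\<^sup>*))"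
    if "(x, y) \<in> E'\<^sup>*" "x \<in> V" for x y
    using that
  proof (induction rule: rtrancl_induct)
    case (step y z)
    from step.IH[OF \<open>x \<in> V\<close>] \<open>(y, z) \<in> E'\<close>[THEN estep] show ?case
      using v(1) by (elim disjE conjE bexE) (blast intro: rtrancl_into_rtrancl)+
  qed simp
  have through: "(x, v) \<in> E'\<^sup>*" if "u \<in> V" "(x, u) \<in> E\<^sup>*" "(u, v) \<in> H" for x u
    using rtrancl_into_rtrancl[OF subsetD[OF sub that(2)] to_v[OF that(1,3)]] .
  have out: "(v, y) \<in> E'\<^sup>*" if "u \<in> V" "(u, y) \<in> E\<^sup>*" "(v, u) \<in> H" for y u
    using converse_rtrancl_into_rtrancl[OF from_v[OF that(1,3)] subsetD[OF sub that(2)]] .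
  show "(x, y) \<in> E'\<^sup>* \<longleftrightarrow> (x, y) \<in> E\<^sup>* \<or>
      (\<exists>u\<in>V. \<exists>u'\<in>V. (x, u) \<in> E\<^sup>* \<and> (u, v) \<in> H \<and> (v, u') \<in> H \<and> (u', y) \<in> E\<^sup>*)" if "x \<in> V" "y \<in> V"
  proof
    assume "(x, y) \<in> E'\<^sup>*"
    then show "(x, y) \<in> E\<^sup>* \<or>
      (\<exists>u\<in>V. \<exists>u'\<in>V. (x, u) \<in> E\<^sup>* \<and> (u, v) \<in> H \<and> (v, u') \<in> H \<and> (u', y) \<in> E\<^sup>*)"
      using P2[of x y] that v(1) by auto
  next
    assume "(x, y) \<in> E\<^sup>* \<or>
      (\<exists>u\<in>V. \<exists>u'\<in>V. (x, u) \<in> E\<^sup>* \<and> (u, v) \<in> H \<and> (v, u') \<in> H \<and> (u', y) \<in> E\<^sup>*)"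
    then show "(x, y) \<in> E'\<^sup>*"
    proof (elim disjE bexE conjE)
      fix u u' assume "u \<in> V" "u' \<in> V" "(x, u) \<in> E\<^sup>*" "(u, v) \<in> H" "(v, u') \<in> H" "(u', y) \<in> E\<^sup>*"
      then show ?thesis using rtrancl_trans[OF through out] by blast
    qed (rule subsetD[OF sub])
  qed
  show "x \<in> V \<Longrightarrow> (x, v) \<in> E'\<^sup>* \<longleftrightarrow> (\<exists>u\<in>V. (x, u) \<in> E\<^sup>* \<and> (u, v) \<in> H)"
    using P2[of x v] through[of _ x] v(1) by metis
  show "y \<in> V \<Longrightarrow> (v, y) \<in> E'\<^sup>* \<longleftrightarrow> (\<exists>u\<in>V. (v, u) \<in> H \<and> (u, y) \<in> E\<^sup>*)"
    using P1[of y] out[of _ y] v(1) by metis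
qed

text \<open>A new cycle must pass through \<open>v\<close>, and after cutting at \<open>v\<close>
  what remains is a path inside \<open>V\<close> from a successor to a predecessor of
  \<open>v\<close>.\<close>

lemma acyclic_insert_vertex:
  fixes H :: "('a \<times> 'a) set"
  assumes v: "v \<notin> V" "(v, v) \<notin> H"
  defines "E \<equiv> H \<inter> V \<times> V" and "E' \<equiv> H \<inter> insert v V \<times> insert v V"
  shows "acyclic E' \<longleftrightarrow> acyclic E \<and>
    \<not> (\<exists>u\<in>V. \<exists>u'\<in>V. (v, u) \<in> H \<and> (u, u') \<in> E\<^sup>* \<and> (u', v) \<in> H)"
proof -
  note R = rtrancl_insert_vertex[OF v, folded E_def E'_def]
  have cyc: "\<not> acyclic F \<longleftrightarrow> (\<exists>x y. (x, y) \<in> F\<^sup>* \<and> (y, x) \<in> F)" for F :: "('a \<times> 'a) set"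
    unfolding acyclic_def by (meson rtrancl_into_trancl1 tranclD2)
  show ?thesis
  proof
    assume a: "acyclic E'"
    have "acyclic E" by (rule acyclic_subset[OF a]) (auto simp: E_def E'_def)
    moreover have False if "u \<in> V" "u' \<in> V" "(v, u) \<in> H" "(u, u') \<in> E\<^sup>*" "(u', v) \<in> H" for u u'
    proof -
      have "(v, u') \<in> E'\<^sup>*" using R(3)[of u'] that by blast
      moreover have "(u', v) \<in> E'" using that by (auto simp: E'_def)
      ultimately show False using a cyc by blast
    qed
    ultimately show "acyclic E \<and> \<not> (\<exists>u\<in>V. \<exists>u'\<in>V. (v, u) \<in> H \<and> (u, u') \<in> E\<^sup>* \<and> (u', v) \<in> H)"
      by blast
  next
    assume a: "acyclic E \<and> \<not> (\<exists>u\<in>V. \<exists>u'\<in>V. (v, u) \<in> H \<and> (u, u') \<in> E\<^sup>* \<and> (u', v) \<in> H)"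
    show "acyclic E'"
    proof (rule ccontr)
      assume "\<not> acyclic E'"
      then obtain x y where xy: "(x, y) \<in> E'\<^sup>*" "(y, x) \<in> E'" using cyc by blast
      have E'D: "x \<in> insert v V" "y \<in> insert v V" "(y, x) \<in> H" using xy(2) by (auto simp: E'_def)
      \<comment> \<open>The closing arc \<open>(y, x)\<close> of the cycle may avoid
        \<open>v\<close>, leave it or enter it; it cannot be a loop at \<open>v\<close>.\<close>
      consider "x \<in> V" "y \<in> V" | "x = v" "y \<in> V" | "x \<in> V" "y = v"
        using E'D v by auto
      then show False
      proof cases
        case 1
        then have yx: "(y, x) \<in> E" using E'D by (auto simp: E_def)
        from R(1)[OF 1] xy(1) consider "(x, y) \<in> E\<^sup>*" |
          u u' where "u \<in> V" "u' \<in> V" "(x, u) \<in> E\<^sup>*" "(u, v) \<in> H" "(v, u') \<in> H" "(u', y) \<in> E\<^sup>*"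
          by blast
        then show False
        proof cases
          case 1
          then show False using yx a cyc by blast
        next
          case 2
          \<comment> \<open>The cycle is rotated so that it starts and ends at
            \<open>v\<close>.\<close>
          then have "(u', u) \<in> E\<^sup>*" using yx by (meson rtrancl_into_rtrancl rtrancl_trans)
          then show False using a 2 by blast
        qed
      next
        case 2
        then show False using R(3)[of y] xy(1) E'D(3) a by blast
      next
        case 3
        then show False using R(2)[of x] xy(1) E'D(3) a by blast
      qed
    qed
  qed
qed

text \<open>\<open>None\<close> is a dead end: a cycle never disappears when vertices are added. The
  reflexive closure records all types in use. The relation on types need not be transitive, since
  two paths may meet in a type without meeting in a vertex.\<close>

definition summary :: "('a \<Rightarrow> 't) \<Rightarrow> ('a \<times> 'a) set \<Rightarrow> 'a set \<Rightarrow> ('t \<times> 't) set option" where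
  "summary \<tau> H V = (if acyclic (H \<inter> V \<times> V)
     then Some {(\<tau> x, \<tau> y) | x y. x \<in> V \<and> y \<in> V \<and> (x, y) \<in> (H \<inter> V \<times> V)\<^sup>*} else None)"

text \<open>\<open>to\<close> selects the types with a forced arc into the new vertex,
  \<open>from\<close> those with one out of it. As \<open>S\<close> contains \<open>(a, a)\<close>
  for every type in use, the test also detects a 2-cycle with a single earlier vertex.\<close>

definition extend :: "('t \<Rightarrow> bool) \<Rightarrow> ('t \<Rightarrow> bool) \<Rightarrow> 't \<Rightarrow> ('t \<times> 't) set \<Rightarrow> ('t \<times> 't) set option" where
  "extend to from t S =
    (if \<exists>a b. (a, b) \<in> S \<and> from a \<and> to b then None
     else Some (S \<union> {(t, t)} \<union> {(a, t) |a. \<exists>u. (a, u) \<in> S \<and> to u} \<union>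
       {(t, b) |b. \<exists>u. from u \<and> (u, b) \<in> S} \<union>
       {(a, b) |a b. \<exists>u u'. (a, u) \<in> S \<and> to u \<and> from u' \<and> (u', b) \<in> S}))"

text \<open>\<open>Q\<close> and \<open>Q'\<close> stand for reachability before and after the
  insertion. Passing to types is exact because \<open>to\<close> and \<open>from\<close> look at
  types only.\<close>

lemma image_extend:
  assumes R1: "\<And>x y. x \<in> V \<Longrightarrow> y \<in> V \<Longrightarrow> (x, y) \<in> Q' \<longleftrightarrow> (x, y) \<in> Q \<or>
      (\<exists>u\<in>V. \<exists>u'\<in>V. (x, u) \<in> Q \<and> to (\<tau> u) \<and> from (\<tau> u') \<and> (u', y) \<in> Q)"
    and R2: "\<And>x. x \<in> V \<Longrightarrow> (x, v) \<in> Q' \<longleftrightarrow> (\<exists>u\<in>V. (x, u) \<in> Q \<and> to (\<tau> u))"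
    and R3: "\<And>y. y \<in> V \<Longrightarrow> (v, y) \<in> Q' \<longleftrightarrow> (\<exists>u\<in>V. from (\<tau> u) \<and> (u, y) \<in> Q)"
    and R4: "(v, v) \<in> Q'"
  defines "S \<equiv> {(\<tau> x, \<tau> y) | x y. x \<in> V \<and> y \<in> V \<and> (x, y) \<in> Q}"
  shows "{(\<tau> x, \<tau> y) | x y. x \<in> insert v V \<and> y \<in> insert v V \<and> (x, y) \<in> Q'} =
    S \<union> {(\<tau> v, \<tau> v)} \<union> {(a, \<tau> v) |a. \<exists>u. (a, u) \<in> S \<and> to u} \<union>
    {(\<tau> v, b) |b. \<exists>u. from u \<and> (u, b) \<in> S} \<union>
    {(a, b) |a b. \<exists>u u'. (a, u) \<in> S \<and> to u \<and> from u' \<and> (u', b) \<in> S}" (is "?L = ?R")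
proof (rule equalityI; rule subrelI)
  have SI: "(\<tau> x, \<tau> y) \<in> S" if "x \<in> V" "y \<in> V" "(x, y) \<in> Q" for x y
    using that unfolding S_def by blast
  fix a b assume "(a, b) \<in> ?L"
  then obtain x y where xy: "a = \<tau> x" "b = \<tau> y" "(x, y) \<in> Q'" "x \<in> insert v V" "y \<in> insert v V"
    by blast
  consider "x = v" "y = v" | "x = v" "y \<in> V" | "x \<in> V" "y = v" | "x \<in> V" "y \<in> V"
    using xy by blast
  then show "(a, b) \<in> ?R"
  proof cases
    case 1
    then show ?thesis using xy by simp
  next
    case 2
    then show ?thesis using xy R3[of y] SI by blast
  next
    case 3
    then show ?thesis using xy R2[of x] SI by blast
  next
    case 4
    then show ?thesis using xy R1[of x y] SI by blast
  qed
next
  have SE: "\<exists>x y. a = \<tau> x \<and> b = \<tau> y \<and> x \<in> V \<and> y \<in> V \<and> (x, y) \<in> Q" if "(a, b) \<in> S" for a b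
    using that unfolding S_def by blast
  fix a b assume "(a, b) \<in> ?R"
  then consider "(a, b) \<in> S" | "a = \<tau> v" "b = \<tau> v" | u where "b = \<tau> v" "(a, u) \<in> S" "to u"
    | u where "a = \<tau> v" "from u" "(u, b) \<in> S" | u u' where "(a, u) \<in> S" "to u" "from u'" "(u', b) \<in> S"
    by blast
  then have "\<exists>x y. a = \<tau> x \<and> b = \<tau> y \<and> x \<in> insert v V \<and> y \<in> insert v V \<and> (x, y) \<in> Q'"
  proof cases
    case 1
    then show ?thesis using SE[of a b] R1 by blast
  next
    case 2
    then show ?thesis using R4 by blast
  next
    case 3
    then show ?thesis using SE[of a u] R2 by blast
  next
    case 4
    then show ?thesis using SE[of u b] R3 by blast
  next
    case 5
    \<comment> \<open>The two pairs come from paths that may have nothing in common; the new vertex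
      links them, whichever representatives of the types are taken.\<close>
    obtain x1 x2 where x: "a = \<tau> x1" "u = \<tau> x2" "x1 \<in> V" "x2 \<in> V" "(x1, x2) \<in> Q" using SE 5(1) by blast
    obtain y1 y2 where y: "u' = \<tau> y1" "b = \<tau> y2" "y1 \<in> V" "y2 \<in> V" "(y1, y2) \<in> Q" using SE 5(4) by blast
    have "(x1, y2) \<in> Q'" using R1[of x1 y2] x y 5 by blast
    then show ?thesis using x y by blast
  qed
  then show "(a, b) \<in> ?L" by blast
qed

text \<open>This makes a finite automaton possible: if the arcs at \<open>v\<close> depend only on
  the type of the other end, then the new summary is a function of the old one.\<close>

lemma summary_insert:
  assumes v: "v \<notin> V" "(v, v) \<notin> H"
    and to: "\<And>u. u \<in> V \<Longrightarrow> (u, v) \<in> H \<longleftrightarrow> to (\<tau> u)"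
    and from_v: "\<And>u. u \<in> V \<Longrightarrow> (v, u) \<in> H \<longleftrightarrow> from (\<tau> u)"
  shows "summary \<tau> H (insert v V) = Option.bind (summary \<tau> H V) (extend to from (\<tau> v))"
proof -
  define Q where "Q = (H \<inter> V \<times> V)\<^sup>*"
  define Q' where "Q' = (H \<inter> insert v V \<times> insert v V)\<^sup>*"
  note R = rtrancl_insert_vertex[OF v, folded Q_def Q'_def]
  note A = acyclic_insert_vertex[OF v, folded Q_def Q'_def]
  let ?S = "{(\<tau> x, \<tau> y) | x y. x \<in> V \<and> y \<in> V \<and> (x, y) \<in> Q}"
  have ex: "(\<exists>a b. (a, b) \<in> ?S \<and> from a \<and> to b) \<longleftrightarrow>
    (\<exists>u\<in>V. \<exists>u'\<in>V. (v, u) \<in> H \<and> (u, u') \<in> Q \<and> (u', v) \<in> H)"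
    using to from_v by blast
  show ?thesis
  proof (cases "acyclic (H \<inter> V \<times> V) \<and> \<not> (\<exists>a b. (a, b) \<in> ?S \<and> from a \<and> to b)")
    case False
    then have "\<not> acyclic (H \<inter> insert v V \<times> insert v V)" unfolding A ex by blast
    then have "summary \<tau> H (insert v V) = None" by (simp only: summary_def if_False)
    moreover have "Option.bind (summary \<tau> H V) (extend to from (\<tau> v)) = None"
    proof (cases "acyclic (H \<inter> V \<times> V)")
      case True
      then have "extend to from (\<tau> v) ?S = None" using False unfolding extend_def by (simp only: if_True simp_thms)
      then show ?thesis using True unfolding summary_def Q_def[symmetric] by (simp only: if_True Option.bind.simps)
    qed (simp add: summary_def)
    ultimately show ?thesis by simp
  next
    case True
    have eq: "{(\<tau> x, \<tau> y) | x y. x \<in> insert v V \<and> y \<in> insert v V \<and> (x, y) \<in> Q'} =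
      ?S \<union> {(\<tau> v, \<tau> v)} \<union> {(a, \<tau> v) |a. \<exists>u. (a, u) \<in> ?S \<and> to u} \<union>
       {(\<tau> v, b) |b. \<exists>u. from u \<and> (u, b) \<in> ?S} \<union>
       {(a, b) |a b. \<exists>u u'. (a, u) \<in> ?S \<and> to u \<and> from u' \<and> (u', b) \<in> ?S}"
    proof (rule image_extend)
      show "(v, v) \<in> Q'" by (simp add: Q'_def)
      show "(x, v) \<in> Q' \<longleftrightarrow> (\<exists>u\<in>V. (x, u) \<in> Q \<and> to (\<tau> u))" if "x \<in> V" for x
        using R(2)[OF that] to by blast
      show "(v, y) \<in> Q' \<longleftrightarrow> (\<exists>u\<in>V. from (\<tau> u) \<and> (u, y) \<in> Q)" if "y \<in> V" for y
        using R(3)[OF that] from_v by blast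
      show "(x, y) \<in> Q' \<longleftrightarrow> (x, y) \<in> Q \<or>
        (\<exists>u\<in>V. \<exists>u'\<in>V. (x, u) \<in> Q \<and> to (\<tau> u) \<and> from (\<tau> u') \<and> (u', y) \<in> Q)" if "x \<in> V" "y \<in> V" for x y
        using R(1)[OF that] to from_v by blast
    qed
    have "acyclic (H \<inter> insert v V \<times> insert v V)" using A ex True by blast
    then have "summary \<tau> H (insert v V) =
        Some {(\<tau> x, \<tau> y) | x y. x \<in> insert v V \<and> y \<in> insert v V \<and> (x, y) \<in> Q'}"
      by (simp only: summary_def Q'_def if_True)
    moreover have "summary \<tau> H V = Some ?S" using True by (simp only: summary_def Q_def if_True)
    ultimately show ?thesis using True unfolding eq extend_def by (simp only: Option.bind.simps if_False)
  qed
qed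

lemma summary_singleton: "(v, v) \<notin> H \<Longrightarrow> summary \<tau> H {v} = Some {(\<tau> v, \<tau> v)}"
proof -
  assume "(v, v) \<notin> H"
  then have "H \<inter> {v} \<times> {v} = {}" by auto
  then show ?thesis by (auto simp: summary_def acyclic_def)
qed

section \<open>The automaton\<close>

text \<open>
  While vertex \<open>i\<close> is added to a realisation of the vertices below \<open>i\<close>, every vertex has a type
  \<open>(s, b)\<close>: \<open>b\<close> is its new letter, and \<open>s\<close> is \<open>2 * a + e\<close> if its old letter is \<open>a\<close> and \<open>e\<close> tells
  whether it is adjacent to \<open>i\<close>. Vertex \<open>i\<close> itself, read first, has \<open>s = 2 * k\<close>. The types of two
  vertices determine their adjacency, in the old decoder \<open>D\<close>.
\<close>

definition type_adj :: "nat \<Rightarrow> (nat \<times> nat) set \<Rightarrow> nat \<Rightarrow> nat \<Rightarrow> bool" where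
  "type_adj k D s' s = (if s' = 2 * k then odd s else (s' div 2, s div 2) \<in> D)"

type_synonym vtype = "nat \<times> nat"
type_synonym astate = "(nat \<times> nat) set \<times> (nat \<times> nat) set \<times> (vtype \<times> vtype) set option"

text \<open>\<open>t\<close> is the type of the vertex being read, \<open>t'\<close> that of a
  vertex read earlier. The actual adjacency is recovered from the old decoder, with the earlier
  vertex as first argument, and compared with what the new decoder would yield for the opposite
  order.\<close>

definition before_new :: "nat \<Rightarrow> (nat \<times> nat) set \<Rightarrow> (nat \<times> nat) set \<Rightarrow> vtype \<Rightarrow> vtype \<Rightarrow> bool" where
  "before_new k D D' t t' = (type_adj k D (fst t') (fst t) \<noteq> ((snd t, snd t') \<in> D'))"

definition after_new :: "nat \<Rightarrow> (nat \<times> nat) set \<Rightarrow> (nat \<times> nat) set \<Rightarrow> vtype \<Rightarrow> vtype \<Rightarrow> bool" where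
  "after_new k D D' t t' = (type_adj k D (fst t') (fst t) \<noteq> ((snd t', snd t) \<in> D'))"

text \<open>Both decoders travel unchanged in the state, so a single transition table serves all
  pairs of decoders.\<close>

definition astep :: "nat \<Rightarrow> astate \<Rightarrow> nat \<Rightarrow> nat \<Rightarrow> astate" where
  "astep k q s b = (case q of (D, D', S) \<Rightarrow>
     (D, D', Option.bind S (extend (before_new k D D' (s, b)) (after_new k D D' (s, b)) (s, b))))"

definition ainit :: "nat \<Rightarrow> (nat \<times> nat) set \<Rightarrow> (nat \<times> nat) set \<Rightarrow> nat \<Rightarrow> astate" where
  "ainit k D D' b = (D, D', Some {((2 * k, b), (2 * k, b))})"

primrec arun :: "nat \<Rightarrow> astate \<Rightarrow> (nat \<Rightarrow> nat) \<Rightarrow> (nat \<Rightarrow> nat) \<Rightarrow> nat \<Rightarrow> astate" where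
  "arun k q s b 0 = q"
| "arun k q s b (Suc j) = astep k (arun k q s b j) (s j) (b j)"

definition sym_of :: "(nat \<Rightarrow> nat \<Rightarrow> bool) \<Rightarrow> (nat \<Rightarrow> nat) \<Rightarrow> nat \<Rightarrow> nat \<Rightarrow> nat" where
  "sym_of adj l i x = 2 * l x + of_bool (adj i x)"

text \<open>\<open>p\<close> lists the vertices in order and is thus, up to a shift by one, the
  inverse of the position map of a letter realisation. Since adjacency is symmetric, pairs with
  \<open>a < b\<close> say everything.\<close>

definition realises :: "(nat \<Rightarrow> nat \<Rightarrow> bool) \<Rightarrow> nat \<Rightarrow> nat \<Rightarrow> (nat \<times> nat) set \<Rightarrow> (nat \<Rightarrow> nat) \<Rightarrow> (nat \<Rightarrow> nat) \<Rightarrow> bool" where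
  "realises adj k m D l p \<longleftrightarrow> bij_betw p {..<m} {..<m} \<and> (\<forall>x<m. l x < k) \<and>
     (\<forall>a b. a < b \<longrightarrow> b < m \<longrightarrow> adj (p a) (p b) = ((l (p a), l (p b)) \<in> D))"

text \<open>Adjacency to the vertex being read can be computed from types: for a vertex read earlier
  the old decoder decides, because the word follows the old order, and for the new vertex
  \<open>i\<close> the bit in the symbol does.\<close>

lemma arun_summary:
  assumes real: "realises adj k i D l p" and sym: "\<And>x y. adj x y = adj y x" and "j \<le> i"
    and b: "\<And>j. j < i \<Longrightarrow> l' (p j) = b j"
  defines "\<tau> \<equiv> \<lambda>x. (if x = i then 2 * k else sym_of adj l i x, l' x)"
  shows "arun k (ainit k D D' (l' i)) (\<lambda>j. sym_of adj l i (p j)) b j =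
    (D, D', summary \<tau> (forced adj D' l') (insert i (p ` {..<j})))"
  using \<open>j \<le> i\<close>
proof (induction j)
  case 0
  show ?case by (simp add: ainit_def summary_singleton forced_def \<tau>_def)
next
  case (Suc j)
  have p: "inj_on p {..<i}" "\<And>a. a < i \<Longrightarrow> p a < i" "\<And>a. a < i \<Longrightarrow> l (p a) < k"
    and pa: "\<And>a c. a < c \<Longrightarrow> c < i \<Longrightarrow> adj (p a) (p c) = ((l (p a), l (p c)) \<in> D)"
    using real unfolding realises_def by (auto simp: bij_betw_def)
  let ?V = "insert i (p ` {..<j})" and ?H = "forced adj D' l'"
  let ?t = "(sym_of adj l i (p j), b j)"
  have t: "\<tau> (p j) = ?t" using p(2)[of j] Suc.prems b[of j] by (simp add: \<tau>_def)
  have V: "p j \<notin> ?V"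
  proof
    assume "p j \<in> ?V"
    moreover have "p j < i" using p(2) Suc.prems by simp
    ultimately obtain a where "a < j" "p a = p j" by fastforce
    then show False using inj_onD[OF p(1), of a j] Suc.prems by simp
  qed
  have adj: "adj u (p j) = type_adj k D (fst (\<tau> u)) (fst ?t)" if "u \<in> ?V" for u
  proof (cases "u = i")
    case True
    then show ?thesis by (simp add: \<tau>_def type_adj_def sym_of_def)
  next
    case False
    then obtain a where a: "a < j" "u = p a" using \<open>u \<in> ?V\<close> by auto
    then have "u \<noteq> i" "sym_of adj l i u \<noteq> 2 * k" "sym_of adj l i u div 2 = l u"
      using p(2,3)[of a] Suc.prems by (auto simp: sym_of_def)
    moreover have "sym_of adj l i (p j) div 2 = l (p j)" by (auto simp: sym_of_def)
    ultimately show ?thesis using pa[of a j] a Suc.prems by (simp add: \<tau>_def type_adj_def)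
  qed
  have tl: "snd (\<tau> u) = l' u" for u by (simp add: \<tau>_def)
  have ne: "u \<noteq> p j" if "u \<in> ?V" for u using V that by blast
  have "summary \<tau> ?H (insert (p j) ?V) = Option.bind (summary \<tau> ?H ?V)
    (extend (before_new k D D' ?t) (after_new k D D' ?t) (\<tau> (p j)))"
  proof (rule summary_insert[OF V])
    show "(p j, p j) \<notin> ?H" by (simp add: forced_def)
    fix u assume u: "u \<in> ?V"
    show "(u, p j) \<in> ?H \<longleftrightarrow> before_new k D D' ?t (\<tau> u)"
      using ne[OF u] adj[OF u] tl[of u] b[of j] Suc.prems
      by (simp add: forced_def before_new_def)
    show "(p j, u) \<in> ?H \<longleftrightarrow> after_new k D D' ?t (\<tau> u)"
      using ne[OF u] adj[OF u] tl[of u] b[of j] Suc.prems sym[of "p j" u]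
      by (simp add: forced_def after_new_def)
  qed
  moreover have "insert (p j) ?V = insert i (p ` {..<Suc j})"
    by (auto simp: lessThan_Suc)
  ultimately have "summary \<tau> ?H (insert i (p ` {..<Suc j})) = Option.bind (summary \<tau> ?H ?V)
    (extend (before_new k D D' ?t) (after_new k D D' ?t) ?t)" by (simp only: t)
  moreover have "arun k (ainit k D D' (l' i)) (\<lambda>j. sym_of adj l i (p j)) b j = (D, D', summary \<tau> ?H ?V)"
    by (rule Suc.IH) (use Suc.prems in simp)
  ultimately show ?case by (simp only: arun.simps astep_def prod.case)
qed

definition astates :: "nat \<Rightarrow> astate set" where
  "astates k = Pow ({..<k} \<times> {..<k}) \<times> Pow ({..<k} \<times> {..<k}) \<times>
     insert None (Some ` Pow (({..2 * k} \<times> {..<k}) \<times> ({..2 * k} \<times> {..<k})))"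

lemma astep_in_astates:
  assumes "q \<in> astates k" "s < 2 * k" "b < k"
  shows "astep k q s b \<in> astates k"
proof -
  obtain D D' S where q: "q = (D, D', S)" by (cases q)
  let ?T = "{..2 * k} \<times> {..<k}"
  have T: "(s, b) \<in> ?T" using assms by auto
  have *: "extend f g t S' \<in> insert None (Some ` Pow (?T \<times> ?T))"
    if "S' \<subseteq> ?T \<times> ?T" "t \<in> ?T" for f g S' and t :: vtype
  proof -
    have "extend f g t S' = None \<or> (\<exists>S''. extend f g t S' = Some S'' \<and> S'' \<subseteq> ?T \<times> ?T)"
      using that unfolding extend_def by (simp split: if_split) blast
    then show ?thesis by blast
  qed
  have "Option.bind S (extend f g (s, b)) \<in> insert None (Some ` Pow (?T \<times> ?T))" for f g
    using assms(1) *[OF _ T] by (cases S) (auto simp: q astates_def simp del: insert_iff)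
  then show ?thesis using assms(1) by (simp add: q astates_def astep_def)
qed

lemma ainit_in_astates:
  assumes "D \<subseteq> {..<k} \<times> {..<k}" "D' \<subseteq> {..<k} \<times> {..<k}" "b < k"
  shows "ainit k D D' b \<in> astates k"
  using assms by (auto simp: ainit_def astates_def)

lemma finite_astates: "finite (astates k)"
  by (simp add: astates_def)

text \<open>There are \<open>(2 * k + 1) * k\<close>, hence at most 3k^2 types, and so at most 9k^4
  pairs of types. The two decoders and \<open>None\<close> add k^2 + k^2 + 1 to the exponent, which
  is at most 3k^4.\<close>

lemma card_astates: "k \<ge> 1 \<Longrightarrow> card (astates k) \<le> 2 ^ (12 * k ^ 4)"
proof -
  assume k: "k \<ge> 1"
  let ?m = "((2 * k + 1) * k) ^ 2"
  have "card (astates k) = 2 ^ (k * k) * (2 ^ (k * k) * Suc (2 ^ ?m))"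
    unfolding astates_def
    by (simp add: card_cartesian_product card_Pow card_insert_if card_image power2_eq_square del: insert_iff)
  also have "\<dots> \<le> 2 ^ (k * k) * (2 ^ (k * k) * 2 ^ (?m + 1))"
    by (intro mult_le_mono order_refl) simp
  also have "\<dots> = 2 ^ (k * k + (k * k + (?m + 1)))" by (simp add: power_add)
  also have "\<dots> \<le> 2 ^ (12 * k ^ 4)"
  proof (rule power_increasing)
    have kk: "k ^ 2 \<le> k ^ 4" "1 \<le> k ^ 4" using k by (auto intro: power_increasing one_le_power)
    have "(2 * k + 1) * k \<le> (3 * k) * k" using k by (intro mult_le_mono) auto
    then have "?m \<le> ((3 * k) * k) ^ 2" by (rule power_mono) simp
    also have "\<dots> = 9 * k ^ 4" by (simp add: power2_eq_square power4_eq_xxxx)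
    finally have m: "?m \<le> 9 * k ^ 4" .
    show "k * k + (k * k + (?m + 1)) \<le> 12 * k ^ 4"
      using kk m by (simp add: power2_eq_square del: One_nat_def)
  qed simp
  finally show ?thesis .
qed

text \<open>Any numbering will do. It is fixed together with \<open>k\<close>, before the program is
  written, and the machine only sees tables derived from it.\<close>

definition code :: "nat \<Rightarrow> astate \<Rightarrow> nat" where
  "code k = (SOME f. bij_betw f (astates k) {..<card (astates k)})"

definition dec :: "nat \<Rightarrow> nat \<Rightarrow> (nat \<times> nat) set" where
  "dec k = (SOME f. bij_betw f {..<(2::nat) ^ (k * k)} (Pow ({..<k} \<times> {..<k})))"

definition uncode :: "nat \<Rightarrow> nat \<Rightarrow> astate" where
  "uncode k = inv_into (astates k) (code k)"

definition nstep :: "nat \<Rightarrow> nat \<Rightarrow> nat \<Rightarrow> nat \<Rightarrow> nat" where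
  "nstep k q s b = code k (astep k (uncode k q) s b)"

text \<open>\<open>c\<close> packs the number of the new decoder and the letter of the new vertex,
  so that one loop can search through both.\<close>

definition ninit :: "nat \<Rightarrow> nat \<Rightarrow> nat \<Rightarrow> nat" where
  "ninit k d c = code k (ainit k (dec k d) (dec k (c div k)) (c mod k))"

definition nacc :: "nat \<Rightarrow> nat \<Rightarrow> bool" where
  "nacc k q \<longleftrightarrow> snd (snd (uncode k q)) \<noteq> None"

primrec nrun :: "nat \<Rightarrow> nat \<Rightarrow> (nat \<Rightarrow> nat) \<Rightarrow> (nat \<Rightarrow> nat) \<Rightarrow> nat \<Rightarrow> nat" where
  "nrun k q s b 0 = q"
| "nrun k q s b (Suc j) = nstep k (nrun k q s b j) (s j) (b j)"

lemma code_bij: "bij_betw (code k) (astates k) {..<card (astates k)}"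
proof -
  have "\<exists>f. bij_betw f (astates k) {..<card (astates k)}"
    using ex_bij_betw_finite_nat[OF finite_astates, of k] by (simp add: atLeast0LessThan)
  then show ?thesis unfolding code_def by (rule someI_ex)
qed

lemma dec_bij: "bij_betw (dec k) {..<(2::nat) ^ (k * k)} (Pow ({..<k} \<times> {..<k}))"
proof -
  have "\<exists>f. bij_betw f {..<(2::nat) ^ (k * k)} (Pow ({..<k} \<times> {..<k}))"
    using ex_bij_betw_nat_finite[of "Pow ({..<k} \<times> {..<k})"]
    by (simp add: atLeast0LessThan card_Pow card_cartesian_product)
  then show ?thesis unfolding dec_def by (rule someI_ex)
qed

lemma dec_subset: "d < 2 ^ (k * k) \<Longrightarrow> dec k d \<subseteq> {..<k} \<times> {..<k}"
  using bij_betwE[OF dec_bij, of k] by blast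

lemma dec_surj:
  assumes "D \<subseteq> {..<k} \<times> {..<k}"
  obtains d where "d < 2 ^ (k * k)" "dec k d = D"
proof -
  have "D \<in> dec k ` {..<2 ^ (k * k)}" using dec_bij[of k] assms by (simp add: bij_betw_def)
  then show ?thesis using that by auto
qed

lemma code_less: "q \<in> astates k \<Longrightarrow> code k q < card (astates k)"
  using code_bij[of k] by (auto simp: bij_betw_def)

lemma uncode_code: "q \<in> astates k \<Longrightarrow> uncode k (code k q) = q"
  unfolding uncode_def by (rule bij_betw_inv_into_left[OF code_bij])

lemma uncode_in: "q < card (astates k) \<Longrightarrow> uncode k q \<in> astates k"
  unfolding uncode_def using bij_betw_inv_into[OF code_bij, of k] by (auto simp: bij_betw_def)

lemma nstep_less: "q < card (astates k) \<Longrightarrow> s < 2 * k \<Longrightarrow> b < k \<Longrightarrow> nstep k q s b < card (astates k)"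
  unfolding nstep_def by (intro code_less astep_in_astates uncode_in)

lemma initial_in_astates:
  assumes "k \<ge> 1" "d < 2 ^ (k * k)" "c < 2 ^ (k * k) * k"
  shows "ainit k (dec k d) (dec k (c div k)) (c mod k) \<in> astates k"
  using assms by (intro ainit_in_astates dec_subset) (auto simp: less_mult_imp_div_less)

lemma ninit_less:
  assumes "k \<ge> 1" "d < 2 ^ (k * k)" "c < 2 ^ (k * k) * k"
  shows "ninit k d c < card (astates k)"
  unfolding ninit_def by (intro code_less initial_in_astates assms)

text \<open>As \<open>p\<close> permutes the vertices below \<open>i\<close>, the summary covers all
  vertices up to \<open>i\<close> once the word has been read. The guesses \<open>b\<close> are
  indexed by positions in the old order, the letters \<open>l'\<close> by vertices.\<close>

lemma nrun_correct:
  assumes k: "k \<ge> 1" and d: "d < 2 ^ (k * k)" and c: "c < 2 ^ (k * k) * k"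
    and real: "realises adj k i (dec k d) l p" and sym: "\<And>x y. adj x y = adj y x"
    and b: "\<And>j. j < i \<Longrightarrow> b j < k" "\<And>j. j < i \<Longrightarrow> l' (p j) = b j" "l' i = c mod k"
  shows "nacc k (nrun k (ninit k d c) (\<lambda>j. sym_of adj l i (p j)) b i) \<longleftrightarrow>
    acyclic (forced adj (dec k (c div k)) l' \<inter> {..<Suc i} \<times> {..<Suc i})"
proof -
  let ?q = "ainit k (dec k d) (dec k (c div k)) (c mod k)"
  let ?s = "\<lambda>j. sym_of adj l i (p j)"
  have p: "p ` {..<i} = {..<i}" "\<And>a. a < i \<Longrightarrow> l (p a) < k"
    using real unfolding realises_def by (auto simp: bij_betw_def)
  have s: "?s j < 2 * k" if "j < i" for j using p(2)[OF that] by (auto simp: sym_of_def)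
  have run: "arun k ?q ?s b j \<in> astates k \<and> nrun k (ninit k d c) ?s b j = code k (arun k ?q ?s b j)"
    if "j \<le> i" for j
    using that
  proof (induction j)
    case 0
    show ?case using initial_in_astates[OF k d c] by (simp add: ninit_def)
  next
    case (Suc j)
    then have "arun k ?q ?s b j \<in> astates k" "nrun k (ninit k d c) ?s b j = code k (arun k ?q ?s b j)"
      "j < i" by auto
    then show ?case using astep_in_astates[OF _ s[of j] b(1)[of j]]
      by (simp add: nstep_def uncode_code del: One_nat_def)
  qed
  have "arun k ?q ?s b i = (dec k d, dec k (c div k),
      summary (\<lambda>x. (if x = i then 2 * k else sym_of adj l i x, l' x))
        (forced adj (dec k (c div k)) l') (insert i (p ` {..<i})))"
    using arun_summary[where i = i and j = i and l' = l' and b = b, OF real sym order_refl b(2)] b(3) by simp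
  moreover have "insert i (p ` {..<i}) = {..<Suc i}" using p by auto
  moreover have "nacc k (nrun k (ninit k d c) ?s b i) \<longleftrightarrow> snd (snd (arun k ?q ?s b i)) \<noteq> None"
    using run[of i] unfolding nacc_def by (simp only: uncode_code order_refl)
  ultimately show ?thesis by (simp add: summary_def)
qed

section \<open>Dynamic programming over the automaton\<close>

text \<open>\<open>pick f m\<close> is one more than the last index below \<open>m\<close> satisfying \<open>f\<close>, and 0 if there is none.\<close>

primrec pick :: "(nat \<Rightarrow> bool) \<Rightarrow> nat \<Rightarrow> nat" where
  "pick f 0 = 0"
| "pick f (Suc b) = (if f b then Suc b else pick f b)"

lemma pick_neq_0: "pick f m \<noteq> 0 \<longleftrightarrow> (\<exists>b<m. f b)"
  by (induction m) (auto simp: less_Suc_eq)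

lemma pick_less: "pick f m \<noteq> 0 \<Longrightarrow> pick f m - 1 < m \<and> f (pick f m - 1)"
  by (induction m) (auto simp: less_Suc_eq split: if_splits)

lemma pick_le: "pick f m \<le> m"
  by (induction m) auto

lemma pick_cong: "(\<And>b. b < m \<Longrightarrow> f b = g b) \<Longrightarrow> pick f m = pick g m"
  by (induction m) auto

text \<open>
  Nonzero iff the automaton can accept the last \<open>m\<close> symbols from state \<open>q\<close>; then the value is one
  more than a letter to be guessed next (for \<open>m > 0\<close>).
\<close>

primrec goodv :: "nat \<Rightarrow> (nat \<Rightarrow> nat) \<Rightarrow> nat \<Rightarrow> nat \<Rightarrow> nat \<Rightarrow> nat" where
  "goodv k s i 0 q = of_bool (nacc k q)"
| "goodv k s i (Suc m) q = pick (\<lambda>b. goodv k s i m (nstep k q (s (i - Suc m)) b) \<noteq> 0) k"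

text \<open>The states visited when the stored choices are followed from \<open>q\<close>;
  subtracting 1 undoes the shift made by \<open>pick\<close>.\<close>

primrec trace :: "nat \<Rightarrow> (nat \<Rightarrow> nat) \<Rightarrow> nat \<Rightarrow> nat \<Rightarrow> nat \<Rightarrow> nat" where
  "trace k s i q 0 = q"
| "trace k s i q (Suc j) = nstep k (trace k s i q j) (s j) (goodv k s i (i - j) (trace k s i q j) - 1)"

text \<open>Induction from the end of the word: at each position the letter of the given accepting
  run is a possible choice.\<close>

lemma goodv_complete:
  assumes "\<And>j. j < i \<Longrightarrow> b j < k" "nacc k (nrun k q s b i)" "m \<le> i"
  shows "goodv k s i m (nrun k q s b (i - m)) \<noteq> 0"
  using \<open>m \<le> i\<close>
proof (induction m)
  case 0
  then show ?case using assms by simp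
next
  case (Suc m)
  have "i - m = Suc (i - Suc m)" using Suc.prems by simp
  then have "goodv k s i m (nstep k (nrun k q s b (i - Suc m)) (s (i - Suc m)) (b (i - Suc m))) \<noteq> 0"
    using Suc by simp
  moreover have "b (i - Suc m) < k" using assms(1)[of "i - Suc m"] Suc.prems by simp
  ultimately show ?case unfolding goodv.simps pick_neq_0 by blast
qed

text \<open>A letter returned by \<open>pick\<close> leads to a state with a nonzero value again, so
  the trace never gets stuck.\<close>

lemma trace_good:
  assumes "goodv k s i i q \<noteq> 0" "j \<le> i"
  shows "goodv k s i (i - j) (trace k s i q j) \<noteq> 0"
  using \<open>j \<le> i\<close>
proof (induction j)
  case 0
  then show ?case using assms by simp
next
  case (Suc j)
  then have *: "i - j = Suc (i - Suc j)" "i - Suc (i - Suc j) = j" by auto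
  have "goodv k s i (Suc (i - Suc j)) (trace k s i q j) \<noteq> 0" using Suc * by simp
  from pick_less[OF this[unfolded goodv.simps]] show ?case using * by (simp del: goodv.simps(1)) 
qed

lemma trace_letter:
  assumes "goodv k s i i q \<noteq> 0" "j < i"
  shows "goodv k s i (i - j) (trace k s i q j) - 1 < k"
proof -
  have *: "i - j = Suc (i - Suc j)" using assms by auto
  have "goodv k s i (Suc (i - Suc j)) (trace k s i q j) \<noteq> 0"
    using trace_good[OF assms(1), of j] assms(2) * by simp
  from pick_less[OF this[unfolded goodv.simps]] show ?thesis unfolding * by simp
qed

lemma trace_nrun: "trace k s i q j = nrun k q s (\<lambda>j. goodv k s i (i - j) (trace k s i q j) - 1) j"
  by (induction j) auto

lemma trace_acc:
  assumes "goodv k s i i q \<noteq> 0"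
  shows "nacc k (nrun k q s (\<lambda>j. goodv k s i (i - j) (trace k s i q j) - 1) i)"
proof -
  have "nacc k (trace k s i q i)" using trace_good[OF assms, of i] by simp
  then show ?thesis by (subst trace_nrun[symmetric])
qed

section \<open>Topological sorting\<close>

text \<open>\<open>P\<close> is the set of vertices already placed; only predecessors still to be
  placed are counted.\<close>

definition indeg :: "(nat \<times> nat) set \<Rightarrow> nat \<Rightarrow> nat set \<Rightarrow> nat \<Rightarrow> nat" where
  "indeg F m P x = card {y. y < m \<and> (y, x) \<in> F \<and> y \<notin> P}"

lemma exists_source:
  assumes "acyclic (F \<inter> {..<m} \<times> {..<m})" "P \<subset> {..<m}"
  obtains x where "x < m" "x \<notin> P" "indeg F m P x = 0"
proof -
  let ?E = "F \<inter> {..<m} \<times> {..<m}"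
  have "finite ?E" by simp
  then have "wf ?E" using assms(1) by (rule finite_acyclic_wf)
  moreover obtain z where "z \<in> {..<m} - P" using assms(2) by blast
  ultimately obtain x where x: "x \<in> {..<m} - P" "\<And>y. (y, x) \<in> ?E \<Longrightarrow> y \<notin> {..<m} - P"
    by (rule wfE_min) blast
  then have "{y. y < m \<and> (y, x) \<in> F \<and> y \<notin> P} = {}" by blast
  then show ?thesis using that[of x] x by (simp add: indeg_def)
qed

lemma indeg_insert:
  assumes "z < m" "z \<notin> P"
  shows "indeg F m (insert z P) x = indeg F m P x - of_bool ((z, x) \<in> F)"
proof -
  let ?A = "{y. y < m \<and> (y, x) \<in> F \<and> y \<notin> P}"
  have "{y. y < m \<and> (y, x) \<in> F \<and> y \<notin> insert z P} = ?A - {z}" by auto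
  moreover have "card (?A - {z}) = card ?A - of_bool (z \<in> ?A)"
    by (simp add: card_Diff_singleton_if)
  ultimately show ?thesis using assms by (simp add: indeg_def)
qed

definition sorted_upto :: "(nat \<times> nat) set \<Rightarrow> nat \<Rightarrow> (nat \<Rightarrow> nat) \<Rightarrow> nat \<Rightarrow> bool" where
  "sorted_upto F m p t \<longleftrightarrow> inj_on p {..<t} \<and> p ` {..<t} \<subseteq> {..<m} \<and>
     (\<forall>s<t. \<forall>y<m. (y, p s) \<in> F \<longrightarrow> y \<in> p ` {..<s})"

lemma sorted_upto_Suc:
  assumes "sorted_upto F m p t" "z < m" "z \<notin> p ` {..<t}" "indeg F m (p ` {..<t}) z = 0"
  shows "sorted_upto F m (p(t := z)) (Suc t)"
proof -
  have "\<forall>y<m. (y, z) \<in> F \<longrightarrow> y \<in> p ` {..<t}"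
    using assms(4) by (auto simp: indeg_def)
  moreover have im: "(p(t := z)) ` {..<s} = p ` {..<s}" if "s \<le> t" for s using that by auto
  moreover have "inj_on (p(t := z)) {..<Suc t}"
    using assms(1,3) unfolding sorted_upto_def lessThan_Suc by (auto simp: inj_on_def)
  moreover have "(p(t := z)) ` {..<Suc t} \<subseteq> {..<m}"
    using assms(1,2) unfolding sorted_upto_def lessThan_Suc by auto
  moreover have "y \<in> (p(t := z)) ` {..<s}" if "s < Suc t" "y < m" "(y, (p(t := z)) s) \<in> F" for s y
  proof (cases "s = t")
    case True
    then show ?thesis using that calculation(1) unfolding im[OF eq_imp_le[OF True]] by simp
  next
    case False
    then have "s < t" using that by simp
    then show ?thesis using that assms(1) unfolding im[OF less_imp_le[OF \<open>s < t\<close>]] sorted_upto_def by auto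
  qed
  ultimately show ?thesis unfolding sorted_upto_def by blast
qed

text \<open>A pair with the wrong adjacency would be forced the other way round, by symmetry of
  \<open>adj\<close>. Then the later vertex would have been placed before the earlier one.\<close>

lemma sorted_realises:
  assumes "sorted_upto (forced adj D l) m p m" "\<And>x. x < m \<Longrightarrow> l x < k" "\<And>x y. adj x y = adj y x"
  shows "realises adj k m D l p"
proof -
  have p: "inj_on p {..<m}" "p ` {..<m} \<subseteq> {..<m}"
    and f: "\<And>s y. s < m \<Longrightarrow> y < m \<Longrightarrow> (y, p s) \<in> forced adj D l \<Longrightarrow> y \<in> p ` {..<s}"
    using assms(1) unfolding sorted_upto_def by auto
  have "p ` {..<m} = {..<m}" using p by (intro card_subset_eq) (auto simp: card_image)
  moreover have "adj (p a) (p b) = ((l (p a), l (p b)) \<in> D)" if ab: "a < b" "b < m" for a b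
  proof (rule ccontr)
    assume "adj (p a) (p b) \<noteq> ((l (p a), l (p b)) \<in> D)"
    moreover have "p a \<noteq> p b" using inj_onD[OF p(1), of a b] ab by auto
    ultimately have "(p b, p a) \<in> forced adj D l" using assms(3)[of "p a" "p b"] by (auto simp: forced_def)
    then obtain c where c: "c < a" "p b = p c" using f[of a "p b"] p(2) ab by auto
    then show False using inj_onD[OF p(1), of b c] ab by auto
  qed
  ultimately show ?thesis using p assms(2) by (simp add: realises_def bij_betw_def)
qed

section \<open>Expressions of the program\<close>

text \<open>
  Registers: 0 \<open>n\<close>, 1 start of the working memory, 2 current vertex \<open>i\<close>, 3 decoder, 4 success flag;
  the others are local. The working memory is a matrix with \<open>n + 1\<close> columns. Row 0: the
  vertices in their current order, row 1: their letters, row 2: indegrees, row \<open>3 + q\<close>: values of the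
  dynamic program for state \<open>q\<close>.
\<close>

definition add :: "expr \<Rightarrow> expr \<Rightarrow> expr" where "add = Bi Add"
definition sub :: "expr \<Rightarrow> expr \<Rightarrow> expr" where "sub = Bi Sub"
definition mul :: "expr \<Rightarrow> expr \<Rightarrow> expr" where "mul = Bi Mul"

lemma eval_arith [simp]:
  "eval (add a b) R M = eval a R M + eval b R M"
  "eval (sub a b) R M = eval a R M - eval b R M"
  "eval (mul a b) R M = eval a R M * eval b R M"
  by (simp_all add: add_def sub_def mul_def)

lemma safe_arith [simp]:
  "safe w (add a b) R M \<longleftrightarrow> safe w a R M \<and> safe w b R M \<and> eval a R M + eval b R M < 2 ^ w"
  "safe w (sub a b) R M \<longleftrightarrow> safe w a R M \<and> safe w b R M"
  "safe w (mul a b) R M \<longleftrightarrow> safe w a R M \<and> safe w b R M \<and> eval a R M * eval b R M < 2 ^ w"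
  by (auto simp: add_def sub_def mul_def)

lemma well_arith [simp]:
  "well (add a b) \<longleftrightarrow> well a \<and> well b" "well (sub a b) \<longleftrightarrow> well a \<and> well b"
  "well (mul a b) \<longleftrightarrow> well a \<and> well b"
  by (simp_all add: add_def sub_def mul_def)

lemma cost_arith [simp]:
  "cost (add a b) = cost a + cost b + 1" "cost (sub a b) = cost a + cost b + 1"
  "cost (mul a b) = cost a + cost b + 1"
  by (simp_all add: add_def sub_def mul_def)

definition Tab2 :: "nat \<Rightarrow> nat \<Rightarrow> (nat \<Rightarrow> nat \<Rightarrow> nat) \<Rightarrow> expr \<Rightarrow> expr \<Rightarrow> expr" where
  "Tab2 m1 m2 f a b = Tab (map (\<lambda>z. f (z div m2) (z mod m2)) [0..<m1 * m2]) (add (mul a (Cn m2)) b)"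

lemma index_less: "a < m1 \<Longrightarrow> b < m2 \<Longrightarrow> a * m2 + b < m1 * (m2 :: nat)"
proof -
  assume "a < m1" "b < m2"
  then have "a * m2 + b < Suc a * m2" by simp
  also have "\<dots> \<le> m1 * m2" using \<open>a < m1\<close> by (intro mult_le_mono) auto
  finally show ?thesis .
qed

lemma eval_Tab2:
  "eval a R M < m1 \<Longrightarrow> eval b R M < m2 \<Longrightarrow>
    eval (Tab2 m1 m2 f a b) R M = f (eval a R M) (eval b R M)"
  using index_less[of "eval a R M" m1 "eval b R M" m2] by (simp add: Tab2_def)

lemma safe_Tab2:
  assumes "eval a R M < m1" "eval b R M < m2" "m1 * m2 < 2 ^ w" "safe w a R M" "safe w b R M"
    "f (eval a R M) (eval b R M) < 2 ^ w"
  shows "safe w (Tab2 m1 m2 f a b) R M"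
proof -
  note i = index_less[OF assms(1,2)]
  have "1 * m2 \<le> m1 * m2" "eval a R M * m2 \<le> m1 * m2" using assms(1) by (intro mult_le_mono; simp)+
  then have "m2 < 2 ^ w" "eval a R M * m2 < 2 ^ w" using assms(3) by (metis le_less_trans mult_1)+
  moreover have "eval a R M * m2 + eval b R M < 2 ^ w" using i assms(3) by simp
  ultimately show ?thesis using assms i by (simp add: Tab2_def)
qed

lemma well_Tab2 [simp]: "well (Tab2 m1 m2 f a b) \<longleftrightarrow> well a \<and> well b"
  by (simp add: Tab2_def)

lemma cost_Tab2 [simp]: "cost (Tab2 m1 m2 f a b) = cost a + cost b + 4 * (m1 * m2) + 5"
  by (simp add: Tab2_def)

abbreviation nst :: "nat \<Rightarrow> nat" where "nst k \<equiv> card (astates k)"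
abbreviation ndec :: "nat \<Rightarrow> nat" where "ndec k \<equiv> 2 ^ (k * k)"

definition cellE :: "expr \<Rightarrow> expr \<Rightarrow> expr" where
  "cellE r c = add (Vr 1) (add (mul r (add (Vr 0) (Cn 1))) c)"

definition rd :: "expr \<Rightarrow> expr \<Rightarrow> expr" where
  "rd r c = Ld (cellE r c)"

definition adjE :: "expr \<Rightarrow> expr \<Rightarrow> expr" where
  "adjE x y = Ld (add (mul x (Vr 0)) y)"

definition stepE :: "nat \<Rightarrow> expr \<Rightarrow> expr \<Rightarrow> expr \<Rightarrow> expr" where
  "stepE k q s b = Tab2 (nst k) (2 * k * k) (\<lambda>q z. nstep k q (z div k) (z mod k)) q (add (mul s (Cn k)) b)"

definition accE :: "nat \<Rightarrow> expr \<Rightarrow> expr" where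
  "accE k q = Tab2 1 (nst k) (\<lambda>_ q. of_bool (nacc k q)) (Cn 0) q"

definition initE :: "nat \<Rightarrow> expr \<Rightarrow> expr \<Rightarrow> expr" where
  "initE k d c = Tab2 (ndec k) (ndec k * k) (ninit k) d c"

definition divE :: "nat \<Rightarrow> expr \<Rightarrow> expr" where "divE k c = Bi Div c (Cn k)"
text \<open>The machine has no remainder operation.\<close>

definition modE :: "nat \<Rightarrow> expr \<Rightarrow> expr" where "modE k c = sub c (mul (divE k c) (Cn k))"

definition symE :: "expr \<Rightarrow> expr" where
  "symE x = add (mul (Cn 2) (rd (Cn 1) x)) (adjE (Vr 2) x)"

text \<open>Decides whether \<open>(x, y)\<close> is forced, from the two letters and the adjacency
  bit. On the diagonal, where \<open>forced\<close> has no pairs, it may yield 1;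
  \<open>prog_indeg\<close> corrects for this.\<close>

definition arcE :: "nat \<Rightarrow> expr \<Rightarrow> expr \<Rightarrow> expr" where
  "arcE k x y = Tab2 (ndec k) (k * k * 2)
     (\<lambda>d z. of_bool (odd z \<noteq> ((z div 2 div k, z div 2 mod k) \<in> dec k d))) (Vr 3)
     (add (mul (add (mul (rd (Cn 1) y) (Cn k)) (rd (Cn 1) x)) (Cn 2)) (adjE x y))"

definition decE :: "nat \<Rightarrow> expr \<Rightarrow> expr" where
  "decE k e = Tab2 (ndec k) (k * k) (\<lambda>d z. of_bool ((z div k, z mod k) \<in> dec k d)) (Vr 3) e"

lemma well_exprs [simp]:
  "well (cellE r c) \<longleftrightarrow> well r \<and> well c" "well (rd r c) \<longleftrightarrow> well r \<and> well c"
  "well (adjE x y) \<longleftrightarrow> well x \<and> well y" "well (stepE k q s b) \<longleftrightarrow> well q \<and> well s \<and> well b"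
  "well (accE k q) \<longleftrightarrow> well q" "well (initE k d c) \<longleftrightarrow> well d \<and> well c"
  "well (divE k c) \<longleftrightarrow> well c" "well (modE k c) \<longleftrightarrow> well c" "well (symE x) \<longleftrightarrow> well x"
  "well (arcE k x y) \<longleftrightarrow> well x \<and> well y" "well (decE k x) \<longleftrightarrow> well x"
  by (auto simp: cellE_def rd_def adjE_def stepE_def accE_def initE_def divE_def modE_def symE_def
      arcE_def decE_def)

lemma cost_exprs [simp]:
  "cost (cellE r c) = cost r + cost c + 9" "cost (rd r c) = cost r + cost c + 10"
  "cost (adjE x y) = cost x + cost y + 5"
  "cost (stepE k q s b) = cost q + cost s + cost b + 4 * (nst k * (2 * k * k)) + 8"
  "cost (accE k q) = cost q + 4 * nst k + 6"
  "cost (initE k d c) = cost d + cost c + 4 * (ndec k * (ndec k * k)) + 5"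
  "cost (divE k c) = cost c + 2" "cost (modE k c) = 2 * cost c + 5"
  "cost (symE x) = 2 * cost x + 21"
  "cost (arcE k x y) = 2 * cost x + 2 * cost y + 4 * (ndec k * (k * k * 2)) + 40"
  "cost (decE k x) = cost x + 4 * (ndec k * (k * k)) + 7"
  by (auto simp: cellE_def rd_def adjE_def stepE_def accE_def initE_def divE_def modE_def symE_def
      arcE_def decE_def)

text \<open>An upper bound for the cost of every expression in the program.\<close>

definition cmax :: "nat \<Rightarrow> nat" where
  "cmax k = 4 * (nst k * (2 * k * k) + nst k + ndec k * (ndec k * k) + ndec k * (k * k * 2) + ndec k * (k * k)) + 200"

text \<open>The limits cover the largest memory address and the sizes of the tables. All overflow
  checks below are derived from these assumptions.\<close>

locale ram =
  fixes k n w :: nat and adj :: "nat \<Rightarrow> nat \<Rightarrow> bool"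
  assumes k1: "1 \<le> k" and n1: "1 \<le> n" and w1: "1 \<le> w"
    and adj_sym: "adj x y = adj y x"
    and lim_mem: "n * n + (k * k + 2 * n) + ((nst k + 3) * (n + 1) + n) < 2 ^ w"
    and lim_step: "nst k * (2 * k * k) < 2 ^ w"
    and lim_init: "ndec k * (ndec k * k) < 2 ^ w"
    and lim_arc: "ndec k * (k * k * 2) < 2 ^ w"
begin

text \<open>The working memory lies behind the input matrix and also behind the
  \<open>k * k + 2 * n\<close> cells of the output. Writing the output may thus destroy the input,
  but never the rows it is copied from.\<close>

definition base :: nat where "base = n * n + (k * k + 2 * n)"
definition cl :: "nat \<Rightarrow> nat \<Rightarrow> nat" where "cl r c = base + (r * (n + 1) + c)"

lemma cl_eq_iff: "c \<le> n \<Longrightarrow> c' \<le> n \<Longrightarrow> cl r c = cl r' c' \<longleftrightarrow> r = r' \<and> c = c'"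
proof
  assume *: "c \<le> n" "c' \<le> n" "cl r c = cl r' c'"
  then have "r * (n + 1) + c = r' * (n + 1) + c'" by (simp add: cl_def)
  then have "(r * (n + 1) + c) div (n + 1) = (r' * (n + 1) + c') div (n + 1)"
    "(r * (n + 1) + c) mod (n + 1) = (r' * (n + 1) + c') mod (n + 1)" by simp_all
  moreover have "(a * (n + 1) + b) div (n + 1) = a \<and> (a * (n + 1) + b) mod (n + 1) = b" if "b \<le> n" for a b
    using that by (simp only: div_mult_self3 mod_mult_self3) auto
  ultimately show "r = r' \<and> c = c'" using * by metis
qed simp

lemma cl_ge_base: "\<not> cl r c < base"
  by (simp add: cl_def)

definition env :: "(nat \<Rightarrow> nat) \<Rightarrow> (nat \<Rightarrow> nat) \<Rightarrow> bool" where
  "env R M \<longleftrightarrow> R 0 = n \<and> R 1 = base \<and> (\<forall>x<n. \<forall>y<n. M (x * n + y) = of_bool (adj x y))"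

lemma small: "a < 2 ^ w" if "a \<le> base + ((nst k + 3) * (n + 1) + n)"
  using lim_mem that by (simp add: base_def)

lemma cell_small:
  assumes "r < nst k + 3" "c \<le> n"
  shows "r * (n + 1) + c \<le> (nst k + 3) * (n + 1) + n" "r * (n + 1) \<le> (nst k + 3) * (n + 1)"
  using assms by (auto intro!: add_mono mult_le_mono)

lemma one_less: "Suc 0 < 2 ^ w"
  using w1 one_less_power[of "2::nat" w] by simp

lemma n_less: "x \<le> Suc n \<Longrightarrow> x < 2 ^ w"
  by (rule small) (auto simp: base_def)

lemma nst_pos: "0 < nst k"
  using ninit_less[OF k1, of 0 0] k1 by (simp add: Suc_le_eq)

lemma k_less: "x \<le> 2 * k * k \<Longrightarrow> x < 2 ^ w"
proof -
  assume "x \<le> 2 * k * k"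
  also have "\<dots> \<le> nst k * (2 * k * k)" using nst_pos by simp
  finally show ?thesis using lim_step by simp
qed

lemma k_less': "x \<le> k \<Longrightarrow> x < 2 ^ w"
  by (rule k_less) (use k1 in \<open>auto intro: le_trans\<close>)

lemma safe_cellE:
  assumes "safe w r R M" "safe w c R M" "R 0 = n" "R (Suc 0) = base" "eval r R M < nst k + 3" "eval c R M \<le> n"
  shows "safe w (cellE r c) R M"
  using assms cell_small[OF assms(5,6)] by (auto simp: cellE_def one_less intro!: small)

lemma eval_cellE: "R 0 = n \<Longrightarrow> R (Suc 0) = base \<Longrightarrow> eval (cellE r c) R M = cl (eval r R M) (eval c R M)"
  by (simp add: cellE_def cl_def)

lemma safe_rd:
  assumes "safe w r R M" "safe w c R M" "R 0 = n" "R (Suc 0) = base" "eval r R M < nst k + 3" "eval c R M \<le> n"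
  shows "safe w (rd r c) R M"
  using safe_cellE[OF assms] by (simp add: rd_def)

lemma eval_rd: "R 0 = n \<Longrightarrow> R (Suc 0) = base \<Longrightarrow> eval (rd r c) R M = M (cl (eval r R M) (eval c R M))"
  by (simp add: rd_def eval_cellE)

lemma adj_idx_less: "x < n \<Longrightarrow> y < n \<Longrightarrow> x * n + y < n * n"
  by (rule index_less)

lemma safe_adjE:
  assumes "safe w x R M" "safe w y R M" "R 0 = n" "eval x R M < n" "eval y R M < n"
  shows "safe w (adjE x y) R M"
proof -
  have "eval x R M * n + eval y R M < 2 ^ w" "eval x R M * n < 2 ^ w"
    using adj_idx_less[OF assms(4,5)] by (auto simp: base_def intro!: small)
  then show ?thesis using assms by (simp add: adjE_def)
qed

lemma eval_adjE:
  "env R M \<Longrightarrow> eval x R M < n \<Longrightarrow> eval y R M < n \<Longrightarrow>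
    eval (adjE x y) R M = of_bool (adj (eval x R M) (eval y R M))"
  by (simp add: adjE_def env_def)

lemma eval_stepE:
  assumes "eval q R M < nst k" "eval s R M < 2 * k" "eval b R M < k"
  shows "eval (stepE k q s b) R M = nstep k (eval q R M) (eval s R M) (eval b R M)"
proof -
  have "eval (add (mul s (Cn k)) b) R M < 2 * k * k" using index_less[OF assms(2,3)] by simp
  from eval_Tab2[where b = "add (mul s (Cn k)) b", OF assms(1) this] show ?thesis using assms(3) by (simp add: stepE_def)
qed

lemma nst_less: "q < nst k \<Longrightarrow> q < 2 ^ w"
  by (rule small) (auto simp: base_def)

lemma safe_stepE:
  assumes "eval q R M < nst k" "eval s R M < 2 * k" "eval b R M < k" "safe w q R M" "safe w s R M" "safe w b R M"
  shows "safe w (stepE k q s b) R M"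
proof -
  have i: "eval (add (mul s (Cn k)) b) R M < 2 * k * k" using index_less[OF assms(2,3)] by simp
  have "nstep k (eval q R M) (eval s R M) (eval b R M) < 2 ^ w"
    using assms by (intro nst_less nstep_less)
  moreover have "safe w (add (mul s (Cn k)) b) R M"
    using assms(5,6) i k_less[of "eval s R M * k"] k_less[of "eval s R M * k + eval b R M"] k_less'[of k]
    by simp
  ultimately show ?thesis unfolding stepE_def
    by (intro safe_Tab2[OF assms(1) i lim_step assms(4)]) (use assms(3) in simp_all)
qed

lemma eval_accE: "eval q R M < nst k \<Longrightarrow> eval (accE k q) R M = of_bool (nacc k (eval q R M))"
  by (simp add: accE_def eval_Tab2)

lemma safe_accE: "eval q R M < nst k \<Longrightarrow> safe w q R M \<Longrightarrow> safe w (accE k q) R M"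
  unfolding accE_def using nst_less small[of "nst k"]
  by (intro safe_Tab2) (auto simp: one_less base_def)

lemma eval_initE: "eval d R M < ndec k \<Longrightarrow> eval c R M < ndec k * k \<Longrightarrow>
    eval (initE k d c) R M = ninit k (eval d R M) (eval c R M)"
  by (simp add: initE_def eval_Tab2)

lemma safe_initE: "eval d R M < ndec k \<Longrightarrow> eval c R M < ndec k * k \<Longrightarrow> safe w d R M \<Longrightarrow> safe w c R M \<Longrightarrow>
    safe w (initE k d c) R M"
  unfolding initE_def by (intro safe_Tab2 lim_init nst_less ninit_less k1)

lemma eval_divE [simp]: "eval (divE k c) R M = eval c R M div k"
  by (simp add: divE_def)

lemma safe_divE [simp]: "safe w (divE k c) R M \<longleftrightarrow> safe w c R M"
  using k_less'[of k] by (simp add: divE_def)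

lemma eval_modE [simp]: "eval (modE k c) R M = eval c R M mod k"
  by (simp add: modE_def minus_div_mult_eq_mod)

lemma safe_modE: "eval c R M < 2 ^ w \<Longrightarrow> safe w c R M \<Longrightarrow> safe w (modE k c) R M"
  using k_less'[of k] by (auto simp: modE_def intro: le_less_trans[OF div_times_less_eq_dividend])

lemma symE:
  assumes "env R M" "R 2 = i" "i < n" "eval x R M < n" "safe w x R M" "M (cl 1 (eval x R M)) < k"
  shows "eval (symE x) R M = sym_of adj (\<lambda>x. M (cl 1 x)) i (eval x R M)" "safe w (symE x) R M"
proof -
  have *: "R 0 = n" "R (Suc 0) = base" using assms(1) by (auto simp: env_def)
  have r[simplified]: "eval (rd (Cn 1) x) R M = M (cl 1 (eval x R M))" by (simp add: eval_rd *)
  have a: "eval (adjE (Vr 2) x) R M = of_bool (adj i (eval x R M))"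
    using eval_adjE[OF assms(1), of "Vr 2" x] assms by simp
  show "eval (symE x) R M = sym_of adj (\<lambda>x. M (cl 1 x)) i (eval x R M)"
    by (simp add: symE_def r a sym_of_def)
  have "safe w (rd (Cn 1) x) R M" using assms * by (intro safe_rd) (auto simp: one_less)
  moreover have "safe w (adjE (Vr 2) x) R M" using assms * by (intro safe_adjE) auto
  moreover have "Suc (2 * M (cl 1 (eval x R M))) < 2 ^ w"
    using assms(6) k1 by (intro k_less) (cases k; auto)
  ultimately show "safe w (symE x) R M" using k_less[of 2] k1
    by (cases k) (auto simp: symE_def r a)
qed

definition arc :: "nat \<Rightarrow> (nat \<Rightarrow> nat) \<Rightarrow> nat \<Rightarrow> nat \<Rightarrow> nat" where
  "arc d l x y = of_bool (adj x y \<noteq> ((l y, l x) \<in> dec k d))"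

lemma arcE:
  assumes "env R M" "R 3 = d" "d < ndec k" "eval x R M < n" "safe w x R M" "M (cl 1 (eval x R M)) < k"
    "eval y R M < n" "safe w y R M" "M (cl 1 (eval y R M)) < k"
  shows "eval (arcE k x y) R M = arc d (\<lambda>x. M (cl 1 x)) (eval x R M) (eval y R M)"
    "safe w (arcE k x y) R M"
proof -
  have *: "R 0 = n" "R (Suc 0) = base" using assms(1) by (auto simp: env_def)
  let ?a = "M (cl 1 (eval y R M))" and ?b = "M (cl 1 (eval x R M))"
  let ?e = "of_bool (adj (eval x R M) (eval y R M)) :: nat"
  have r1: "eval (rd (Cn 1) x) R M = ?b" "eval (rd (Cn 1) y) R M = ?a" by (simp_all add: eval_rd *)
  note r = r1[simplified]
  have a: "eval (adjE x y) R M = ?e" using eval_adjE[OF assms(1)] assms by simp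
  let ?i = "add (mul (add (mul (rd (Cn 1) y) (Cn k)) (rd (Cn 1) x)) (Cn 2)) (adjE x y)"
  have ev: "eval ?i R M = (?a * k + ?b) * 2 + ?e" by (simp add: r a)
  have lt1: "?a * k + ?b < k * k" by (rule index_less) fact+
  have lt: "eval ?i R M < k * k * 2" unfolding ev by (rule index_less[OF lt1]) simp
  have d: "eval (Vr 3) R M < ndec k" using assms by simp
  define z where "z = eval ?i R M"
  have z: "z div 2 = ?a * k + ?b" "odd z = adj (eval x R M) (eval y R M)"
    unfolding z_def ev by auto
  have dm: "(?a * k + ?b) div k = ?a" "(?a * k + ?b) mod k = ?b" using assms by auto
  have "eval (arcE k x y) R M = of_bool (odd z \<noteq> ((z div 2 div k, z div 2 mod k) \<in> dec k d))"
    unfolding arcE_def eval_Tab2[OF d lt] z_def using assms(2) by simp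
  then show "eval (arcE k x y) R M = arc d (\<lambda>x. M (cl 1 x)) (eval x R M) (eval y R M)"
    unfolding z dm arc_def .
  have "safe w (rd (Cn 1) x) R M" "safe w (rd (Cn 1) y) R M"
    using assms * by (auto intro!: safe_rd simp: one_less)
  moreover have "safe w (adjE x y) R M" using assms * by (intro safe_adjE) auto
  moreover have kk: "z < 2 ^ w" if "z \<le> k * k * 2" for z using k_less[of z] that by (simp add: ac_simps)
  have "(?a * k + ?b) * 2 + ?e < 2 ^ w" by (rule kk) (use lt ev in simp)
  moreover have "(?a * k + ?b) * 2 < 2 ^ w" by (rule kk) (use lt1 in simp)
  moreover have "?a * k + ?b < 2 ^ w" by (rule kk) (use lt1 in simp)
  moreover have "?a * k < 2 ^ w" by (rule kk) (use lt1 in linarith)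
  moreover have "2 < (2::nat) ^ w" by (rule kk) (use k1 in simp)
  ultimately have i: "safe w ?i R M" using k_less'[of k]
    unfolding safe_arith eval_arith eval.simps safe.simps r1 a by blast
  show "safe w (arcE k x y) R M"
    unfolding arcE_def by (rule safe_Tab2[OF d lt lim_arc _ i]) (auto simp: one_less)
qed

lemma decE:
  assumes "R 3 = d" "d < ndec k" "eval e R M < k * k" "safe w e R M"
  shows "eval (decE k e) R M = of_bool ((eval e R M div k, eval e R M mod k) \<in> dec k d)"
    "safe w (decE k e) R M"
proof -
  have d: "eval (Vr 3) R M < ndec k" using assms by simp
  show "eval (decE k e) R M = of_bool ((eval e R M div k, eval e R M mod k) \<in> dec k d)"
    unfolding decE_def using eval_Tab2[OF d assms(3)] assms by simp
  have "ndec k * (k * k) \<le> ndec k * (k * k * 2)" by simp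
  then have "ndec k * (k * k) < 2 ^ w" using lim_arc by (rule le_less_trans)
  then show "safe w (decE k e) R M"
    unfolding decE_def by (intro safe_Tab2 assms d) (auto simp: one_less)
qed

text \<open>Frame condition of the dynamic program, which writes only to rows from 3 on.\<close>

definition low :: "(nat \<Rightarrow> nat) \<Rightarrow> (nat \<Rightarrow> nat) \<Rightarrow> bool" where
  "low M0 M \<longleftrightarrow> (\<forall>a<base. M a = M0 a) \<and> (\<forall>r<3. \<forall>c\<le>n. M (cl r c) = M0 (cl r c))"

lemma env_cong: "env R M \<Longrightarrow> (\<And>x. x < 2 \<Longrightarrow> R' x = R x) \<Longrightarrow> (\<And>a. a < base \<Longrightarrow> M' a = M a) \<Longrightarrow> env R' M'"
proof -
  assume *: "env R M" "\<And>x. x < 2 \<Longrightarrow> R' x = R x" "\<And>a. a < base \<Longrightarrow> M' a = M a"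
  have "x * n + y < base" if "x < n" "y < n" for x y
    using adj_idx_less[OF that] by (simp add: base_def)
  then show "env R' M'" using * by (simp add: env_def)
qed

end

text \<open>The specifications of subprograms fix one start state, to which the postcondition may
  then refer. This brings such a specification into weakest-precondition form.\<close>

lemma hoare_call:
  assumes "\<And>R0 M0. P R0 M0 \<Longrightarrow> hoare w C T (start R0 M0) (Q R0 M0)"
  shows "hoare w C T (\<lambda>R M. P R M \<and> (\<forall>R' M'. Q R M R' M' \<longrightarrow> Post R' M')) Post"
  unfolding hoare_def
proof (intro allI impI)
  fix R M assume 0: "bnd w R M" "P (clr R) M \<and> (\<forall>R' M'. Q (clr R) M R' M' \<longrightarrow> Post R' M')"
  then obtain t R' M' where "exec w C (R, M) t (R', M')" "t \<le> T" "Q (clr R) M (clr R') M'"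
    using assms[of "clr R" M] unfolding hoare_def by blast
  then show "\<exists>t R' M'. exec w C (R, M) t (R', M') \<and> t \<le> T \<and> Post (clr R') M'"
    using 0 by blast
qed

lemma cmax_ge: "200 \<le> cmax k"
  by (simp add: cmax_def)

text \<open>The loop overhead, at most 57 per round, disappears in \<open>cmax k\<close>, so that
  nested loops cost plain products. \<open>m\<close> may exceed the number of rounds; in this way
  loops over the vertices seen so far are charged for \<open>n\<close> rounds.\<close>

lemma hoare_For_bound:
  assumes w: "1 \<le> w" and x: "x < zz" and e: "well e" "cost e \<le> 20" and cnt: "cnt < 2 ^ w" "cnt \<le> m" "1 \<le> m"
    and init: "\<And>R M. A R M \<Longrightarrow> I 0 (R(x := 0)) M"
    and body: "\<And>j. j < cnt \<Longrightarrow> hoare w P b (\<lambda>R M. R x = j \<and> I j R M)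
      (\<lambda>R M. R x = j \<and> I (Suc j) (R(x := Suc j)) M)"
    and guard: "\<And>j R M. j \<le> cnt \<Longrightarrow> R x = j \<Longrightarrow> I j R M \<Longrightarrow> safe w e R M \<and> eval e R M = cnt"
    and fin: "\<And>R M. R x = cnt \<Longrightarrow> I cnt R M \<Longrightarrow> Q R M"
  shows "hoare w (For x e P) (m * (b + cmax k)) A Q"
proof (rule hoare_pre)
  show "hoare w (For x e P) (cnt * (b + cost e + 10) + cost e + 7) A Q"
    using hoare_For[OF w x e(1) cnt(1) init body guard fin] .
  have "cnt * (b + cost e + 10) + cost e + 7 \<le> m * (b + 30) + m * 27"
    using e(2) cnt(2,3) by (intro order_trans[OF _ add_mono[OF mult_le_mono[of cnt m "b + cost e + 10"] mult_le_mono[of 1 m 27]]]) auto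
  also have "\<dots> = m * (b + 57)" by (simp add: algebra_simps)
  also have "\<dots> \<le> m * (b + cmax k)" using cmax_ge[of k] by (intro mult_le_mono) auto
  finally show "cnt * (b + cost e + 10) + cost e + 7 \<le> m * (b + cmax k)" .
qed

definition ag :: "nat set \<Rightarrow> (nat \<Rightarrow> nat) \<Rightarrow> (nat \<Rightarrow> nat) \<Rightarrow> bool" where
  "ag S R0 R \<longleftrightarrow> (\<forall>x. x \<notin> S \<longrightarrow> R x = R0 x)"

section \<open>The dynamic program\<close>

text \<open>Column \<open>j\<close> of row \<open>3 + q\<close> is to hold \<open>goodv\<close> for
  the last \<open>i - j\<close> symbols and state \<open>q\<close>, so column \<open>i\<close>
  contains acceptance. Register 6 holds the state, 7 the letter tried, 8 the symbol, 9 the best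
  choice so far and 11 the column.\<close>

definition prog_acc :: "nat \<Rightarrow> com" where
  "prog_acc k = For 6 (Cn (nst k)) (St (cellE (add (Cn 3) (Vr 6)) (Vr 2)) (accE k (Vr 6)))"

definition prog_choice :: "nat \<Rightarrow> com" where
  "prog_choice k = Seq (Asg 9 (Cn 0)) (For 7 (Cn k)
     (Ite (rd (add (Cn 3) (stepE k (Vr 6) (Vr 8) (Vr 7))) (add (Vr 11) (Cn 1)))
       (Asg 9 (add (Vr 7) (Cn 1))) Skip))"

definition prog_column :: "nat \<Rightarrow> com" where
  "prog_column k = For 6 (Cn (nst k)) (Seq (prog_choice k) (St (cellE (add (Cn 3) (Vr 6)) (Vr 11)) (Vr 9)))"

definition prog_dp :: "nat \<Rightarrow> com" where
  "prog_dp k = For 5 (Vr 2) (Seq (Asg 11 (sub (sub (Vr 2) (Cn 1)) (Vr 5)))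
     (Seq (Asg 8 (symE (rd (Cn 0) (Vr 11)))) (prog_column k)))"

context ram
begin

abbreviation A where "A \<equiv> cmax k"

lemma cost_le_cmax: "4 * nst k + 100 \<le> A" "4 * (nst k * (2 * k * k)) + 100 \<le> A"
  "4 * (ndec k * (ndec k * k)) + 100 \<le> A" "4 * (ndec k * (k * k * 2)) + 100 \<le> A"
  "4 * (ndec k * (k * k)) + 100 \<le> A" "200 \<le> A"
  by (simp_all add: cmax_def)

lemma kA: "200 \<le> k * A"
  using mult_le_mono[OF k1 cost_le_cmax(6)] by simp

lemma kA': "A \<le> k * A"
  using mult_le_mono[OF k1 order_refl] by simp

lemma low_upd: "3 \<le> r \<Longrightarrow> c \<le> n \<Longrightarrow> low M0 M \<Longrightarrow> low M0 (M(cl r c := v))"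
  using cl_ge_base by (auto simp: low_def cl_eq_iff)

lemma low_refl: "low M M"
  by (simp add: low_def)

lemma nst_less': "nst k < 2 ^ w"
  by (rule small) (simp add: base_def)

lemma prog_acc:
  assumes "R0 0 = n" "R0 1 = base" "R0 2 < n"
  shows "hoare w (prog_acc k) (nst k * (4 * A)) (start R0 M0)
    (\<lambda>R M. ag {6} R0 R \<and> low M0 M \<and> (\<forall>q<nst k. M (cl (3 + q) (R0 2)) = of_bool (nacc k q)))"
proof -
  let ?I = "\<lambda>j R M. ag {6} R0 R \<and> low M0 M \<and> (\<forall>q<j. M (cl (3 + q) (R0 2)) = of_bool (nacc k q))"
  have "hoare w (prog_acc k) (nst k * (3 * A + A)) (start R0 M0) (?I (nst k))"
    unfolding prog_acc_def
  proof (rule hoare_For_bound[OF w1, where I = ?I])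
    fix j assume j: "j < nst k"
    show "hoare w (St (cellE (add (Cn 3) (Vr 6)) (Vr 2)) (accE k (Vr 6))) (3 * A)
      (\<lambda>R M. R 6 = j \<and> ?I j R M) (\<lambda>R M. R 6 = j \<and> ?I (Suc j) (R(6 := Suc j)) M)"
    proof (rule hoare_pre, rule hoare_St[OF w1])
      fix R M assume I: "R 6 = j \<and> ?I j R M"
      have R: "R 0 = n" "R (Suc 0) = base" "R 2 = R0 2" "R 6 = j" using I assms by (auto simp: ag_def)
      have ce: "eval (cellE (add (Cn 3) (Vr 6)) (Vr 2)) R M = cl (3 + j) (R0 2)"
        using R by (simp add: eval_cellE)
      have cs: "safe w (cellE (add (Cn 3) (Vr 6)) (Vr 2)) R M"
        using R j assms(3) by (intro safe_cellE) (auto intro!: small)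
      have ae: "eval (accE k (Vr 6)) R M = of_bool (nacc k j)" "safe w (accE k (Vr 6)) R M"
        using R j by (simp_all add: eval_accE safe_accE)
      show "safe w (cellE (add (Cn 3) (Vr 6)) (Vr 2)) R M \<and> safe w (accE k (Vr 6)) R M \<and>
        R 6 = j \<and> ?I (Suc j) (R(6 := Suc j))
          (M(eval (cellE (add (Cn 3) (Vr 6)) (Vr 2)) R M := eval (accE k (Vr 6)) R M))"
        unfolding ce ae(1) using I cs ae(2) assms(3)
        by (auto simp: ag_def cl_eq_iff less_Suc_eq intro!: low_upd)
    qed (use cost_le_cmax in auto)
  qed (use nst_pos nst_less in \<open>auto simp: ag_def low_refl intro!: small\<close>)
  then show ?thesis by simp
qed

lemma prog_choice:
  assumes "R0 0 = n" "R0 1 = base" "R0 6 < nst k" "R0 8 < 2 * k" "R0 11 < n"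
  shows "hoare w (prog_choice k) (k * (4 * A)) (start R0 M0)
    (\<lambda>R M. M = M0 \<and> ag {7, 9} R0 R \<and>
      R 9 = pick (\<lambda>b. M0 (cl (3 + nstep k (R0 6) (R0 8) b) (Suc (R0 11))) \<noteq> 0) k)"
proof -
  let ?f = "\<lambda>b. M0 (cl (3 + nstep k (R0 6) (R0 8) b) (Suc (R0 11))) \<noteq> 0"
  let ?I = "\<lambda>j R M. M = M0 \<and> ag {7, 9} R0 R \<and> R 9 = pick ?f j"
  let ?e = "rd (add (Cn 3) (stepE k (Vr 6) (Vr 8) (Vr 7))) (add (Vr 11) (Cn 1))"
  have "hoare w (For 7 (Cn k) (Ite ?e (Asg 9 (add (Vr 7) (Cn 1))) Skip)) (k * (2 * A + A))
    (\<lambda>R M. M = M0 \<and> ag {7, 9} R0 R \<and> R 9 = 0) (?I k)"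
  proof (rule hoare_For_bound[OF w1, where I = ?I])
    fix j assume j: "j < k"
    show "hoare w (Ite ?e (Asg 9 (add (Vr 7) (Cn 1))) Skip) (2 * A)
      (\<lambda>R M. R 7 = j \<and> ?I j R M) (\<lambda>R M. R 7 = j \<and> ?I (Suc j) (R(7 := Suc j)) M)"
    proof (rule hoare_pre, rule hoare_Ite[OF w1], simp, rule hoare_Asg[OF w1], simp, simp, rule hoare_Skip)
      fix R M assume I: "R 7 = j \<and> ?I j R M"
      have R: "R 0 = n" "R (Suc 0) = base" "R 6 = R0 6" "R 8 = R0 8" "R 11 = R0 11" "R 7 = j"
        using I assms by (auto simp: ag_def)
      have st: "eval (stepE k (Vr 6) (Vr 8) (Vr 7)) R M = nstep k (R0 6) (R0 8) j"
        "safe w (stepE k (Vr 6) (Vr 8) (Vr 7)) R M"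
        using R j assms by (simp_all add: eval_stepE safe_stepE)
      have lt: "nstep k (R0 6) (R0 8) j < nst k" using assms j by (intro nstep_less)
      have e: "eval ?e R M = M (cl (3 + nstep k (R0 6) (R0 8) j) (Suc (R0 11)))"
        using R by (simp add: eval_rd st)
      have s: "safe w ?e R M"
        using R lt assms(5) st by (intro safe_rd) (auto intro!: small simp: base_def one_less)
      have "Suc j < 2 ^ w" using j by (intro k_less') simp
      then show "safe w ?e R M \<and> (if eval ?e R M \<noteq> 0
          then safe w (add (Vr 7) (Cn 1)) R M \<and> (R(9 := eval (add (Vr 7) (Cn 1)) R M)) 7 = j \<and>
            ?I (Suc j) (R(9 := eval (add (Vr 7) (Cn 1)) R M, 7 := Suc j)) M
          else R 7 = j \<and> ?I (Suc j) (R(7 := Suc j)) M)"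
        unfolding e using I s R by (auto simp: ag_def one_less)
    qed (use cost_le_cmax in auto)
  qed (use k1 k_less' in \<open>auto simp: ag_def\<close>)
  note loop = this
  show ?thesis unfolding prog_choice_def
  proof (rule hoare_pre, rule hoare_Seq, rule loop, rule hoare_Asg[OF w1])
    show "cost (Cn 0) + 2 + k * (2 * A + A) \<le> k * (4 * A)"
      using kA cost_le_cmax(6) by (simp add: algebra_simps)
  qed (auto simp: ag_def)
qed

lemma prog_column:
  assumes "R0 0 = n" "R0 1 = base" "R0 8 < 2 * k" "R0 11 < n"
  shows "hoare w (prog_column k) (nst k * (k * (6 * A))) (start R0 M0)
    (\<lambda>R M. ag {6, 7, 9} R0 R \<and> low M0 M \<and>
      (\<forall>q<nst k. M (cl (3 + q) (R0 11)) = pick (\<lambda>b. M0 (cl (3 + nstep k q (R0 8) b) (Suc (R0 11))) \<noteq> 0) k) \<and>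
      (\<forall>q<nst k. \<forall>c\<le>n. c \<noteq> R0 11 \<longrightarrow> M (cl (3 + q) c) = M0 (cl (3 + q) c)))"
proof -
  let ?v = "\<lambda>q. pick (\<lambda>b. M0 (cl (3 + nstep k q (R0 8) b) (Suc (R0 11))) \<noteq> 0) k"
  let ?I = "\<lambda>j R M. ag {6, 7, 9} R0 R \<and> low M0 M \<and> (\<forall>q<j. M (cl (3 + q) (R0 11)) = ?v q) \<and>
    (\<forall>q<nst k. \<forall>c\<le>n. c \<noteq> R0 11 \<longrightarrow> M (cl (3 + q) c) = M0 (cl (3 + q) c))"
  let ?c = "cellE (add (Cn 3) (Vr 6)) (Vr 11)"
  have "hoare w (prog_column k) (nst k * (k * (5 * A) + A)) (start R0 M0) (?I (nst k))"
    unfolding prog_column_def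
  proof (rule hoare_For_bound[OF w1, where I = ?I])
    fix j assume j: "j < nst k"
    show "hoare w (Seq (prog_choice k) (St ?c (Vr 9))) (k * (5 * A))
      (\<lambda>R M. R 6 = j \<and> ?I j R M) (\<lambda>R M. R 6 = j \<and> ?I (Suc j) (R(6 := Suc j)) M)"
    proof (rule hoare_pre, rule hoare_Seq, rule hoare_St[OF w1], simp, simp, rule hoare_call, rule prog_choice)
      show "k * (4 * A) + (cost ?c + cost (Vr 9) + 1) \<le> k * (5 * A)"
        using kA by (simp add: algebra_simps)
      fix R M assume I: "R 6 = j \<and> ?I j R M"
      have R: "R 0 = n" "R 1 = base" "R 6 = j" "R 8 = R0 8" "R 11 = R0 11"
        using I assms by (auto simp: ag_def)
      let ?Q = "\<lambda>R' M'. safe w ?c R' M' \<and> safe w (Vr 9) R' M' \<and>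
          R' 6 = j \<and> ?I (Suc j) (R'(6 := Suc j)) (M'(eval ?c R' M' := eval (Vr 9) R' M'))"
      have Q: "?Q R' M" if Q: "ag {7, 9} R R'" "R' 9 = pick (\<lambda>b. M (cl (3 + nstep k (R 6) (R 8) b) (Suc (R 11))) \<noteq> 0) k" for R'
      proof -
        have R': "R' 0 = n" "R' (Suc 0) = base" "R' 11 = R0 11" "R' 6 = j"
          using Q(1) R by (auto simp: ag_def)
        have ce: "eval ?c R' M = cl (3 + j) (R0 11)" using R' by (simp add: eval_cellE)
        have cs: "safe w ?c R' M" using R' j assms(4) by (intro safe_cellE) (auto intro!: small)
        \<comment> \<open>The values read lie in the next column, which this loop does not touch, so
          they are still those of the initial memory.\<close>
        have "R' 9 = ?v j" unfolding Q(2) R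
        proof (rule pick_cong)
          fix b assume "b < k"
          then have "nstep k j (R0 8) b < nst k" using j assms by (intro nstep_less)
          then show "(M (cl (3 + nstep k j (R0 8) b) (Suc (R0 11))) \<noteq> 0) =
             (M0 (cl (3 + nstep k j (R0 8) b) (Suc (R0 11))) \<noteq> 0)"
            using I assms(4) by simp
        qed
        moreover have "low M0 (M(cl (3 + j) (R0 11) := v))" for v
          by (rule low_upd) (use I assms(4) in auto)
        ultimately show ?thesis unfolding ce using cs R' I Q(1) assms(4)
          by (auto simp: ag_def cl_eq_iff less_Suc_eq)
      qed
      show "(R 0 = n \<and> R 1 = base \<and> R 6 < nst k \<and> R 8 < 2 * k \<and> R 11 < n) \<and>
        (\<forall>R' M'. M' = M \<and> ag {7, 9} R R' \<and>
          R' 9 = pick (\<lambda>b. M (cl (3 + nstep k (R 6) (R 8) b) (Suc (R 11))) \<noteq> 0) k \<longrightarrow> ?Q R' M')"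
      proof (rule conjI, goal_cases)
        case 1
        show ?case using R j assms by simp
      next
        case 2
        show ?case
        proof (intro allI impI, elim conjE)
          fix R' M' assume 1: "M' = M" and 2: "ag {7, 9} R R'"
            "R' 9 = pick (\<lambda>b. M (cl (3 + nstep k (R 6) (R 8) b) (Suc (R 11))) \<noteq> 0) k"
          show "?Q R' M'" unfolding 1 by (rule Q[OF 2])
        qed
      qed
    qed auto
  qed (use nst_pos nst_less' in \<open>auto simp: ag_def low_refl\<close>)
  then show ?thesis
  proof (rule hoare_pre)
    show "nst k * (k * (5 * A) + A) \<le> nst k * (k * (6 * A))"
      using kA' by (intro mult_le_mono2) simp
  qed auto
qed

end

text \<open>Reduces an arbitrary precondition to fixed start states, the form in which the
  subprograms are specified.\<close>

lemma hoare_use: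
  assumes "\<And>R0 M0. P R0 M0 \<Longrightarrow> hoare w C T (start R0 M0) Q"
  shows "hoare w C T P Q"
  using assms unfolding hoare_def by blast

context ram
begin

definition sy :: "nat \<Rightarrow> (nat \<Rightarrow> nat) \<Rightarrow> nat \<Rightarrow> nat" where
  "sy i M j = sym_of adj (\<lambda>x. M (cl 1 x)) i (M (cl 0 j))"

text \<open>What rows 0 and 1 must satisfy for all table indices computed from them to be in
  range.\<close>

definition word :: "nat \<Rightarrow> (nat \<Rightarrow> nat) \<Rightarrow> bool" where
  "word i M \<longleftrightarrow> (\<forall>j<i. M (cl 0 j) < i) \<and> (\<forall>x<i. M (cl 1 x) < k)"

lemma word_sy: "word i M \<Longrightarrow> j < i \<Longrightarrow> sy i M j < 2 * k"
  by (auto simp: word_def sy_def sym_of_def)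

lemma low_cell: "low M0 M \<Longrightarrow> r < 3 \<Longrightarrow> c \<le> n \<Longrightarrow> M (cl r c) = M0 (cl r c)"
  by (simp add: low_def)

lemma low_env: "env R0 M0 \<Longrightarrow> low M0 M \<Longrightarrow> ag S R0 R \<Longrightarrow> 0 \<notin> S \<Longrightarrow> 1 \<notin> S \<Longrightarrow> env R M"
proof (rule env_cong, assumption)
  fix x :: nat assume "ag S R0 R" "0 \<notin> S" "1 \<notin> S" "x < 2"
  then show "R x = R0 x" by (cases x) (auto simp: ag_def)
qed (simp add: low_def)

lemma low_sy: "low M0 M \<Longrightarrow> word i M0 \<Longrightarrow> i \<le> n \<Longrightarrow> j < i \<Longrightarrow> sy i M j = sy i M0 j"
  by (auto simp: sy_def low_cell word_def sym_of_def) 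

lemma low_word: "low M0 M \<Longrightarrow> word i M0 \<Longrightarrow> i \<le> n \<Longrightarrow> word i M"
  by (simp add: low_cell word_def)

lemma low_trans: "low M0 M \<Longrightarrow> low M M' \<Longrightarrow> low M0 M'"
  by (simp add: low_def)

lemma symE_word:
  assumes "env R M" "R 2 = i" "i < n" "word i M" "R 11 = j" "j < i"
  shows "eval (symE (rd (Cn 0) (Vr 11))) R M = sy i M j" "safe w (symE (rd (Cn 0) (Vr 11))) R M"
proof -
  have *: "R 0 = n" "R (Suc 0) = base" using assms(1) by (auto simp: env_def)
  let ?x = "rd (Cn 0) (Vr 11)"
  have x: "eval ?x R M = M (cl 0 j)" using * assms by (simp add: eval_rd)
  have s: "safe w ?x R M" using * assms by (intro safe_rd) auto
  have lt: "eval ?x R M < n" "M (cl 1 (eval ?x R M)) < k"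
    unfolding x using assms by (auto simp: word_def intro: less_trans)
  show "eval (symE ?x) R M = sy i M j" "safe w (symE ?x) R M"
    using symE[OF assms(1,2,3) lt(1) s lt(2)] unfolding x sy_def by auto
qed

lemma prog_dp:
  assumes "env R0 M0" "R0 2 = i" "i < n" "word i M0"
    and acc: "\<And>q. q < nst k \<Longrightarrow> M0 (cl (3 + q) i) = of_bool (nacc k q)"
  shows "hoare w (prog_dp k) (n * (nst k * (k * (9 * A)))) (start R0 M0)
    (\<lambda>R M. ag {5, 6, 7, 8, 9, 11} R0 R \<and> low M0 M \<and>
      (\<forall>j\<le>i. \<forall>q<nst k. M (cl (3 + q) j) = goodv k (sy i M0) i (i - j) q))"
proof -
  let ?I = "\<lambda>t R M. ag {5, 6, 7, 8, 9, 11} R0 R \<and> low M0 M \<and>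
      (\<forall>j\<le>i. i - t \<le> j \<longrightarrow> (\<forall>q<nst k. M (cl (3 + q) j) = goodv k (sy i M0) i (i - j) q))"
  have R01: "R0 0 = n" "R0 1 = base" using assms(1) by (auto simp: env_def)
  have big: "A \<le> nst k * (k * A)"
    using mult_le_mono[of 1 "nst k" "A" "k * A"] nst_pos kA' by simp
  have "hoare w (prog_dp k) (n * (nst k * (k * (8 * A)) + A)) (start R0 M0) (?I i)"
    unfolding prog_dp_def
  proof (rule hoare_For_bound[OF w1, where I = ?I])
    fix t assume t: "t < i"
    \<comment> \<open>The columns are filled from right to left, as the recursion of
      \<open>goodv\<close> demands.\<close>
    define j where "j = i - 1 - t"
    have j: "j < i" "i - t = Suc j" "i - Suc t = j" using t by (auto simp: j_def)
    let ?P1 = "\<lambda>R M. R 5 = t \<and> ?I t R M \<and> R 11 = j"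
    let ?P2 = "\<lambda>R M. R 5 = t \<and> ?I t R M \<and> R 11 = j \<and> R 8 = sy i M0 j"
    have 1: "hoare w (Asg 11 (sub (sub (Vr 2) (Cn 1)) (Vr 5))) A (\<lambda>R M. R 5 = t \<and> ?I t R M) ?P1"
      by (rule hoare_pre[OF hoare_Asg[OF w1]])
         (use cost_le_cmax(6) assms(2) in \<open>auto simp: ag_def one_less j_def\<close>)
    have 2: "hoare w (Asg 8 (symE (rd (Cn 0) (Vr 11)))) A ?P1 ?P2"
    proof (rule hoare_pre[OF hoare_Asg[OF w1]])
      fix R M assume P: "?P1 R M"
      have e: "env R M" using low_env[OF assms(1), of M "{5, 6, 7, 8, 9, 11}" R] P by simp
      have "R 2 = i" using P assms(2) by (simp add: ag_def)
      have wd: "word i M" using low_word[of M0 M i] P assms(3,4) by simp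
      note s = symE_word[OF e \<open>R 2 = i\<close> assms(3) wd, of j]
      show "safe w (symE (rd (Cn 0) (Vr 11))) R M \<and> ?P2 (R(8 := eval (symE (rd (Cn 0) (Vr 11))) R M)) M"
        using s P j assms(3) low_sy[OF _ assms(4), of M j] by (auto simp: ag_def)
    qed (use cost_le_cmax(6) in auto)
    have 3: "hoare w (prog_column k) (nst k * (k * (6 * A))) ?P2 (\<lambda>R M. R 5 = t \<and> ?I (Suc t) (R(5 := Suc t)) M)"
    proof (rule hoare_use)
      fix R1 M1 assume P: "?P2 R1 M1"
      have R1: "R1 0 = n" "R1 1 = base" "R1 8 = sy i M0 j" "R1 11 = j" using P R01 by (auto simp: ag_def)
      have lt: "sy i M0 j < 2 * k" using word_sy[OF assms(4) j(1)] .
      show "hoare w (prog_column k) (nst k * (k * (6 * A))) (start R1 M1)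
         (\<lambda>R M. R 5 = t \<and> ?I (Suc t) (R(5 := Suc t)) M)"
      proof (rule hoare_conseq[OF prog_column[of R1 M1]])
        fix R M
        assume Q: "ag {6, 7, 9} R1 R \<and> low M1 M \<and>
          (\<forall>q<nst k. M (cl (3 + q) (R1 11)) = pick (\<lambda>b. M1 (cl (3 + nstep k q (R1 8) b) (Suc (R1 11))) \<noteq> 0) k) \<and>
          (\<forall>q<nst k. \<forall>c\<le>n. c \<noteq> R1 11 \<longrightarrow> M (cl (3 + q) c) = M1 (cl (3 + q) c))"
        have "M (cl (3 + q) c) = goodv k (sy i M0) i (i - c) q" if c: "c \<le> i" "j \<le> c" and q: "q < nst k" for c q
        proof (cases "c = j")
          case False
          then show ?thesis using Q P R1 c q j assms(3) by simp
        next
          case True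
          \<comment> \<open>With \<open>Suc (i - Suc j)\<close> symbols left, \<open>goodv\<close>
            reads the symbol at position \<open>j\<close>.\<close>
          have "i - j = Suc (i - Suc j)" "i - Suc (i - Suc j) = j" using j by auto
          then have "goodv k (sy i M0) i (i - c) q =
              pick (\<lambda>b. goodv k (sy i M0) i (i - Suc j) (nstep k q (sy i M0 j) b) \<noteq> 0) k"
            using True by simp
          also have "\<dots> = pick (\<lambda>b. M1 (cl (3 + nstep k q (R1 8) b) (Suc (R1 11))) \<noteq> 0) k"
          proof (rule pick_cong)
            fix b assume "b < k"
            then have "nstep k q (sy i M0 j) b < nst k" using q lt by (intro nstep_less)
            then show "(goodv k (sy i M0) i (i - Suc j) (nstep k q (sy i M0 j) b) \<noteq> 0) =
              (M1 (cl (3 + nstep k q (R1 8) b) (Suc (R1 11))) \<noteq> 0)"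
              using P R1 j by simp
          qed
          also have "\<dots> = M (cl (3 + q) c)" using Q R1 True q by simp
          finally show ?thesis by simp
        qed
        moreover have "ag {5, 6, 7, 8, 9, 11} R0 (R(5 := Suc t))" "R 5 = t"
          using Q P by (auto simp: ag_def)
        moreover have "low M0 M" using Q P low_trans by blast
        ultimately show "R 5 = t \<and> ?I (Suc t) (R(5 := Suc t)) M" using j by simp
      qed (use R1 lt j assms(3) in auto)
    qed
    show "hoare w (Seq (Asg 11 (sub (sub (Vr 2) (Cn 1)) (Vr 5)))
         (Seq (Asg 8 (symE (rd (Cn 0) (Vr 11)))) (prog_column k))) (nst k * (k * (8 * A)))
      (\<lambda>R M. R 5 = t \<and> ?I t R M) (\<lambda>R M. R 5 = t \<and> ?I (Suc t) (R(5 := Suc t)) M)"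
      by (rule hoare_pre[OF hoare_Seq[OF hoare_Seq[OF 3 2] 1]])
         (use big in \<open>auto simp: algebra_simps\<close>)
  next
    show "i < 2 ^ w" by (rule n_less) (use assms(3) in simp)
  next
    fix R M assume "R = R0 \<and> M = M0"
    moreover have "j = i" if "j \<le> i" "i - 0 \<le> j" for j using that by simp
    ultimately show "?I 0 (R(5 := 0)) M" using acc low_refl by (auto simp: ag_def)
  qed (use assms(2,3) in \<open>auto simp: ag_def\<close>)
  then show ?thesis
  proof (rule hoare_conseq)
    show "n * (nst k * (k * (8 * A)) + A) \<le> n * (nst k * (k * (9 * A)))"
      by (intro mult_le_mono2) (use big in \<open>simp add: algebra_simps\<close>)
  qed auto
qed

end

section \<open>Extracting a new decoder and new letters\<close>

definition prog_find :: "nat \<Rightarrow> com" where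
  "prog_find k = Seq (Asg 10 (Cn 0)) (For 5 (Cn (ndec k * k))
     (Ite (rd (add (Cn 3) (initE k (Vr 3) (Vr 5))) (Cn 0)) (Asg 10 (add (Vr 5) (Cn 1))) Skip))"

text \<open>The new letters overwrite the old ones in row 1. This is safe because the old letter of
  a vertex is needed only for its own symbol, which is computed just before the letter is
  replaced.\<close>

definition prog_letters :: "nat \<Rightarrow> com" where
  "prog_letters k = For 5 (Vr 2) (Seq (Asg 11 (Vr 5)) (Seq (Asg 8 (symE (rd (Cn 0) (Vr 11))))
     (Seq (Asg 9 (sub (rd (add (Cn 3) (Vr 6)) (Vr 11)) (Cn 1)))
     (Seq (St (cellE (Cn 1) (rd (Cn 0) (Vr 11))) (Vr 9)) (Asg 6 (stepE k (Vr 6) (Vr 8) (Vr 9)))))))"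

text \<open>Register 12 saves the letter of the new vertex, since \<open>prog_letters\<close> reuses
  register 8. The old decoder in register 3 can be replaced early: from here on it is needed only
  inside the automaton state.\<close>

definition prog_trace :: "nat \<Rightarrow> com" where
  "prog_trace k = Seq (Asg 8 (sub (Vr 10) (Cn 1))) (Seq (Asg 6 (initE k (Vr 3) (Vr 8)))
     (Seq (Asg 12 (modE k (Vr 8))) (Seq (Asg 3 (divE k (Vr 8)))
     (Seq (prog_letters k) (St (cellE (Cn 1) (Vr 2)) (Vr 12))))))"

context ram
begin

lemma init_cnt_less: "ndec k * k < 2 ^ w"
proof -
  have "1 * (ndec k * k) \<le> ndec k * (ndec k * k)" by (intro mult_le_mono) auto
  from le_less_trans[OF this lim_init] show ?thesis by (simp only: mult_1)
qed

text \<open>Column 0 holds the values for the whole word and all states at once, so each new decoder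
  and letter of the new vertex costs just one lookup.\<close>

lemma prog_find:
  assumes "R0 0 = n" "R0 1 = base" "R0 3 < ndec k"
  shows "hoare w (prog_find k) (ndec k * k * (4 * A)) (start R0 M0)
    (\<lambda>R M. M = M0 \<and> ag {5, 10} R0 R \<and>
      R 10 = pick (\<lambda>c. M0 (cl (3 + ninit k (R0 3) c) 0) \<noteq> 0) (ndec k * k))"
proof -
  let ?f = "\<lambda>c. M0 (cl (3 + ninit k (R0 3) c) 0) \<noteq> 0" and ?J = "ndec k * k"
  let ?I = "\<lambda>j R M. M = M0 \<and> ag {5, 10} R0 R \<and> R 10 = pick ?f j"
  let ?e = "rd (add (Cn 3) (initE k (Vr 3) (Vr 5))) (Cn 0)"
  have J: "1 \<le> ?J" using k1 by (simp add: Suc_le_eq)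
  have loop: "hoare w (For 5 (Cn ?J) (Ite ?e (Asg 10 (add (Vr 5) (Cn 1))) Skip)) (?J * (2 * A + A))
    (\<lambda>R M. M = M0 \<and> ag {5, 10} R0 R \<and> R 10 = 0) (?I ?J)"
  proof (rule hoare_For_bound[OF w1, where I = ?I])
    fix j assume j: "j < ?J"
    show "hoare w (Ite ?e (Asg 10 (add (Vr 5) (Cn 1))) Skip) (2 * A)
      (\<lambda>R M. R 5 = j \<and> ?I j R M) (\<lambda>R M. R 5 = j \<and> ?I (Suc j) (R(5 := Suc j)) M)"
    proof (rule hoare_pre, rule hoare_Ite[OF w1], simp, rule hoare_Asg[OF w1], simp, simp, rule hoare_Skip)
      fix R M assume I: "R 5 = j \<and> ?I j R M"
      have R: "R 0 = n" "R (Suc 0) = base" "R 3 = R0 3" "R 5 = j"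
        using I assms by (auto simp: ag_def)
      have st: "eval (initE k (Vr 3) (Vr 5)) R M = ninit k (R0 3) j"
        "safe w (initE k (Vr 3) (Vr 5)) R M"
        using R j assms by (simp_all add: eval_initE safe_initE)
      have lt: "ninit k (R0 3) j < nst k" using assms j k1 by (intro ninit_less)
      have e: "eval ?e R M = M (cl (3 + ninit k (R0 3) j) 0)"
        using R by (simp add: eval_rd st)
      have s: "safe w ?e R M"
        using R lt st by (intro safe_rd) (auto intro!: small simp: base_def one_less)
      have "Suc j < 2 ^ w" using j init_cnt_less by simp
      then show "safe w ?e R M \<and> (if eval ?e R M \<noteq> 0
          then safe w (add (Vr 5) (Cn 1)) R M \<and> (R(10 := eval (add (Vr 5) (Cn 1)) R M)) 5 = j \<and>
            ?I (Suc j) (R(10 := eval (add (Vr 5) (Cn 1)) R M, 5 := Suc j)) M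
          else R 5 = j \<and> ?I (Suc j) (R(5 := Suc j)) M)"
        unfolding e using I s R by (auto simp: ag_def one_less)
    qed (use cost_le_cmax in auto)
  qed (use J init_cnt_less in \<open>auto simp: ag_def\<close>)
  have JA: "A \<le> ?J * A" using mult_le_mono[OF J order_refl, of A] by simp
  show ?thesis unfolding prog_find_def
  proof (rule hoare_pre, rule hoare_Seq, rule loop, rule hoare_Asg[OF w1])
    show "cost (Cn 0) + 2 + ?J * (2 * A + A) \<le> ?J * (4 * A)"
    proof -
      define z where "z = ?J * A"
      have e: "?J * (2 * A + A) = 3 * z" "?J * (4 * A) = 4 * z" by (simp_all add: z_def algebra_simps)
      show ?thesis unfolding e using JA[folded z_def] cost_le_cmax(6) by simp
    qed
  qed (auto simp: ag_def)
qed

definition only :: "nat set \<Rightarrow> (nat \<Rightarrow> nat) \<Rightarrow> (nat \<Rightarrow> nat) \<Rightarrow> bool" where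
  "only S M0 M \<longleftrightarrow> (\<forall>a<base. M a = M0 a) \<and> (\<forall>r c. r \<notin> S \<longrightarrow> c \<le> n \<longrightarrow> M (cl r c) = M0 (cl r c))"

lemma only_refl: "only S M M"
  by (simp add: only_def)

lemma only_upd: "only S M0 M \<Longrightarrow> r \<in> S \<Longrightarrow> c \<le> n \<Longrightarrow> only S M0 (M(cl r c := v))"
  using cl_ge_base by (auto simp: only_def cl_eq_iff)

lemma only_cell: "only S M0 M \<Longrightarrow> r \<notin> S \<Longrightarrow> c \<le> n \<Longrightarrow> M (cl r c) = M0 (cl r c)"
  by (simp add: only_def)

lemma only_trans: "only S M0 M \<Longrightarrow> only T M M' \<Longrightarrow> S \<subseteq> U \<Longrightarrow> T \<subseteq> U \<Longrightarrow> only U M0 M'"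
  by (simp add: only_def) (metis in_mono)

lemma only_env: "env R0 M0 \<Longrightarrow> only T M0 M \<Longrightarrow> ag S R0 R \<Longrightarrow> 0 \<notin> S \<Longrightarrow> 1 \<notin> S \<Longrightarrow> env R M"
proof (rule env_cong, assumption)
  fix x :: nat assume "ag S R0 R" "0 \<notin> S" "1 \<notin> S" "x < 2"
  then show "R x = R0 x" by (cases x) (auto simp: ag_def)
qed (simp add: only_def)

lemma prog_letters:
  assumes "env R0 M0" "R0 2 = i" "i < n" "word i M0" and inj: "inj_on (\<lambda>j. M0 (cl 0 j)) {..<i}"
    and q: "R0 6 = q" "q < nst k"
    and dp: "\<And>j q. j \<le> i \<Longrightarrow> q < nst k \<Longrightarrow> M0 (cl (3 + q) j) = goodv k s i (i - j) q"
    and good: "goodv k s i i q \<noteq> 0" and s: "\<And>j. j < i \<Longrightarrow> s j = sy i M0 j"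
  shows "hoare w (prog_letters k) (n * (6 * A)) (start R0 M0)
    (\<lambda>R M. ag {5, 6, 8, 9, 11} R0 R \<and> only {1} M0 M \<and>
      (\<forall>j<i. M (cl 1 (M0 (cl 0 j))) = goodv k s i (i - j) (trace k s i q j) - 1))"
proof -
  let ?b = "\<lambda>j. goodv k s i (i - j) (trace k s i q j) - 1" and ?p = "\<lambda>j. M0 (cl 0 j)"
  let ?I = "\<lambda>t R M. ag {5, 6, 8, 9, 11} R0 R \<and> only {1} M0 M \<and> R 6 = trace k s i q t \<and>
    (\<forall>j<t. M (cl 1 (?p j)) = ?b j) \<and> (\<forall>j<i. t \<le> j \<longrightarrow> M (cl 1 (?p j)) = M0 (cl 1 (?p j)))"
  have R01: "R0 0 = n" "R0 1 = base" using assms(1) by (auto simp: env_def)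
  have tr: "trace k s i q t < nst k" if "t \<le> i" for t
    using that
  proof (induction t)
    case (Suc t)
    then show ?case
      using trace_letter[OF good, of t] s[of t] word_sy[OF assms(4), of t] by (auto intro: nstep_less)
  qed (simp add: q)
  have "hoare w (prog_letters k) (n * (5 * A + A)) (start R0 M0) (?I i)"
    unfolding prog_letters_def
  proof (rule hoare_For_bound[OF w1, where I = ?I])
    fix t assume t: "t < i"
    have pt: "?p t < i" "?p t \<le> n" using assms(3,4) t by (auto simp: word_def)
    have bt: "?b t < k" by (rule trace_letter[OF good t])
    have st: "s t < 2 * k" using s[OF t] word_sy[OF assms(4) t] by simp
    let ?P1 = "\<lambda>R M. R 5 = t \<and> ?I t R M \<and> R 11 = t"
    let ?P2 = "\<lambda>R M. R 5 = t \<and> ?I t R M \<and> R 11 = t \<and> R 8 = s t"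
    let ?P3 = "\<lambda>R M. R 5 = t \<and> ?I t R M \<and> R 11 = t \<and> R 8 = s t \<and> R 9 = ?b t"
    let ?P4 = "\<lambda>R M. R 5 = t \<and> ag {5, 6, 8, 9, 11} R0 R \<and> only {1} M0 M \<and> R 6 = trace k s i q t \<and>
      (\<forall>j<Suc t. M (cl 1 (?p j)) = ?b j) \<and>
      (\<forall>j<i. Suc t \<le> j \<longrightarrow> M (cl 1 (?p j)) = M0 (cl 1 (?p j))) \<and> R 8 = s t \<and> R 9 = ?b t"
    let ?x = "rd (Cn 0) (Vr 11)"
    have x: "eval ?x R M = ?p t" "safe w ?x R M" "env R M" "R 0 = n" "R (Suc 0) = base" "R 2 = i"
      if "?P1 R M" for R M
    proof -
      show e: "env R M" using only_env[OF assms(1), of "{1}" M "{5, 6, 8, 9, 11}" R] that by simp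
      then show R: "R 0 = n" "R (Suc 0) = base" by (auto simp: env_def)
      show "R 2 = i" using that assms(2) by (simp add: ag_def)
      have "M (cl 0 t) = ?p t" using that only_cell[of "{1}" M0 M 0 t] t assms(3) by simp
      then show "eval ?x R M = ?p t" using that R by (simp add: eval_rd)
      show "safe w ?x R M" using that R t assms(3) by (intro safe_rd) auto
    qed
    have 1: "hoare w (Asg 11 (Vr 5)) 4 (\<lambda>R M. R 5 = t \<and> ?I t R M) ?P1"
      by (rule hoare_pre[OF hoare_Asg[OF w1]]) (auto simp: ag_def)
    have 2: "hoare w (Asg 8 (symE ?x)) A ?P1 ?P2"
    proof (rule hoare_pre[OF hoare_Asg[OF w1]])
      fix R M assume P: "?P1 R M"
      note x = x[OF P]
      have m: "M (cl 1 (?p t)) = M0 (cl 1 (?p t))" using P t by simp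
      have "M (cl 1 (?p t)) < k" using m assms(4) pt by (simp add: word_def)
      then have "eval (symE ?x) R M = sym_of adj (\<lambda>x. M (cl 1 x)) i (?p t)" "safe w (symE ?x) R M"
        using symE[OF x(3,6) assms(3), of ?x] x pt assms(3) by auto
      moreover have "sym_of adj (\<lambda>x. M (cl 1 x)) i (?p t) = s t"
        using m s[OF t] by (simp add: sym_of_def sy_def)
      ultimately show "safe w (symE ?x) R M \<and> ?P2 (R(8 := eval (symE ?x) R M)) M"
        using P by (auto simp: ag_def)
    qed (use cost_le_cmax(6) in auto)
    let ?e3 = "rd (add (Cn 3) (Vr 6)) (Vr 11)"
    have 3: "hoare w (Asg 9 (sub ?e3 (Cn 1))) A ?P2 ?P3"
    proof (rule hoare_pre[OF hoare_Asg[OF w1]])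
      fix R M assume P: "?P2 R M"
      then have x: "env R M" "R 0 = n" "R (Suc 0) = base" "R 2 = i" using x[of R M] by blast+
      have "M (cl (3 + trace k s i q t) t) = M0 (cl (3 + trace k s i q t) t)"
        using P only_cell[of "{1}" M0 M] t assms(3) by simp
      also have "\<dots> = goodv k s i (i - t) (trace k s i q t)" using dp tr t by simp
      finally have e: "eval ?e3 R M = goodv k s i (i - t) (trace k s i q t)"
        using P x by (simp add: eval_rd)
      have "safe w ?e3 R M" using P x tr[of t] t assms(3) by (intro safe_rd) (auto intro!: small)
      then show "safe w (sub ?e3 (Cn 1)) R M \<and> ?P3 (R(9 := eval (sub ?e3 (Cn 1)) R M)) M"
        using P e by (auto simp: ag_def one_less)
    qed (use cost_le_cmax(6) in auto)
    have 4: "hoare w (St (cellE (Cn 1) ?x) (Vr 9)) A ?P3 ?P4"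
    proof (rule hoare_pre[OF hoare_St[OF w1]])
      fix R M assume P: "?P3 R M"
      then have x: "eval ?x R M = ?p t" "safe w ?x R M" "env R M" "R 0 = n" "R (Suc 0) = base" "R 2 = i"
        using x[of R M] by blast+
      have c: "eval (cellE (Cn 1) ?x) R M = cl 1 (?p t)" using x by (simp add: eval_cellE)
      have cs: "safe w (cellE (Cn 1) ?x) R M" using x pt by (intro safe_cellE) (auto simp: one_less)
      have o: "only {1} M0 (M(cl 1 (?p t) := ?b t))" using P pt by (intro only_upd) auto
      \<comment> \<open>Distinct positions hold distinct vertices, so this store spoils neither the
        new letters already written nor the old ones still to be read.\<close>
      have ne: "?p j \<noteq> ?p t" "?p j \<le> n" if "j < i" "j \<noteq> t" for j
        using inj_onD[OF inj, of j t] that t assms(3,4) by (auto simp: word_def)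
      have "\<forall>j<Suc t. (M(cl 1 (?p t) := ?b t)) (cl 1 (?p j)) = ?b j"
        using P ne t pt by (auto simp: less_Suc_eq cl_eq_iff)
      moreover have "\<forall>j<i. Suc t \<le> j \<longrightarrow> (M(cl 1 (?p t) := ?b t)) (cl 1 (?p j)) = M0 (cl 1 (?p j))"
        using P ne pt by (auto simp: cl_eq_iff)
      moreover have "R 9 = ?b t" using P by simp
      ultimately show "safe w (cellE (Cn 1) ?x) R M \<and> safe w (Vr 9) R M \<and>
        ?P4 R (M(eval (cellE (Cn 1) ?x) R M := eval (Vr 9) R M))"
        unfolding c eval.simps using P cs o by simp
    qed (use cost_le_cmax(6) in auto)
    have 5: "hoare w (Asg 6 (stepE k (Vr 6) (Vr 8) (Vr 9))) A ?P4
      (\<lambda>R M. R 5 = t \<and> ?I (Suc t) (R(5 := Suc t)) M)"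
    proof (rule hoare_pre[OF hoare_Asg[OF w1]])
      fix R M assume P: "?P4 R M"
      have "eval (stepE k (Vr 6) (Vr 8) (Vr 9)) R M = trace k s i q (Suc t)"
        "safe w (stepE k (Vr 6) (Vr 8) (Vr 9)) R M"
        using P tr[of t] t st bt by (simp_all add: eval_stepE safe_stepE)
      then show "safe w (stepE k (Vr 6) (Vr 8) (Vr 9)) R M \<and>
        (R(6 := eval (stepE k (Vr 6) (Vr 8) (Vr 9)) R M)) 5 = t \<and>
        ?I (Suc t) (R(6 := eval (stepE k (Vr 6) (Vr 8) (Vr 9)) R M, 5 := Suc t)) M"
        using P by (simp add: ag_def del: trace.simps)
    qed (use cost_le_cmax in auto)
    show "hoare w (Seq (Asg 11 (Vr 5)) (Seq (Asg 8 (symE ?x))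
     (Seq (Asg 9 (sub ?e3 (Cn 1)))
     (Seq (St (cellE (Cn 1) ?x) (Vr 9)) (Asg 6 (stepE k (Vr 6) (Vr 8) (Vr 9))))))) (5 * A)
      (\<lambda>R M. R 5 = t \<and> ?I t R M) (\<lambda>R M. R 5 = t \<and> ?I (Suc t) (R(5 := Suc t)) M)"
      by (rule hoare_pre[OF hoare_Seq[OF hoare_Seq[OF hoare_Seq[OF hoare_Seq[OF 5 4] 3] 2] 1]])
        (use cost_le_cmax(6) in auto)
  next
    show "i < 2 ^ w" by (rule n_less) (use assms(3) in simp)
  qed (use assms(2,3) q only_refl in \<open>auto simp: ag_def\<close>)
  then show ?thesis
    by (rule hoare_conseq) auto
qed

lemma prog_trace:
  assumes "env R0 M0" "R0 2 = i" "i < n" "word i M0" and inj: "inj_on (\<lambda>j. M0 (cl 0 j)) {..<i}"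
    and d: "R0 3 = d" "d < ndec k" and c: "R0 10 = Suc c" "c < ndec k * k"
    and dp: "\<And>j q. j \<le> i \<Longrightarrow> q < nst k \<Longrightarrow> M0 (cl (3 + q) j) = goodv k s i (i - j) q"
    and good: "goodv k s i i (ninit k d c) \<noteq> 0" and s: "\<And>j. j < i \<Longrightarrow> s j = sy i M0 j"
  shows "hoare w (prog_trace k) (n * (11 * A)) (start R0 M0)
    (\<lambda>R M. ag {3, 5, 6, 8, 9, 11, 12} R0 R \<and> R 3 = c div k \<and> only {1} M0 M \<and> M (cl 1 i) = c mod k \<and>
      (\<forall>j<i. M (cl 1 (M0 (cl 0 j))) = goodv k s i (i - j) (trace k s i (ninit k d c) j) - 1))"
proof -
  let ?q = "ninit k d c"
  let ?b = "\<lambda>j. goodv k s i (i - j) (trace k s i ?q j) - 1"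
  let ?ag = "\<lambda>R. ag {3, 5, 6, 8, 9, 11, 12} R0 R"
  have R01: "R0 0 = n" "R0 1 = base" using assms(1) by (auto simp: env_def)
  have c2: "c < 2 ^ w" using c(2) init_cnt_less by simp
  have q: "?q < nst k" using ninit_less[OF k1 d(2) c(2)] .
  let ?P1 = "\<lambda>R M. M = M0 \<and> ?ag R \<and> R 3 = d \<and> R 8 = c"
  let ?P2 = "\<lambda>R M. M = M0 \<and> ?ag R \<and> R 3 = d \<and> R 8 = c \<and> R 6 = ?q"
  let ?P3 = "\<lambda>R M. M = M0 \<and> ?ag R \<and> R 3 = d \<and> R 8 = c \<and> R 6 = ?q \<and> R 12 = c mod k"
  let ?P4 = "\<lambda>R M. M = M0 \<and> ?ag R \<and> R 3 = c div k \<and> R 6 = ?q \<and> R 12 = c mod k"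
  let ?P5 = "\<lambda>R M. ?ag R \<and> R 3 = c div k \<and> only {1} M0 M \<and> R 12 = c mod k \<and>
      (\<forall>j<i. M (cl 1 (M0 (cl 0 j))) = ?b j)"
  let ?P6 = "\<lambda>R M. ?ag R \<and> R 3 = c div k \<and> only {1} M0 M \<and> M (cl 1 i) = c mod k \<and>
      (\<forall>j<i. M (cl 1 (M0 (cl 0 j))) = ?b j)"
  have 1: "hoare w (Asg 8 (sub (Vr 10) (Cn 1))) A (start R0 M0) ?P1"
    by (rule hoare_pre[OF hoare_Asg[OF w1]]) (use c d cost_le_cmax(6) in \<open>auto simp: ag_def one_less\<close>)
  have 2: "hoare w (Asg 6 (initE k (Vr 3) (Vr 8))) A ?P1 ?P2"
    by (rule hoare_pre[OF hoare_Asg[OF w1]])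
       (use c d cost_le_cmax in \<open>auto simp: ag_def eval_initE safe_initE\<close>)
  have 3: "hoare w (Asg 12 (modE k (Vr 8))) A ?P2 ?P3"
    by (rule hoare_pre[OF hoare_Asg[OF w1]])
       (use c d c2 cost_le_cmax(6) in \<open>auto simp: ag_def safe_modE\<close>)
  have 4: "hoare w (Asg 3 (divE k (Vr 8))) A ?P3 ?P4"
    by (rule hoare_pre[OF hoare_Asg[OF w1]])
       (use c d cost_le_cmax(6) in \<open>auto simp: ag_def\<close>)
  have 5: "hoare w (prog_letters k) (n * (6 * A)) ?P4 ?P5"
  proof (rule hoare_use)
    fix R1 M1 assume P: "?P4 R1 M1"
    then have M1: "M1 = M0" by simp
    have e: "env R1 M0"
      using only_env[OF assms(1) only_refl, of "{3, 5, 6, 8, 9, 11, 12}" R1] P by simp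
    have R: "R1 2 = i" "R1 6 = ?q" using P assms(2) by (auto simp: ag_def)
    show "hoare w (prog_letters k) (n * (6 * A)) (start R1 M1) ?P5"
      unfolding M1
      by (rule hoare_conseq[OF prog_letters[OF e R(1) assms(3,4) inj R(2) q dp good s]])
         (use P in \<open>auto simp: ag_def\<close>)
  qed
  have 6: "hoare w (St (cellE (Cn 1) (Vr 2)) (Vr 12)) A ?P5 ?P6"
  proof (rule hoare_pre[OF hoare_St[OF w1]])
    fix R M assume P: "?P5 R M"
    have R: "R 0 = n" "R (Suc 0) = base" "R 2 = i" using P R01 assms(2) by (auto simp: ag_def)
    have ce: "eval (cellE (Cn 1) (Vr 2)) R M = cl 1 i" using R by (simp add: eval_cellE)
    have cs: "safe w (cellE (Cn 1) (Vr 2)) R M" using R assms(3) by (intro safe_cellE) (auto simp: one_less)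
    have o: "only {1} M0 (M(cl 1 i := c mod k))" using P assms(3) by (intro only_upd) auto
    have ne: "cl 1 (M0 (cl 0 j)) \<noteq> cl 1 i" if "j < i" for j
      using that assms(3,4) by (subst cl_eq_iff) (auto simp: word_def)
    have "R 12 = c mod k" using P by simp
    then show "safe w (cellE (Cn 1) (Vr 2)) R M \<and> safe w (Vr 12) R M \<and>
        ?P6 R (M(eval (cellE (Cn 1) (Vr 2)) R M := eval (Vr 12) R M))"
      unfolding ce eval.simps using P o ne cs by simp
  qed (use cost_le_cmax(6) in auto)
  have nA: "A \<le> n * A" using mult_le_mono[OF n1 order_refl, of A] by simp
  show ?thesis unfolding prog_trace_def
    by (rule hoare_pre[OF hoare_Seq[OF hoare_Seq[OF hoare_Seq[OF hoare_Seq[OF hoare_Seq[OF 6 5] 4] 3] 2] 1]])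
      (use nA in auto)
qed

end

section \<open>Topological sorting on the machine\<close>

definition prog_count :: "nat \<Rightarrow> com" where
  "prog_count k = For 6 (add (Vr 2) (Cn 1)) (Asg 9 (add (Vr 9) (arcE k (Vr 6) (Vr 5))))"

definition prog_indeg :: "nat \<Rightarrow> com" where
  "prog_indeg k = For 5 (add (Vr 2) (Cn 1)) (Seq (Asg 9 (Cn 0)) (Seq (prog_count k)
     (St (cellE (Cn 2) (Vr 5)) (sub (Vr 9) (arcE k (Vr 5) (Vr 5))))))"

definition prog_source :: com where
  "prog_source = For 6 (add (Vr 2) (Cn 1)) (Ite (rd (Cn 2) (Vr 6)) Skip (Asg 9 (Vr 6)))"

definition prog_update :: "nat \<Rightarrow> com" where
  "prog_update k = For 6 (add (Vr 2) (Cn 1))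
     (St (cellE (Cn 2) (Vr 6)) (sub (rd (Cn 2) (Vr 6)) (arcE k (Vr 9) (Vr 6))))"

text \<open>The last store overwrites the indegree 0 of the vertex just placed by 1, so that it is
  never taken for a source again. It also makes harmless whatever \<open>prog_update\<close> did to
  that entry on the diagonal.\<close>

definition prog_sort :: "nat \<Rightarrow> com" where
  "prog_sort k = For 5 (add (Vr 2) (Cn 1)) (Seq (Asg 9 (Cn 0)) (Seq prog_source
     (Seq (St (cellE (Cn 0) (Vr 5)) (Vr 9)) (Seq (prog_update k) (St (cellE (Cn 2) (Vr 9)) (Cn 1))))))"

context ram
begin

text \<open>\<open>arc\<close> and \<open>forced\<close> differ only on the diagonal, so subtracting
  the diagonal entry leaves the true indegree.\<close>

lemma sum_arc:
  assumes "x < m"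
  shows "(\<Sum>y<m. arc d l y x) - arc d l x x = indeg (forced adj (dec k d) l) m {} x"
proof -
  have 1: "(\<Sum>y<m. arc d l y x) = arc d l x x + (\<Sum>y\<in>{..<m} - {x}. arc d l y x)"
    using assms by (intro sum.remove) auto
  have "(\<Sum>y\<in>{..<m} - {x}. arc d l y x) = (\<Sum>y\<in>{..<m} - {x}. of_bool ((y, x) \<in> forced adj (dec k d) l))"
    by (intro sum.cong) (auto simp: arc_def forced_def)
  also have "\<dots> = card (({..<m} - {x}) \<inter> {y. (y, x) \<in> forced adj (dec k d) l})"
    by simp
  also have "({..<m} - {x}) \<inter> {y. (y, x) \<in> forced adj (dec k d) l} = {y. y < m \<and> (y, x) \<in> forced adj (dec k d) l \<and> y \<notin> {}}"
    by (auto simp: forced_def)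
  finally show ?thesis using 1 by (simp add: indeg_def)
qed

lemma arc_le: "arc d l x y \<le> 1"
  by (simp add: arc_def)

lemma arcE':
  assumes "env R M" "R 3 = d" "d < ndec k" "i < n" "\<And>x. x \<le> i \<Longrightarrow> M (cl 1 x) = l x" "\<And>x. x \<le> i \<Longrightarrow> l x < k"
    "R x = a" "a \<le> i" "R y = b" "b \<le> i"
  shows "eval (arcE k (Vr x) (Vr y)) R M = arc d l a b" "safe w (arcE k (Vr x) (Vr y)) R M"
proof -
  have *: "M (cl 1 (eval (Vr x) R M)) < k" "M (cl 1 (eval (Vr y) R M)) < k"
    using assms(5)[of a] assms(6)[of a] assms(5)[of b] assms(6)[of b] assms(7-10) by auto
  have "eval (Vr x) R M < n" "eval (Vr y) R M < n" using assms by auto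
  note a = arcE[OF assms(1-3) this(1) _ *(1) this(2) _ *(2)]
  show "safe w (arcE k (Vr x) (Vr y)) R M" by (rule a) auto
  show "eval (arcE k (Vr x) (Vr y)) R M = arc d l a b"
    using assms(5)[of a] assms(5)[of b] assms(7-10) by (subst a) (auto simp: arc_def)
qed

lemma prog_count:
  assumes "env R0 M0" "R0 2 = i" "i < n" "R0 3 = d" "d < ndec k"
    and l: "\<And>x. x \<le> i \<Longrightarrow> M0 (cl 1 x) = l x" "\<And>x. x \<le> i \<Longrightarrow> l x < k"
    and x: "R0 5 = x" "x \<le> i" "R0 9 = 0"
  shows "hoare w (prog_count k) (n * (2 * A)) (start R0 M0)
    (\<lambda>R M. M = M0 \<and> ag {6, 9} R0 R \<and> R 9 = (\<Sum>y<Suc i. arc d l y x))"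
proof -
  let ?I = "\<lambda>j R M. M = M0 \<and> ag {6, 9} R0 R \<and> R 9 = (\<Sum>y<j. arc d l y x)"
  have bnd: "(\<Sum>y<j. arc d l y x) \<le> j" for j
    using sum_mono[of "{..<j}" "\<lambda>y. arc d l y x" "\<lambda>_. 1"] arc_le by simp
  have "hoare w (prog_count k) (n * (A + A)) (start R0 M0) (?I (Suc i))"
    unfolding prog_count_def
  proof (rule hoare_For_bound[OF w1, where I = ?I])
    fix j assume j: "j < Suc i"
    show "hoare w (Asg 9 (add (Vr 9) (arcE k (Vr 6) (Vr 5)))) A
      (\<lambda>R M. R 6 = j \<and> ?I j R M) (\<lambda>R M. R 6 = j \<and> ?I (Suc j) (R(6 := Suc j)) M)"
    proof (rule hoare_pre[OF hoare_Asg[OF w1]])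
      fix R M assume I: "R 6 = j \<and> ?I j R M"
      have e: "env R M0" using only_env[OF assms(1) only_refl, of "{6, 9}" R] I by simp
      have R: "R 3 = d" "R 5 = x" "R 6 = j" "M = M0" using I assms by (auto simp: ag_def)
      have a: "eval (arcE k (Vr 6) (Vr 5)) R M = arc d l j x" "safe w (arcE k (Vr 6) (Vr 5)) R M"
        unfolding R(4) using arcE'[OF e R(1) assms(5,3) l R(3) _ R(2) x(2)] j by auto
      have "(\<Sum>y<Suc j. arc d l y x) < 2 ^ w"
        using bnd[of "Suc j"] j assms(3) by (intro n_less) linarith
      then show "safe w (add (Vr 9) (arcE k (Vr 6) (Vr 5))) R M \<and>
        (R(9 := eval (add (Vr 9) (arcE k (Vr 6) (Vr 5))) R M)) 6 = j \<and>
        ?I (Suc j) (R(9 := eval (add (Vr 9) (arcE k (Vr 6) (Vr 5))) R M, 6 := Suc j)) M"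
        using I a by (simp add: ag_def)
    qed (use cost_le_cmax in auto)
  next
    show "Suc i < 2 ^ w" by (rule n_less) (use assms(3) in simp)
    then show "safe w (add (Vr 2) (Cn 1)) R M \<and> eval (add (Vr 2) (Cn 1)) R M = Suc i"
      if "?I j R M" for j R M
      using that assms(2) by (simp add: ag_def one_less)
  qed (use assms(3) x n1 in \<open>auto simp: ag_def\<close>)
  then show ?thesis by (simp add: mult_2)
qed

lemma prog_indeg:
  assumes "env R0 M0" "R0 2 = i" "i < n" "R0 3 = d" "d < ndec k"
    and l: "\<And>x. x \<le> i \<Longrightarrow> M0 (cl 1 x) = l x" "\<And>x. x \<le> i \<Longrightarrow> l x < k"
  shows "hoare w (prog_indeg k) (n * (n * (5 * A))) (start R0 M0)
    (\<lambda>R M. ag {5, 6, 9} R0 R \<and> only {2} M0 M \<and>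
      (\<forall>x<Suc i. M (cl 2 x) = indeg (forced adj (dec k d) l) (Suc i) {} x))"
proof -
  let ?F = "forced adj (dec k d) l"
  let ?I = "\<lambda>j R M. ag {5, 6, 9} R0 R \<and> only {2} M0 M \<and> (\<forall>x<j. M (cl 2 x) = indeg ?F (Suc i) {} x)"
  have R01: "R0 0 = n" "R0 1 = base" using assms(1) by (auto simp: env_def)
  have nA: "A \<le> n * A" using mult_le_mono[OF n1 order_refl, of A] by simp
  have "hoare w (prog_indeg k) (n * (n * (4 * A) + A)) (start R0 M0) (?I (Suc i))"
    unfolding prog_indeg_def
  proof (rule hoare_For_bound[OF w1, where I = ?I])
    fix x assume x: "x < Suc i"
    let ?P1 = "\<lambda>R M. R 5 = x \<and> ?I x R M \<and> R 9 = 0"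
    let ?P2 = "\<lambda>R M. R 5 = x \<and> ?I x R M \<and> R 9 = (\<Sum>y<Suc i. arc d l y x)"
    have pre: "env R M" "R 2 = i" "R 3 = d" "\<And>x. x \<le> i \<Longrightarrow> M (cl 1 x) = l x" if "?I x R M" for R M
    proof -
      show "env R M" using only_env[OF assms(1), of "{2}" M "{5, 6, 9}" R] that by simp
      show "R 2 = i" "R 3 = d" using that assms by (auto simp: ag_def)
      show "M (cl 1 x) = l x" if "x \<le> i" for x
        using only_cell[of "{2}" M0 M 1 x] l(1)[OF that] that assms(3) \<open>?I _ R M\<close> by simp
    qed
    have 1: "hoare w (Asg 9 (Cn 0)) A (\<lambda>R M. R 5 = x \<and> ?I x R M) ?P1"
      by (rule hoare_pre[OF hoare_Asg[OF w1]]) (use cost_le_cmax(6) in \<open>auto simp: ag_def\<close>)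
    have 2: "hoare w (prog_count k) (n * (2 * A)) ?P1 ?P2"
    proof (rule hoare_use)
      fix R1 M1 assume P: "?P1 R1 M1"
      then have I: "?I x R1 M1" and R: "R1 5 = x" "R1 9 = 0" by auto
      note p = pre[OF I]
      show "hoare w (prog_count k) (n * (2 * A)) (start R1 M1) ?P2"
        by (rule hoare_conseq[OF prog_count[OF p(1,2) assms(3) p(3) assms(5) p(4) l(2) R(1) _ R(2)]])
           (use x P in \<open>auto simp: ag_def\<close>)
    qed
    let ?e = "sub (Vr 9) (arcE k (Vr 5) (Vr 5))"
    have 3: "hoare w (St (cellE (Cn 2) (Vr 5)) ?e) A ?P2
      (\<lambda>R M. R 5 = x \<and> ?I (Suc x) (R(5 := Suc x)) M)"
    proof (rule hoare_pre[OF hoare_St[OF w1]])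
      fix R M assume P: "?P2 R M"
      then have I: "?I x R M" and R: "R 5 = x" by auto
      note p = pre[OF I]
      have x': "x \<le> i" "x \<le> n" using x assms(3) by auto
      have a: "eval (arcE k (Vr 5) (Vr 5)) R M = arc d l x x" "safe w (arcE k (Vr 5) (Vr 5)) R M"
        using arcE'[OF p(1,3) assms(5,3) p(4) l(2) R x'(1) R x'(1)] by auto
      have R': "R 0 = n" "R (Suc 0) = base" using p(1) by (auto simp: env_def)
      have c: "eval (cellE (Cn 2) (Vr 5)) R M = cl 2 x" using R R' by (simp add: eval_cellE)
      have cs: "safe w (cellE (Cn 2) (Vr 5)) R M" using R R' x' k_less[of 2] k1
        by (intro safe_cellE) auto
      have v: "eval ?e R M = indeg ?F (Suc i) {} x" using P a sum_arc[OF x] by simp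
      have o: "only {2} M0 (M(cl 2 x := v))" for v using P x' by (intro only_upd) auto
      show "safe w (cellE (Cn 2) (Vr 5)) R M \<and> safe w ?e R M \<and>
        R 5 = x \<and> ?I (Suc x) (R(5 := Suc x)) (M(eval (cellE (Cn 2) (Vr 5)) R M := eval ?e R M))"
        unfolding c v using cs a(2) P o x' by (auto simp: ag_def cl_eq_iff less_Suc_eq)
    qed (use cost_le_cmax in auto)
    show "hoare w (Seq (Asg 9 (Cn 0)) (Seq (prog_count k) (St (cellE (Cn 2) (Vr 5)) ?e))) (n * (4 * A))
      (\<lambda>R M. R 5 = x \<and> ?I x R M) (\<lambda>R M. R 5 = x \<and> ?I (Suc x) (R(5 := Suc x)) M)"
      by (rule hoare_pre[OF hoare_Seq[OF hoare_Seq[OF 3 2] 1]]) (use nA in auto)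
  next
    show "Suc i < 2 ^ w" by (rule n_less) (use assms(3) in simp)
    then show "safe w (add (Vr 2) (Cn 1)) R M \<and> eval (add (Vr 2) (Cn 1)) R M = Suc i"
      if "?I j R M" for j R M
      using that assms(2) by (simp add: ag_def one_less)
  qed (use assms(3) n1 only_refl in \<open>auto simp: ag_def\<close>)
  then show ?thesis
  proof (rule hoare_conseq)
    show "n * (n * (4 * A) + A) \<le> n * (n * (5 * A))"
      by (intro mult_le_mono2) (use nA in simp)
  qed auto
qed

lemma two_less: "2 < (2::nat) ^ w"
  by (rule k_less) (use k1 in \<open>cases k; simp\<close>)

text \<open>The result is not shifted by one, so it cannot tell the absence of a source from vertex
  0. It is used only where acyclicity guarantees a source.\<close>

lemma prog_source:
  assumes "R0 0 = n" "R0 1 = base" "R0 2 = i" "i < n" "R0 9 = 0"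
  shows "hoare w prog_source (n * (2 * A)) (start R0 M0)
    (\<lambda>R M. M = M0 \<and> ag {6, 9} R0 R \<and> R 9 = pick (\<lambda>x. M0 (cl 2 x) = 0) (Suc i) - 1)"
proof -
  let ?I = "\<lambda>j R M. M = M0 \<and> ag {6, 9} R0 R \<and> R 9 = pick (\<lambda>x. M0 (cl 2 x) = 0) j - 1"
  let ?e = "rd (Cn 2) (Vr 6)"
  have "hoare w prog_source (n * (A + A)) (start R0 M0) (?I (Suc i))"
    unfolding prog_source_def
  proof (rule hoare_For_bound[OF w1, where I = ?I])
    fix j assume j: "j < Suc i"
    show "hoare w (Ite ?e Skip (Asg 9 (Vr 6))) A
      (\<lambda>R M. R 6 = j \<and> ?I j R M) (\<lambda>R M. R 6 = j \<and> ?I (Suc j) (R(6 := Suc j)) M)"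
    proof (rule hoare_pre, rule hoare_Ite[OF w1], simp, rule hoare_Skip, rule hoare_Asg[OF w1], simp, simp)
      fix R M assume I: "R 6 = j \<and> ?I j R M"
      have R: "R 0 = n" "R (Suc 0) = base" using I assms by (auto simp: ag_def)
      have e: "eval ?e R M = M0 (cl 2 j)" using R I by (simp add: eval_rd)
      have s: "safe w ?e R M" using R I j assms(4) two_less by (intro safe_rd) auto
      show "safe w ?e R M \<and> (if eval ?e R M \<noteq> 0 then R 6 = j \<and> ?I (Suc j) (R(6 := Suc j)) M
        else safe w (Vr 6) R M \<and> (R(9 := eval (Vr 6) R M)) 6 = j \<and>
          ?I (Suc j) (R(9 := eval (Vr 6) R M, 6 := Suc j)) M)"
        unfolding e using s I by (auto simp: ag_def)
    qed (use cost_le_cmax(6) in auto)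
  next
    show "Suc i < 2 ^ w" by (rule n_less) (use assms(4) in simp)
    then show "safe w (add (Vr 2) (Cn 1)) R M \<and> eval (add (Vr 2) (Cn 1)) R M = Suc i"
      if "?I j R M" for j R M
      using that assms(3) by (simp add: ag_def one_less)
  qed (use assms n1 in \<open>auto simp: ag_def\<close>)
  then show ?thesis by (simp add: mult_2)
qed

lemma prog_update:
  assumes "env R0 M0" "R0 2 = i" "i < n" "R0 3 = d" "d < ndec k"
    and l: "\<And>x. x \<le> i \<Longrightarrow> M0 (cl 1 x) = l x" "\<And>x. x \<le> i \<Longrightarrow> l x < k"
    and z: "R0 9 = z" "z \<le> i"
  shows "hoare w (prog_update k) (n * (2 * A)) (start R0 M0)
    (\<lambda>R M. ag {6} R0 R \<and> only {2} M0 M \<and> (\<forall>x<Suc i. M (cl 2 x) = M0 (cl 2 x) - arc d l z x))"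
proof -
  let ?I = "\<lambda>j R M. ag {6} R0 R \<and> only {2} M0 M \<and> (\<forall>x<j. M (cl 2 x) = M0 (cl 2 x) - arc d l z x) \<and>
    (\<forall>x\<le>i. j \<le> x \<longrightarrow> M (cl 2 x) = M0 (cl 2 x))"
  let ?e = "sub (rd (Cn 2) (Vr 6)) (arcE k (Vr 9) (Vr 6))"
  have "hoare w (prog_update k) (n * (A + A)) (start R0 M0) (?I (Suc i))"
    unfolding prog_update_def
  proof (rule hoare_For_bound[OF w1, where I = ?I])
    fix x assume x: "x < Suc i"
    show "hoare w (St (cellE (Cn 2) (Vr 6)) ?e) A
      (\<lambda>R M. R 6 = x \<and> ?I x R M) (\<lambda>R M. R 6 = x \<and> ?I (Suc x) (R(6 := Suc x)) M)"
    proof (rule hoare_pre[OF hoare_St[OF w1]])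
      fix R M assume P: "R 6 = x \<and> ?I x R M"
      have e: "env R M" using only_env[OF assms(1), of "{2}" M "{6}" R] P by simp
      have R: "R 2 = i" "R 3 = d" "R 9 = z" "R 6 = x" using P assms by (auto simp: ag_def)
      have lx: "M (cl 1 y) = l y" if "y \<le> i" for y
        using only_cell[of "{2}" M0 M 1 y] l(1)[OF that] that assms(3) P by simp
      have x': "x \<le> i" "x \<le> n" using x assms(3) by auto
      have a: "eval (arcE k (Vr 9) (Vr 6)) R M = arc d l z x" "safe w (arcE k (Vr 9) (Vr 6)) R M"
        using arcE'[OF e R(2) assms(5,3) lx l(2) R(3) z(2) R(4) x'(1)] by auto
      have R': "R 0 = n" "R (Suc 0) = base" using e by (auto simp: env_def)
      have c: "eval (cellE (Cn 2) (Vr 6)) R M = cl 2 x" using R R' by (simp add: eval_cellE)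
      have cs: "safe w (cellE (Cn 2) (Vr 6)) R M" using R R' x' two_less
        by (intro safe_cellE) auto
      have r: "eval (rd (Cn 2) (Vr 6)) R M = M0 (cl 2 x)" "safe w (rd (Cn 2) (Vr 6)) R M"
        using R R' P x' two_less by (auto simp: eval_rd intro!: safe_rd)
      have v: "eval ?e R M = M0 (cl 2 x) - arc d l z x" using r a by simp
      have o: "only {2} M0 (M(cl 2 x := v))" for v using P x' by (intro only_upd) auto
      show "safe w (cellE (Cn 2) (Vr 6)) R M \<and> safe w ?e R M \<and>
        R 6 = x \<and> ?I (Suc x) (R(6 := Suc x)) (M(eval (cellE (Cn 2) (Vr 6)) R M := eval ?e R M))"
        unfolding c v using cs a(2) r(2) P o x' assms(3) by (auto simp: ag_def cl_eq_iff less_Suc_eq)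
    qed (use cost_le_cmax in auto)
  next
    show "Suc i < 2 ^ w" by (rule n_less) (use assms(3) in simp)
    then show "safe w (add (Vr 2) (Cn 1)) R M \<and> eval (add (Vr 2) (Cn 1)) R M = Suc i"
      if "?I j R M" for j R M
      using that assms(2) by (simp add: ag_def one_less)
  qed (use assms(3) n1 only_refl in \<open>auto simp: ag_def\<close>)
  then show ?thesis
    by (rule hoare_conseq) (auto simp: mult_2)
qed

end

lemma sorted_upto_cong:
  "(\<And>s. s < t \<Longrightarrow> p s = p' s) \<Longrightarrow> sorted_upto F m p t = sorted_upto F m p' t"
proof -
  assume *: "\<And>s. s < t \<Longrightarrow> p s = p' s"
  then have "p ` {..<s} = p' ` {..<s}" if "s \<le> t" for s using that by auto
  moreover have "inj_on p {..<t} = inj_on p' {..<t}" using * by (intro inj_on_cong) auto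
  ultimately show ?thesis unfolding sorted_upto_def using * by auto
qed

context ram
begin

lemma prog_sort:
  assumes "env R0 M0" "R0 2 = i" "i < n" "R0 3 = d" "d < ndec k"
    and l: "\<And>x. x \<le> i \<Longrightarrow> M0 (cl 1 x) = l x" "\<And>x. x \<le> i \<Longrightarrow> l x < k"
    and acyc: "acyclic (forced adj (dec k d) l \<inter> {..<Suc i} \<times> {..<Suc i})"
    and deg: "\<And>x. x < Suc i \<Longrightarrow> M0 (cl 2 x) = indeg (forced adj (dec k d) l) (Suc i) {} x"
  shows "hoare w (prog_sort k) (n * (n * (8 * A))) (start R0 M0)
    (\<lambda>R M. ag {5, 6, 9} R0 R \<and> only {0, 2} M0 M \<and>
      sorted_upto (forced adj (dec k d) l) (Suc i) (\<lambda>s. M (cl 0 s)) (Suc i))"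
proof -
  let ?F = "forced adj (dec k d) l" and ?m = "Suc i"
  let ?p = "\<lambda>M s. M (cl 0 s)"
  \<comment> \<open>Row 2 holds true indegrees only for unplaced vertices; placed ones carry the
    mark 1.\<close>
  let ?c = "\<lambda>P x. if x \<in> P then 1 else indeg ?F ?m P x"
  let ?I = "\<lambda>t R M. ag {5, 6, 9} R0 R \<and> only {0, 2} M0 M \<and> sorted_upto ?F ?m (?p M) t \<and>
    (\<forall>x<?m. M (cl 2 x) = ?c (?p M ` {..<t}) x)"
  have nA: "A \<le> n * A" using mult_le_mono[OF n1 order_refl, of A] by simp
  have pre: "env R M" "R 0 = n" "R (Suc 0) = base" "R 2 = i" "R 3 = d" "\<And>x. x \<le> i \<Longrightarrow> M (cl 1 x) = l x"
    if "ag {5, 6, 9} R0 R" "only {0, 2} M0 M" for R M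
  proof -
    show e: "env R M" using only_env[OF assms(1), of "{0, 2}" M "{5, 6, 9}" R] that by simp
    then show "R 0 = n" "R (Suc 0) = base" by (auto simp: env_def)
    show "R 2 = i" "R 3 = d" using that assms by (auto simp: ag_def)
    show "M (cl 1 x) = l x" if "x \<le> i" for x
      using only_cell[of "{0, 2}" M0 M 1 x] l(1)[OF that] that assms(3) \<open>only _ _ _\<close> by simp
  qed
  have "hoare w (prog_sort k) (n * (n * (7 * A) + A)) (start R0 M0) (?I ?m)"
    unfolding prog_sort_def
  proof (rule hoare_For_bound[OF w1, where I = ?I])
    fix t assume t: "t < ?m"
    then have t': "t \<le> i" "t \<le> n" using assms(3) by auto
    let ?z = "\<lambda>R M. R 9 < ?m \<and> R 9 \<notin> ?p M ` {..<t} \<and> indeg ?F ?m (?p M ` {..<t}) (R 9) = 0"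
    let ?P0 = "\<lambda>R M. R 5 = t \<and> ?I t R M \<and> R 9 = 0"
    let ?P1 = "\<lambda>R M. R 5 = t \<and> ?I t R M \<and> ?z R M"
    let ?P2 = "\<lambda>R M. R 5 = t \<and> ?I t R M \<and> ?z R M \<and> ?p M t = R 9"
    let ?P3 = "\<lambda>R M. R 5 = t \<and> ag {5, 6, 9} R0 R \<and> only {0, 2} M0 M \<and> sorted_upto ?F ?m (?p M) t \<and>
      (\<forall>x<?m. M (cl 2 x) = ?c (?p M ` {..<t}) x - arc d l (R 9) x) \<and> ?z R M \<and> ?p M t = R 9"
    have 1: "hoare w (Asg 9 (Cn 0)) A (\<lambda>R M. R 5 = t \<and> ?I t R M) ?P0"
      by (rule hoare_pre[OF hoare_Asg[OF w1]]) (use cost_le_cmax(6) in \<open>auto simp: ag_def\<close>)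
    have 2: "hoare w prog_source (n * (2 * A)) ?P0 ?P1"
    proof (rule hoare_use)
      fix R1 M1 assume P: "?P0 R1 M1"
      then have I: "ag {5, 6, 9} R0 R1" "only {0, 2} M0 M1" and R: "R1 5 = t" "R1 9 = 0"
        and so: "sorted_upto ?F ?m (?p M1) t" and cnt: "\<And>x. x < ?m \<Longrightarrow> M1 (cl 2 x) = ?c (?p M1 ` {..<t}) x"
        by auto
      note p = pre[OF I]
      \<comment> \<open>Fewer than \<open>?m\<close> vertices have been placed, so some vertex is
        left and acyclicity provides a source among the rest.\<close>
      have "?p M1 ` {..<t} \<subseteq> {..<?m}" "card (?p M1 ` {..<t}) = t"
        using so by (auto simp: sorted_upto_def card_image)
      then have "?p M1 ` {..<t} \<subset> {..<?m}" using t by (metis card_lessThan nat_less_le psubsetI)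
      then obtain x where x: "x < ?m" "x \<notin> ?p M1 ` {..<t}" "indeg ?F ?m (?p M1 ` {..<t}) x = 0"
        by (rule exists_source[OF acyc])
      then have "M1 (cl 2 x) = 0" using cnt by simp
      then have "pick (\<lambda>x. M1 (cl 2 x) = 0) ?m \<noteq> 0" using x(1) unfolding pick_neq_0 by blast
      from pick_less[OF this] have pk: "pick (\<lambda>x. M1 (cl 2 x) = 0) ?m - 1 < ?m"
        "M1 (cl 2 (pick (\<lambda>x. M1 (cl 2 x) = 0) ?m - 1)) = 0" by auto
      show "hoare w prog_source (n * (2 * A)) (start R1 M1) ?P1"
      proof (rule hoare_conseq[OF prog_source[of R1 i M1]])
        fix R M assume Q: "M = M1 \<and> ag {6, 9} R1 R \<and> R 9 = pick (\<lambda>x. M1 (cl 2 x) = 0) ?m - 1"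
        then have "R 9 < ?m" "M1 (cl 2 (R 9)) = 0" using pk by simp_all
        then have "?z R M" using cnt[of "R 9"] Q by (simp split: if_splits)
        then show "?P1 R M" using Q P by (simp add: ag_def)
      qed (use p R assms(3) in auto)
    qed
    have 3: "hoare w (St (cellE (Cn 0) (Vr 5)) (Vr 9)) A ?P1 ?P2"
    proof (rule hoare_pre[OF hoare_St[OF w1]])
      fix R M assume P: "?P1 R M"
      then have I: "ag {5, 6, 9} R0 R" "only {0, 2} M0 M" and R: "R 5 = t" by auto
      note p = pre[OF I]
      have c: "eval (cellE (Cn 0) (Vr 5)) R M = cl 0 t" using R p by (simp add: eval_cellE)
      have cs: "safe w (cellE (Cn 0) (Vr 5)) R M" using R p t' by (intro safe_cellE) auto
      let ?M = "M(cl 0 t := R 9)"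
      have o: "only {0, 2} M0 ?M" using I t' by (intro only_upd) auto
      have ps: "?p ?M s = ?p M s" if "s < t" for s using that t' by (simp add: cl_eq_iff)
      then have im: "?p ?M ` {..<t} = ?p M ` {..<t}" by auto
      have so: "sorted_upto ?F ?m (?p ?M) t" using P sorted_upto_cong[OF ps, where F = ?F and m = ?m] by simp
      have c2: "?M (cl 2 x) = M (cl 2 x)" if "x < ?m" for x using that t' assms(3) by (simp add: cl_eq_iff)
      have "?P2 R ?M" unfolding im using so o P c2 by simp
      then show "safe w (cellE (Cn 0) (Vr 5)) R M \<and> safe w (Vr 9) R M \<and>
        ?P2 R (M(eval (cellE (Cn 0) (Vr 5)) R M := eval (Vr 9) R M))"
        unfolding c eval.simps using cs by simp
    qed (use cost_le_cmax(6) in auto)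
    have 4: "hoare w (prog_update k) (n * (2 * A)) ?P2 ?P3"
    proof (rule hoare_use)
      fix R1 M1 assume P: "?P2 R1 M1"
      then have I: "ag {5, 6, 9} R0 R1" "only {0, 2} M0 M1" and z: "R1 9 \<le> i" by auto
      note p = pre[OF I]
      show "hoare w (prog_update k) (n * (2 * A)) (start R1 M1) ?P3"
      proof (rule hoare_conseq[OF prog_update[OF p(1,4) assms(3) p(5) assms(5) p(6) l(2) refl z]])
        fix R M assume Q: "ag {6} R1 R \<and> only {2} M1 M \<and> (\<forall>x<Suc i. M (cl 2 x) = M1 (cl 2 x) - arc d l (R1 9) x)"
        then have R: "R 9 = R1 9" "R 5 = R1 5" by (auto simp: ag_def)
        have ps: "?p M s = ?p M1 s" if "s \<le> t" for s using Q that t' only_cell[of "{2}" M1 M 0 s] by simp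
        then have im: "?p M ` {..<t} = ?p M1 ` {..<t}" by auto
        have so: "sorted_upto ?F ?m (?p M) t" using P sorted_upto_cong[where F = ?F and m = ?m and t = t and p = "?p M" and p' = "?p M1"] ps by simp
        have o: "only {0, 2} M0 M" by (rule only_trans[of "{0, 2}" M0 M1 "{2}"]) (use Q P in auto)
        show "?P3 R M" unfolding im R using so o P Q ps[of t] by (simp add: ag_def)
      qed auto
    qed
    have 5: "hoare w (St (cellE (Cn 2) (Vr 9)) (Cn 1)) A ?P3 (\<lambda>R M. R 5 = t \<and> ?I (Suc t) (R(5 := Suc t)) M)"
    proof (rule hoare_pre[OF hoare_St[OF w1]])
      fix R M assume P: "?P3 R M"
      then have I: "ag {5, 6, 9} R0 R" "only {0, 2} M0 M" and R: "R 5 = t"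
        and z: "R 9 < ?m" "R 9 \<notin> ?p M ` {..<t}" "indeg ?F ?m (?p M ` {..<t}) (R 9) = 0"
        and pz: "?p M t = R 9" and so: "sorted_upto ?F ?m (?p M) t" by auto
      note p = pre[OF I]
      have z': "R 9 \<le> n" using z(1) assms(3) by simp
      have c: "eval (cellE (Cn 2) (Vr 9)) R M = cl 2 (R 9)" using p by (simp add: eval_cellE)
      have cs: "safe w (cellE (Cn 2) (Vr 9)) R M" using p z' two_less by (intro safe_cellE) auto
      let ?M = "M(cl 2 (R 9) := Suc 0)" and ?P = "?p M ` {..<t}"
      have o: "only {0, 2} M0 ?M" using I z' by (intro only_upd) auto
      have ps: "?p ?M s = ?p M s" if "s < Suc t" for s using that t' z' by (simp add: cl_eq_iff)
      then have "?p ?M ` {..<Suc t} = ?p M ` {..<Suc t}" by auto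
      also have "\<dots> = insert (R 9) ?P" using pz by (simp add: lessThan_Suc)
      finally have im: "?p ?M ` {..<Suc t} = insert (R 9) ?P" .
      have "sorted_upto ?F ?m ((?p M)(t := R 9)) (Suc t)" by (rule sorted_upto_Suc[OF so z])
      moreover have "(?p M)(t := R 9) = ?p M" using pz by (simp add: fun_eq_iff)
      ultimately have so': "sorted_upto ?F ?m (?p ?M) (Suc t)"
        using sorted_upto_cong[OF ps, where F = ?F and m = ?m] by simp
      have "?M (cl 2 x) = ?c (insert (R 9) ?P) x" if x: "x < ?m" for x
      proof (cases "x = R 9")
        case False
        then have 1: "?M (cl 2 x) = ?c ?P x - arc d l (R 9) x"
          using P x z' assms(3) by (simp add: cl_eq_iff)
        have arc: "arc d l (R 9) x = of_bool ((R 9, x) \<in> ?F)" using False by (simp add: arc_def forced_def)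
        show ?thesis
        proof (cases "x \<in> ?P")
          case True
          then obtain s where s: "s < t" "x = ?p M s" by auto
          \<comment> \<open>All predecessors of a placed vertex were placed before it, so no update
            ever decrements its mark.\<close>
          have "(R 9, x) \<notin> ?F"
          proof
            assume "(R 9, x) \<in> ?F"
            then have "R 9 \<in> ?p M ` {..<s}" using so s z(1) unfolding sorted_upto_def by blast
            then show False using z(2) s(1) by auto
          qed
          then show ?thesis using 1 arc True by simp
        next
          case xP: False
          have "?c (insert (R 9) ?P) x = indeg ?F ?m (insert (R 9) ?P) x" using xP False by simp
          also have "\<dots> = indeg ?F ?m ?P x - of_bool ((R 9, x) \<in> ?F)" by (rule indeg_insert[OF z(1,2)])
          finally show ?thesis using 1 arc xP by simp
        qed
      qed simp
      then have "?I (Suc t) (R(5 := Suc t)) ?M" unfolding im using so' o I(1) by (simp add: ag_def)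
      then show "safe w (cellE (Cn 2) (Vr 9)) R M \<and> safe w (Cn 1) R M \<and>
        R 5 = t \<and> ?I (Suc t) (R(5 := Suc t)) (M(eval (cellE (Cn 2) (Vr 9)) R M := eval (Cn 1) R M))"
        unfolding c eval.simps One_nat_def using cs R one_less by simp
    qed (use cost_le_cmax(6) in auto)
    show "hoare w (Seq (Asg 9 (Cn 0)) (Seq prog_source
     (Seq (St (cellE (Cn 0) (Vr 5)) (Vr 9)) (Seq (prog_update k) (St (cellE (Cn 2) (Vr 9)) (Cn 1)))))) (n * (7 * A))
      (\<lambda>R M. R 5 = t \<and> ?I t R M) (\<lambda>R M. R 5 = t \<and> ?I (Suc t) (R(5 := Suc t)) M)"
      by (rule hoare_pre[OF hoare_Seq[OF hoare_Seq[OF hoare_Seq[OF hoare_Seq[OF 5 4] 3] 2] 1]]) (use nA in auto)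
  next
    show "Suc i < 2 ^ w" by (rule n_less) (use assms(3) in simp)
    then show "safe w (add (Vr 2) (Cn 1)) R M \<and> eval (add (Vr 2) (Cn 1)) R M = Suc i"
      if "?I j R M" for j R M
      using that assms(2) by (simp add: ag_def one_less)
  next
    fix R M assume "R = R0 \<and> M = M0"
    then show "?I 0 (R(5 := 0)) M" using deg by (simp add: ag_def only_refl sorted_upto_def)
  qed (use assms(3) n1 in auto)
  then show ?thesis
  proof (rule hoare_conseq)
    show "n * (n * (7 * A) + A) \<le> n * (n * (8 * A))"
      by (intro mult_le_mono2) (use nA in simp)
  qed auto
qed

end

section \<open>Iterative compression, one vertex at a time\<close>

definition solvable :: "(nat \<Rightarrow> nat \<Rightarrow> bool) \<Rightarrow> nat \<Rightarrow> nat \<Rightarrow> bool" where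
  "solvable adj k m \<longleftrightarrow> (\<exists>D l. D \<subseteq> {..<k} \<times> {..<k} \<and> (\<forall>x<m. l x < k) \<and>
     acyclic (forced adj D l \<inter> {..<m} \<times> {..<m}))"

text \<open>The forced pairs on fewer vertices form a subrelation. Read contrapositively, this lets
  a failed search skip all remaining vertices.\<close>

lemma solvable_mono: "solvable adj k m \<Longrightarrow> m' \<le> m \<Longrightarrow> solvable adj k m'"
proof -
  assume "solvable adj k m" "m' \<le> m"
  then obtain D l where D: "D \<subseteq> {..<k} \<times> {..<k}" "\<forall>x<m. l x < k"
    "acyclic (forced adj D l \<inter> {..<m} \<times> {..<m})" unfolding solvable_def by blast
  have "acyclic (forced adj D l \<inter> {..<m'} \<times> {..<m'})"
    by (rule acyclic_subset[OF D(3)]) (use \<open>m' \<le> m\<close> in auto)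
  then show ?thesis using D \<open>m' \<le> m\<close> unfolding solvable_def by (meson less_le_trans)
qed

lemma realises_cong:
  assumes "realises adj k m D l p" "\<And>x. x < m \<Longrightarrow> l' x = l x" "\<And>j. j < m \<Longrightarrow> p' j = p j"
  shows "realises adj k m D l' p'"
proof -
  have "bij_betw p' {..<m} {..<m}"
    using assms(1,3) bij_betw_cong[of "{..<m}" p p'] by (auto simp: realises_def)
  moreover have "p j < m" if "j < m" for j
    using assms(1) that by (auto simp: realises_def bij_betw_def)
  ultimately show ?thesis using assms unfolding realises_def by simp
qed

definition prog_place :: "nat \<Rightarrow> com" where
  "prog_place k = Seq (prog_indeg k) (prog_sort k)"

definition prog_search :: "nat \<Rightarrow> com" where
  "prog_search k = Seq (prog_dp k) (Seq (prog_find k)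
     (Ite (Vr 10) (Seq (prog_trace k) (prog_place k)) (Asg 4 (Cn 0))))"

definition prog_vertex :: "nat \<Rightarrow> com" where
  "prog_vertex k = Ite (Vr 4) (Seq (prog_acc k) (prog_search k)) Skip"

text \<open>In units of \<open>cmax k\<close>, 13 is made up of 4 for \<open>prog_acc\<close> and 9
  for \<open>prog_dp\<close>, and the next 4 belongs to \<open>prog_find\<close>. The 30 covers 11
  for \<open>prog_trace\<close>, 13 for \<open>prog_place\<close> and the lower-order costs.\<close>

definition vertex_time :: "nat \<Rightarrow> nat" where
  "vertex_time k = (nst k * (k * 13) + ndec k * k * 4 + 30) * cmax k"

context ram
begin

abbreviation letters :: "(nat \<Rightarrow> nat) \<Rightarrow> nat \<Rightarrow> nat" where "letters M x \<equiv> M (cl 1 x)"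
abbreviation order :: "(nat \<Rightarrow> nat) \<Rightarrow> nat \<Rightarrow> nat" where "order M j \<equiv> M (cl 0 j)"

definition state_inv :: "nat \<Rightarrow> (nat \<Rightarrow> nat) \<Rightarrow> (nat \<Rightarrow> nat) \<Rightarrow> bool" where
  "state_inv m R M \<longleftrightarrow> env R M \<and>
     (R 4 = 1 \<and> R 3 < ndec k \<and> realises adj k m (dec k (R 3)) (letters M) (order M) \<or>
      R 4 = 0 \<and> \<not> solvable adj k m)"

lemma prog_place:
  assumes "env R0 M0" "R0 2 = i" "i < n" "R0 3 = d" "d < ndec k" "R0 4 = 1"
    and l: "\<And>x. x \<le> i \<Longrightarrow> letters M0 x < k"
    and acyc: "acyclic (forced adj (dec k d) (letters M0) \<inter> {..<Suc i} \<times> {..<Suc i})"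
  shows "hoare w (prog_place k) (n * (n * (13 * A))) (start R0 M0)
    (\<lambda>R M. R 2 = i \<and> state_inv (Suc i) R M)"
proof -
  let ?F = "forced adj (dec k d) (letters M0)"
  let ?P = "\<lambda>R M. ag {5, 6, 9} R0 R \<and> only {2} M0 M \<and> (\<forall>x<Suc i. M (cl 2 x) = indeg ?F (Suc i) {} x)"
  have 1: "hoare w (prog_indeg k) (n * (n * (5 * A))) (start R0 M0) ?P"
    by (rule prog_indeg[OF assms(1-5) _ l]) auto
  have 2: "hoare w (prog_sort k) (n * (n * (8 * A))) ?P (\<lambda>R M. R 2 = i \<and> state_inv (Suc i) R M)"
  proof (rule hoare_use)
    fix R1 M1 assume P: "?P R1 M1"
    have e: "env R1 M1" using only_env[OF assms(1), of "{2}" M1 "{5, 6, 9}" R1] P by simp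
    have R: "R1 2 = i" "R1 3 = d" "R1 4 = 1" using P assms by (auto simp: ag_def)
    have lx: "letters M1 x = letters M0 x" if "x \<le> i" for x
      using only_cell[of "{2}" M0 M1 1 x] that assms(3) P by simp
    show "hoare w (prog_sort k) (n * (n * (8 * A))) (start R1 M1) (\<lambda>R M. R 2 = i \<and> state_inv (Suc i) R M)"
    proof (rule hoare_conseq[OF prog_sort[OF e R(1) assms(3) R(2) assms(5) lx l acyc]])
      fix R M assume Q: "ag {5, 6, 9} R1 R \<and> only {0, 2} M1 M \<and> sorted_upto ?F (Suc i) (order M) (Suc i)"
      have "env R M" using only_env[OF e, of "{0, 2}" M "{5, 6, 9}" R] Q by simp
      moreover have R': "R 2 = i" "R 3 = d" "R 4 = 1" using Q R by (auto simp: ag_def)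
      moreover have "realises adj k (Suc i) (dec k d) (letters M) (order M)"
      proof (rule realises_cong)
        show "realises adj k (Suc i) (dec k d) (letters M0) (order M)"
          by (rule sorted_realises) (use Q l adj_sym in auto)
        show "letters M x = letters M0 x" if "x < Suc i" for x
          using only_cell[of "{0, 2}" M1 M 1 x] lx[of x] that assms(3) Q by simp
      qed simp
      ultimately show "R 2 = i \<and> state_inv (Suc i) R M" using assms(5) by (simp add: state_inv_def)
    qed (use P in auto)
  qed
  show ?thesis unfolding prog_place_def
    by (rule hoare_pre[OF hoare_Seq[OF 2 1]]) (auto simp: algebra_simps)
qed

lemma realises_word:
  "realises adj k i D (letters M) (order M) \<Longrightarrow> word i M \<and> inj_on (order M) {..<i}"
  by (auto simp: realises_def word_def bij_betw_def)

text \<open>The realisation found need not extend the old one; the old one only supplies the order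
  of reading and the symbols. An accepting trace yields acyclicity by \<open>nrun_correct\<close>,
  and conversely every solution is an accepting run for a suitable \<open>c\<close>.\<close>

lemma prog_search:
  assumes "env R0 M0" "R0 2 = i" "i < n" "R0 3 = d" "d < ndec k" "R0 4 = 1"
    and real: "realises adj k i (dec k d) (letters M0) (order M0)"
    and acc: "\<And>q. q < nst k \<Longrightarrow> M0 (cl (3 + q) i) = of_bool (nacc k q)"
  shows "hoare w (prog_search k)
    (n * (nst k * (k * (9 * A))) + ndec k * k * (4 * A) + n * (11 * A) + n * (n * (13 * A)) + A)
    (start R0 M0) (\<lambda>R M. R 2 = i \<and> state_inv (Suc i) R M)"
proof -
  define s where "s = sy i M0"
  let ?J = "ndec k * k"
  let ?g = "\<lambda>c. goodv k s i i (ninit k d c)"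
  have wd: "word i M0" and inj: "inj_on (order M0) {..<i}" using realises_word[OF real] by auto
  have surj: "\<exists>j<i. x = order M0 j" if "x < i" for x
    using real that by (auto simp: realises_def bij_betw_def)
  have s_eq: "s = (\<lambda>j. sym_of adj (letters M0) i (order M0 j))" by (simp add: s_def sy_def fun_eq_iff)
  note corr = nrun_correct[OF k1 assms(5) _ real adj_sym, folded s_eq]
  let ?T = "\<lambda>M. \<forall>j\<le>i. \<forall>q<nst k. M (cl (3 + q) j) = goodv k s i (i - j) q"
  let ?P1 = "\<lambda>R M. ag {5, 6, 7, 8, 9, 11} R0 R \<and> low M0 M \<and> ?T M"
  let ?P2 = "\<lambda>R M. ag {5, 6, 7, 8, 9, 10, 11} R0 R \<and> low M0 M \<and> ?T M \<and> R 10 = pick (\<lambda>c. ?g c \<noteq> 0) ?J"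
  let ?P3 = "\<lambda>R M. env R M \<and> R 2 = i \<and> R 3 < ndec k \<and> R 4 = 1 \<and> (\<forall>x\<le>i. letters M x < k) \<and>
    acyclic (forced adj (dec k (R 3)) (letters M) \<inter> {..<Suc i} \<times> {..<Suc i})"
  let ?Q = "\<lambda>R M. R 2 = i \<and> state_inv (Suc i) R M"
  have 1: "hoare w (prog_dp k) (n * (nst k * (k * (9 * A)))) (start R0 M0) ?P1"
    unfolding s_def by (rule prog_dp[OF assms(1-3) wd acc])
  have R01: "R0 0 = n" "R0 1 = base" using assms(1) by (auto simp: env_def)
  have 2: "hoare w (prog_find k) (?J * (4 * A)) ?P1 ?P2"
  proof (rule hoare_use)
    fix R1 M1 assume P: "?P1 R1 M1"
    have R: "R1 0 = n" "R1 1 = base" "R1 3 = d" using P R01 assms(4) by (auto simp: ag_def)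
    \<comment> \<open>The search reads memory, but column 0 contains exactly the values for all
      \<open>i\<close> symbols.\<close>
    have pk: "pick (\<lambda>c. M1 (cl (3 + ninit k (R1 3) c) 0) \<noteq> 0) ?J = pick (\<lambda>c. ?g c \<noteq> 0) ?J"
      using P R(3) ninit_less[OF k1 assms(5)] by (intro pick_cong) simp
    show "hoare w (prog_find k) (?J * (4 * A)) (start R1 M1) ?P2"
    proof (rule hoare_conseq[OF prog_find[of R1 M1]])
      fix R M assume Q: "M = M1 \<and> ag {5, 10} R1 R \<and> R 10 = pick (\<lambda>c. M1 (cl (3 + ninit k (R1 3) c) 0) \<noteq> 0) ?J"
      show "?P2 R M" using Q P unfolding pk by (auto simp: ag_def)
    qed (use R assms(5) in auto)
  qed
  have 3: "hoare w (prog_trace k) (n * (11 * A)) (\<lambda>R M. ?P2 R M \<and> R 10 \<noteq> 0) ?P3"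
  proof (rule hoare_use)
    fix R1 M1 assume P: "?P2 R1 M1 \<and> R1 10 \<noteq> 0"
    define c where "c = R1 10 - 1"
    have c: "R1 10 = Suc c" using P by (simp add: c_def)
    have cJ: "c < ?J" and good: "?g c \<noteq> 0"
      using pick_less[of "\<lambda>c. ?g c \<noteq> 0" ?J] P unfolding c_def by auto
    have e: "env R1 M1" using low_env[OF assms(1), of M1 "{5, 6, 7, 8, 9, 10, 11}" R1] P by simp
    have R: "R1 2 = i" "R1 3 = d" "R1 4 = 1" using P assms by (auto simp: ag_def)
    have wd1: "word i M1" using low_word[OF _ wd, of M1] P assms(3) by simp
    have ord: "order M1 j = order M0 j" if "j < i" for j using P low_cell[of M0 M1 0 j] that assms(3) by simp
    have inj1: "inj_on (order M1) {..<i}" using inj inj_on_cong[of "{..<i}" "order M1" "order M0"] ord by simp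
    have sM1: "s j = sy i M1 j" if "j < i" for j
      unfolding s_def using low_sy[OF _ wd, of M1 j] P that assms(3) by simp
    let ?b = "\<lambda>j. goodv k s i (i - j) (trace k s i (ninit k d c) j) - 1"
    have T: "M1 (cl (3 + q) j) = goodv k s i (i - j) q" if "j \<le> i" "q < nst k" for j q
      using P that by simp
    show "hoare w (prog_trace k) (n * (11 * A)) (start R1 M1) ?P3"
    proof (rule hoare_conseq[OF prog_trace[OF e R(1) assms(3) wd1 inj1 R(2) assms(5) c cJ T good sM1]])
      fix R M
      assume Q: "ag {3, 5, 6, 8, 9, 11, 12} R1 R \<and> R 3 = c div k \<and> only {1} M1 M \<and> letters M i = c mod k \<and>
        (\<forall>j<i. letters M (order M1 j) = ?b j)"
      have "env R M" using only_env[OF e, of "{1}" M "{3, 5, 6, 8, 9, 11, 12}" R] Q by simp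
      moreover have "R 2 = i" "R 4 = 1" using Q R by (auto simp: ag_def)
      moreover have "R 3 < ndec k" using Q cJ by (simp add: less_mult_imp_div_less)
      moreover have b: "letters M (order M0 j) = ?b j" "?b j < k" if "j < i" for j
        using Q ord[OF that] trace_letter[OF good that] that by auto
      moreover have "letters M x < k" if "x \<le> i" for x
      proof (cases "x = i")
        case True
        then show ?thesis using Q k1 by simp
      next
        case False
        then have "x < i" using that by simp
        then obtain j where "j < i" "x = order M0 j" using surj by blast
        then show ?thesis using b by simp
      qed
      moreover have "acyclic (forced adj (dec k (c div k)) (letters M) \<inter> {..<Suc i} \<times> {..<Suc i})"
        using corr[OF cJ, of ?b "letters M"] b Q trace_acc[OF good] by simp
      ultimately show "?P3 R M" using Q by simp
    qed auto
  qed
  have 4: "hoare w (prog_place k) (n * (n * (13 * A))) ?P3 ?Q"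
  proof (rule hoare_use)
    fix R1 M1 assume P: "?P3 R1 M1"
    show "hoare w (prog_place k) (n * (n * (13 * A))) (start R1 M1) ?Q"
      by (rule prog_place[OF _ _ assms(3) refl]) (use P in auto)
  qed
  have 5: "hoare w (Asg 4 (Cn 0)) 3 (\<lambda>R M. ?P2 R M \<and> R 10 = 0) ?Q"
  proof (rule hoare_pre[OF hoare_Asg[OF w1]])
    fix R M assume P: "?P2 R M \<and> R 10 = 0"
    have e: "env R M" using low_env[OF assms(1), of M "{5, 6, 7, 8, 9, 10, 11}" R] P by simp
    have none: "?g c = 0" if "c < ?J" for c using P pick_neq_0[of "\<lambda>c. ?g c \<noteq> 0" ?J] that by auto
    have "\<not> solvable adj k (Suc i)"
    proof
      assume "solvable adj k (Suc i)"
      then obtain D' l' where D': "D' \<subseteq> {..<k} \<times> {..<k}" and l': "\<And>x. x < Suc i \<Longrightarrow> l' x < k"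
        and ac: "acyclic (forced adj D' l' \<inter> {..<Suc i} \<times> {..<Suc i})" unfolding solvable_def by blast
      obtain d' where d': "d' < ndec k" "dec k d' = D'" using dec_surj[OF D'] .
      \<comment> \<open>A hypothetical solution is turned into an initial state and a run of
        guesses: its decoder and the letter of \<open>i\<close> give \<open>c\<close>, its other
        letters are read off in the old order.\<close>
      define c where "c = d' * k + l' i"
      have c: "c < ?J" "c div k = d'" "c mod k = l' i"
        using index_less[OF d'(1) l'[of i]] l'[of i] by (auto simp: c_def)
      have b: "l' (order M0 j) < k" if "j < i" for j using wd that l' by (simp add: word_def less_Suc_eq)
      have "nacc k (nrun k (ninit k d c) s (\<lambda>j. l' (order M0 j)) i)"
        using corr[OF c(1), of "\<lambda>j. l' (order M0 j)" l'] b c ac d' by simp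
      from goodv_complete[of i, OF b this order_refl] have "?g c \<noteq> 0" by simp
      then show False using none[OF c(1)] by simp
    qed
    moreover have "env (R(4 := 0)) M" by (rule env_cong[OF e]) auto
    moreover have "R 2 = i" using P assms(2) by (simp add: ag_def)
    ultimately show "safe w (Cn 0) R M \<and> ?Q (R(4 := eval (Cn 0) R M)) M"
      by (simp add: state_inv_def)
  qed auto
  have 6: "hoare w (Ite (Vr 10) (Seq (prog_trace k) (prog_place k)) (Asg 4 (Cn 0)))
    (n * (11 * A) + n * (n * (13 * A)) + A) ?P2 ?Q"
    by (rule hoare_pre[OF hoare_Ite[OF w1 _ hoare_Seq[OF 4 3] 5]]) (use cost_le_cmax(6) in auto)
  show ?thesis unfolding prog_search_def
    by (rule hoare_pre[OF hoare_Seq[OF hoare_Seq[OF 6 2] 1]]) auto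
qed

lemma prog_vertex:
  assumes "i < n"
  shows "hoare w (prog_vertex k) (n * (n * vertex_time k))
    (\<lambda>R M. R 2 = i \<and> state_inv i R M) (\<lambda>R M. R 2 = i \<and> state_inv (Suc i) R M)"
proof -
  let ?Q = "\<lambda>R M. R 2 = i \<and> state_inv (Suc i) R M"
  let ?T = "n * (nst k * (k * (9 * A))) + ndec k * k * (4 * A) + n * (11 * A) + n * (n * (13 * A)) + A"
  have 1: "hoare w (Seq (prog_acc k) (prog_search k)) (nst k * (4 * A) + ?T)
    (\<lambda>R M. R 2 = i \<and> state_inv i R M \<and> R 4 \<noteq> 0) ?Q"
  proof (rule hoare_use)
    fix R0 M0 assume P: "R0 2 = i \<and> state_inv i R0 M0 \<and> R0 4 \<noteq> 0"
    then have e: "env R0 M0" and R0: "R0 2 = i" "R0 3 < ndec k" "R0 4 = 1"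
      and real: "realises adj k i (dec k (R0 3)) (letters M0) (order M0)" by (auto simp: state_inv_def)
    let ?P1 = "\<lambda>R M. ag {6} R0 R \<and> low M0 M \<and> (\<forall>q<nst k. M (cl (3 + q) i) = of_bool (nacc k q))"
    have a: "hoare w (prog_acc k) (nst k * (4 * A)) (start R0 M0) ?P1"
      using prog_acc[of R0 M0] e R0 assms by (simp add: env_def)
    have b: "hoare w (prog_search k) ?T ?P1 ?Q"
    proof (rule hoare_use)
      fix R1 M1 assume P: "?P1 R1 M1"
      have e1: "env R1 M1" using low_env[OF e, of M1 "{6}" R1] P by simp
      have R: "R1 2 = i" "R1 3 = R0 3" "R1 4 = 1" using P R0 by (auto simp: ag_def)
      have "realises adj k i (dec k (R0 3)) (letters M1) (order M1)"
        by (rule realises_cong[OF real]) (use P assms low_cell[of M0 M1] in auto)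
      then show "hoare w (prog_search k) ?T (start R1 M1) ?Q"
        using prog_search[OF e1 R(1) assms R(2) R0(2) R(3)] P by blast
    qed
    show "hoare w (Seq (prog_acc k) (prog_search k)) (nst k * (4 * A) + ?T) (start R0 M0) ?Q"
      by (rule hoare_Seq[OF b a])
  qed
  have 2: "hoare w Skip 1 ?Q ?Q" by (rule hoare_Skip)
  show ?thesis unfolding prog_vertex_def
  proof (rule hoare_pre[OF hoare_Ite[OF w1 _ 1 2]])
    fix R M assume P: "R 2 = i \<and> state_inv i R M"
    show "safe w (Vr 4) R M \<and> (if eval (Vr 4) R M \<noteq> 0 then R 2 = i \<and> state_inv i R M \<and> R 4 \<noteq> 0 else ?Q R M)"
      using P solvable_mono[of adj k "Suc i" i] by (auto simp: state_inv_def)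
  next
    \<comment> \<open>Each cost is inflated to a multiple of \<open>n * n\<close>, so that the
      summands can be compared coefficient by coefficient.\<close>
    have n: "z \<le> n * z" for z :: nat using mult_le_mono[OF n1 order_refl, of z] by simp
    have nn: "z \<le> n * (n * z)" "n * z \<le> n * (n * z)" for z :: nat
      using n[of z] n[of "n * z"] by (auto intro: order_trans)
    define x where "x = nst k * (k * A)"
    define y where "y = ndec k * k * A"
    have "nst k * (4 * A) \<le> 4 * x" using k1 by (auto simp: x_def)
    also have "\<dots> \<le> n * (n * (4 * x))" by (rule nn)
    finally have 1: "nst k * (4 * A) \<le> n * (n * (4 * x))" .
    have "nst k * (k * (9 * A)) = 9 * x" by (simp add: x_def)
    then have 2: "n * (nst k * (k * (9 * A))) \<le> n * (n * (9 * x))" using nn(2)[of "9 * x"] by simp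
    have "ndec k * k * (4 * A) = 4 * y" by (simp add: y_def)
    then have 3: "ndec k * k * (4 * A) \<le> n * (n * (4 * y))" using nn(1)[of "4 * y"] by simp
    have 4: "n * (11 * A) \<le> n * (n * (11 * A))" by (rule nn)
    have "A + 10 \<le> 2 * A" using cost_le_cmax(6) by simp
    also have "\<dots> \<le> n * (n * (2 * A))" by (rule nn)
    finally have 5: "A + 10 \<le> n * (n * (2 * A))" .
    have "n * (n * vertex_time k) = n * (n * (4 * x)) + n * (n * (9 * x)) + n * (n * (4 * y)) +
       n * (n * (11 * A)) + n * (n * (13 * A)) + n * (n * (2 * A)) + n * (n * (4 * A))"
      by (simp add: vertex_time_def x_def y_def algebra_simps)
    then have "nst k * (4 * A) + ?T + 10 \<le> n * (n * vertex_time k)"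
      using 1 2 3 4 5 by linarith
    moreover have "cost (Vr 4) + 1 + max z 1 \<le> z + 10" for z by simp
    ultimately show "cost (Vr 4) + 1 + max (nst k * (4 * A) + ?T) 1 \<le> n * (n * vertex_time k)"
      by (rule order_trans[rotated])
  qed auto
qed

end

section \<open>Output and the main loop\<close>

definition prog_output :: "nat \<Rightarrow> com" where
  "prog_output k = Seq (For 5 (Cn (k * k)) (St (Vr 5) (decE k (Vr 5))))
     (Seq (For 5 (Vr 0) (St (add (Cn (k * k)) (Vr 5)) (rd (Cn 1) (Vr 5))))
       (For 5 (Vr 0) (St (add (Cn (k * k)) (add (Vr 0) (rd (Cn 0) (Vr 5)))) (add (Vr 5) (Cn 1)))))"

text \<open>Register 0 is needed as \<open>n\<close> until the output has been written, so the
  answer is kept in register 4 and copied at the very end.\<close>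

definition prog_main :: "nat \<Rightarrow> com" where
  "prog_main k = Seq (Asg 1 (add (mul (Vr 0) (Vr 0)) (add (Cn (k * k)) (mul (Cn 2) (Vr 0)))))
     (Seq (Asg 4 (Cn 1)) (Seq (For 2 (Vr 0) (prog_vertex k))
       (Seq (Ite (Vr 4) (prog_output k) Skip) (Asg 0 (Vr 4)))))"

definition main_time :: "nat \<Rightarrow> nat" where
  "main_time k = vertex_time k + (2 * (k * k) + 10) * cmax k"

context ram
begin

definition written :: "nat \<Rightarrow> (nat \<Rightarrow> nat) \<Rightarrow> (nat \<Rightarrow> nat) \<Rightarrow> (nat \<Rightarrow> nat) \<Rightarrow> bool" where
  "written d l p M \<longleftrightarrow> (\<forall>e<k * k. M e = of_bool ((e div k, e mod k) \<in> dec k d)) \<and>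
     (\<forall>x<n. M (k * k + x) = l x) \<and> (\<forall>t<n. M (k * k + (n + p t)) = Suc t)"

lemma kk_less: "k * k < 2 ^ w"
  by (rule k_less) simp

text \<open>Row 0 lists the vertices by position, whereas the output lists positions by vertex. The
  third loop therefore writes through \<open>order M0\<close> and thereby inverts the permutation;
  \<open>Suc\<close> makes positions start at 1.\<close>

lemma prog_output:
  assumes "R0 0 = n" "R0 1 = base" "R0 3 = d" "d < ndec k"
    and p: "bij_betw (order M0) {..<n} {..<n}"
  shows "hoare w (prog_output k) (k * k * (2 * A) + n * (4 * A)) (start R0 M0)
    (\<lambda>R M. ag {5} R0 R \<and> written d (letters M0) (order M0) M)"
proof -
  let ?hi = "\<lambda>R M. ag {5} R0 R \<and> (\<forall>r c. M (cl r c) = M0 (cl r c))"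
  let ?D = "\<lambda>m M. \<forall>e<m. M e = of_bool ((e div k, e mod k) \<in> dec k d)"
  let ?L = "\<lambda>m M. \<forall>x<m. M (k * k + x) = letters M0 x"
  let ?O = "\<lambda>m M. \<forall>t<m. M (k * k + (n + order M0 t)) = Suc t"
  have inj: "inj_on (order M0) {..<n}" and lt: "\<And>t. t < n \<Longrightarrow> order M0 t < n"
    using p by (auto simp: bij_betw_def)
  have cl_ne: "cl r c \<noteq> a" if "a < base" for r c a using cl_ge_base[of r c] that by auto
  have kk: "1 \<le> k * k" using k1 by simp
  have sm: "a < 2 ^ w" if "a \<le> base" for a by (rule small) (use that in simp)
  let ?P1 = "\<lambda>R M. ?hi R M \<and> ?D (k * k) M" and ?P2 = "\<lambda>R M. ?hi R M \<and> ?D (k * k) M \<and> ?L n M"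
  have 1: "hoare w (For 5 (Cn (k * k)) (St (Vr 5) (decE k (Vr 5)))) (k * k * (A + A)) (start R0 M0) ?P1"
  proof (rule hoare_For_bound[OF w1, where I = "\<lambda>j R M. ?hi R M \<and> ?D j M"])
    fix j assume j: "j < k * k"
    show "hoare w (St (Vr 5) (decE k (Vr 5))) A (\<lambda>R M. R 5 = j \<and> ?hi R M \<and> ?D j M)
      (\<lambda>R M. R 5 = j \<and> ?hi (R(5 := Suc j)) M \<and> ?D (Suc j) M)"
    proof (rule hoare_pre[OF hoare_St[OF w1]])
      fix R M assume P: "R 5 = j \<and> ?hi R M \<and> ?D j M"
      have R: "R 3 = d" using P assms by (auto simp: ag_def)
      have e: "eval (decE k (Vr 5)) R M = of_bool ((j div k, j mod k) \<in> dec k d)" "safe w (decE k (Vr 5)) R M"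
        using decE[where R = R and d = d and e = "Vr 5" and M = M] R assms(4) P j by auto
      have jb: "j < base" using j by (simp add: base_def)
      show "safe w (Vr 5) R M \<and> safe w (decE k (Vr 5)) R M \<and> R 5 = j \<and>
        ?hi (R(5 := Suc j)) (M(eval (Vr 5) R M := eval (decE k (Vr 5)) R M)) \<and>
        ?D (Suc j) (M(eval (Vr 5) R M := eval (decE k (Vr 5)) R M))"
        using P e cl_ne[OF jb] by (auto simp: ag_def less_Suc_eq)
    qed (use cost_le_cmax in auto)
  qed (use kk kk_less in \<open>auto simp: ag_def\<close>)
  have 2: "hoare w (For 5 (Vr 0) (St (add (Cn (k * k)) (Vr 5)) (rd (Cn 1) (Vr 5)))) (n * (A + A)) ?P1 ?P2"
  proof (rule hoare_For_bound[OF w1, where I = "\<lambda>j R M. ?P1 R M \<and> ?L j M"])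
    fix j assume j: "j < n"
    let ?a = "add (Cn (k * k)) (Vr 5)" and ?e = "rd (Cn 1) (Vr 5)"
    show "hoare w (St ?a ?e) A (\<lambda>R M. R 5 = j \<and> ?P1 R M \<and> ?L j M)
      (\<lambda>R M. R 5 = j \<and> ?P1 (R(5 := Suc j)) M \<and> ?L (Suc j) M)"
    proof (rule hoare_pre[OF hoare_St[OF w1]])
      fix R M assume P: "R 5 = j \<and> ?P1 R M \<and> ?L j M"
      have R: "R 0 = n" "R (Suc 0) = base" "R 5 = j" using P assms by (auto simp: ag_def)
      have a: "eval ?a R M = k * k + j" using R by simp
      have e: "eval ?e R M = letters M0 j" using R P by (simp add: eval_rd)
      have jb: "k * k + j < base" using j by (simp add: base_def)
      have s: "safe w ?a R M" "safe w ?e R M"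
        using R j kk_less sm[of "k * k + j"] jb by (auto intro!: safe_rd simp: one_less)
      show "safe w ?a R M \<and> safe w ?e R M \<and> R 5 = j \<and>
        ?P1 (R(5 := Suc j)) (M(eval ?a R M := eval ?e R M)) \<and> ?L (Suc j) (M(eval ?a R M := eval ?e R M))"
        unfolding a e using P s cl_ne[OF jb] by (auto simp: ag_def less_Suc_eq)
    qed (use cost_le_cmax in auto)
  qed (use n1 n_less assms in \<open>auto simp: ag_def\<close>)
  have 3: "hoare w (For 5 (Vr 0) (St (add (Cn (k * k)) (add (Vr 0) (rd (Cn 0) (Vr 5)))) (add (Vr 5) (Cn 1))))
    (n * (A + A)) ?P2 (\<lambda>R M. ?P2 R M \<and> ?O n M)"
  proof (rule hoare_For_bound[OF w1, where I = "\<lambda>j R M. ?P2 R M \<and> ?O j M"])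
    fix j assume j: "j < n"
    let ?a = "add (Cn (k * k)) (add (Vr 0) (rd (Cn 0) (Vr 5)))" and ?e = "add (Vr 5) (Cn 1)"
    show "hoare w (St ?a ?e) A (\<lambda>R M. R 5 = j \<and> ?P2 R M \<and> ?O j M)
      (\<lambda>R M. R 5 = j \<and> ?P2 (R(5 := Suc j)) M \<and> ?O (Suc j) M)"
    proof (rule hoare_pre[OF hoare_St[OF w1]])
      fix R M assume P: "R 5 = j \<and> ?P2 R M \<and> ?O j M"
      have R: "R 0 = n" "R (Suc 0) = base" "R 5 = j" using P assms by (auto simp: ag_def)
      have r: "eval (rd (Cn 0) (Vr 5)) R M = order M0 j" using R P by (simp add: eval_rd)
      have a: "eval ?a R M = k * k + (n + order M0 j)" using R r by simp
      have e: "eval ?e R M = Suc j" using R by simp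
      have jb: "k * k + (n + order M0 j) < base" using lt[OF j] by (simp add: base_def)
      have "safe w (rd (Cn 0) (Vr 5)) R M" using R j by (intro safe_rd) auto
      then have s: "safe w ?a R M" "safe w ?e R M"
        using R r j kk_less sm[of "k * k + (n + order M0 j)"] sm[of "n + order M0 j"] jb n_less[of "Suc j"]
        by (auto simp: one_less)
      have ne: "order M0 t \<noteq> order M0 j" if "t < j" for t
        using inj_onD[OF inj, of t j] that j by auto
      have "?hi (R(5 := Suc j)) (M(k * k + (n + order M0 j) := Suc j))"
        using P cl_ne[OF jb] by (auto simp: ag_def)
      then show "safe w ?a R M \<and> safe w ?e R M \<and> R 5 = j \<and>
        ?P2 (R(5 := Suc j)) (M(eval ?a R M := eval ?e R M)) \<and> ?O (Suc j) (M(eval ?a R M := eval ?e R M))"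
        unfolding a e using P s ne by (auto simp: less_Suc_eq)
    qed (use cost_le_cmax in auto)
  qed (use n1 n_less assms in \<open>auto simp: ag_def\<close>)
  show ?thesis unfolding prog_output_def
    by (rule hoare_conseq[OF hoare_Seq[OF hoare_Seq[OF 3 2] 1]]) (auto simp: written_def algebra_simps)
qed

lemma prog_main:
  assumes M0: "\<And>x y. x < n \<Longrightarrow> y < n \<Longrightarrow> M0 (x * n + y) = of_bool (adj x y)"
  shows "hoare w (prog_main k) (n ^ 3 * main_time k) (\<lambda>R M. R = (\<lambda>r. if r = 0 then n else 0) \<and> M = M0)
    (\<lambda>R M. R 0 = 1 \<and> (\<exists>d l p. d < ndec k \<and> realises adj k n (dec k d) l p \<and> written d l p M) \<or>
      R 0 = 0 \<and> \<not> solvable adj k n)"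
proof -
  let ?R0 = "\<lambda>r :: nat. if r = 0 then n else 0 :: nat"
  let ?out = "\<lambda>M. \<exists>d l p. d < ndec k \<and> realises adj k n (dec k d) l p \<and> written d l p M"
  let ?Q = "\<lambda>R M. R 0 = 1 \<and> ?out M \<or> R 0 = 0 \<and> \<not> solvable adj k n"
  let ?Q4 = "\<lambda>R M. R 4 = 1 \<and> ?out M \<or> R 4 = 0 \<and> \<not> solvable adj k n"
  let ?e = "add (mul (Vr 0) (Vr 0)) (add (Cn (k * k)) (mul (Cn 2) (Vr 0)))"
  have sm: "a < 2 ^ w" if "a \<le> base" for a by (rule small) (use that in simp)
  have 1: "hoare w (Asg 1 ?e) A (\<lambda>R M. R = ?R0 \<and> M = M0) (\<lambda>R M. R = ?R0(1 := base) \<and> M = M0)"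
  proof (rule hoare_pre[OF hoare_Asg[OF w1]])
    have "n * n \<le> base" "k * k \<le> base" "2 * n \<le> base" "k * k + 2 * n \<le> base" "n * n + (k * k + 2 * n) \<le> base"
      by (auto simp: base_def)
    note b = this[THEN sm]
    fix R M assume "R = ?R0 \<and> M = M0"
    then show "safe w ?e R M \<and> R(1 := eval ?e R M) = ?R0(1 := base) \<and> M = M0"
      using b two_less by (simp add: base_def)
  qed (use cost_le_cmax(6) in auto)
  have 2: "hoare w (Asg 4 (Cn 1)) A (\<lambda>R M. R = ?R0(1 := base) \<and> M = M0) (state_inv 0)"
    by (rule hoare_pre[OF hoare_Asg[OF w1]])
      (use cost_le_cmax(6) M0 in \<open>auto simp: one_less state_inv_def env_def realises_def bij_betw_def\<close>)
  have 3: "hoare w (For 2 (Vr 0) (prog_vertex k)) (n * (n * (n * vertex_time k) + A)) (state_inv 0) (state_inv n)"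
  proof (rule hoare_For_bound[OF w1, where I = state_inv])
    \<comment> \<open>The invariant does not look at register 2, so the loop may use it as its
      counter.\<close>
    have inv: "state_inv m (R(2 := v)) M = state_inv m R M" for m R v M
      by (simp add: state_inv_def env_def)
    show "hoare w (prog_vertex k) (n * (n * vertex_time k)) (\<lambda>R M. R 2 = j \<and> state_inv j R M)
      (\<lambda>R M. R 2 = j \<and> state_inv (Suc j) (R(2 := Suc j)) M)" if "j < n" for j
      unfolding inv by (rule prog_vertex[OF that])
    show "state_inv 0 (R(2 := 0)) M" if "state_inv 0 R M" for R M using that unfolding inv .
  qed (use n1 n_less in \<open>auto simp: state_inv_def env_def\<close>)
  have 4: "hoare w (prog_output k) (k * k * (2 * A) + n * (4 * A)) (\<lambda>R M. state_inv n R M \<and> R 4 \<noteq> 0) ?Q4"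
  proof (rule hoare_use)
    fix R1 M1 assume P: "state_inv n R1 M1 \<and> R1 4 \<noteq> 0"
    then have R: "R1 0 = n" "R1 1 = base" "R1 3 < ndec k" "R1 4 = 1"
      and real: "realises adj k n (dec k (R1 3)) (letters M1) (order M1)"
      by (auto simp: state_inv_def env_def)
    have p: "bij_betw (order M1) {..<n} {..<n}" using real by (simp add: realises_def)
    show "hoare w (prog_output k) (k * k * (2 * A) + n * (4 * A)) (start R1 M1) ?Q4"
      by (rule hoare_conseq[OF prog_output[OF R(1,2) refl R(3) p]]) (use R real in \<open>auto simp: ag_def\<close>)
  qed
  have 5: "hoare w (Ite (Vr 4) (prog_output k) Skip) (k * k * (2 * A) + n * (4 * A) + A) (state_inv n) ?Q4"
    by (rule hoare_pre[OF hoare_Ite[OF w1 _ 4 hoare_Skip]])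
      (use cost_le_cmax(6) in \<open>auto simp: state_inv_def\<close>)
  have 6: "hoare w (Asg 0 (Vr 4)) A ?Q4 ?Q"
    by (rule hoare_pre[OF hoare_Asg[OF w1]]) (use cost_le_cmax(6) in auto)
  show ?thesis unfolding prog_main_def
  proof (rule hoare_pre[OF hoare_Seq[OF hoare_Seq[OF hoare_Seq[OF hoare_Seq[OF 6 5] 3] 2] 1]])
    have n: "z \<le> n ^ 3 * z" "n * z \<le> n ^ 3 * z" for z :: nat
      using n1 by (auto intro!: mult_le_mono1 simp: self_le_power)
    have "k * k * (2 * A) \<le> n ^ 3 * (k * k * (2 * A))" "n * (4 * A) \<le> n ^ 3 * (4 * A)" "n * A \<le> n ^ 3 * A"
      "4 * A \<le> n ^ 3 * (4 * A)"
      by (rule n)+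
    moreover have "n * (n * (n * vertex_time k) + A) = n ^ 3 * vertex_time k + n * A"
      by (simp add: power3_eq_cube algebra_simps)
    moreover have "n ^ 3 * main_time k = n ^ 3 * vertex_time k + n ^ 3 * (k * k * (2 * A)) + n ^ 3 * (4 * A) +
      n ^ 3 * (4 * A) + n ^ 3 * A + n ^ 3 * A"
      by (simp add: main_time_def algebra_simps)
    ultimately show "A + (A + (n * (n * (n * vertex_time k) + A) + (k * k * (2 * A) + n * (4 * A) + A + A)))
      \<le> n ^ 3 * main_time k" by linarith
  qed auto
qed

end

section \<open>Program length and word length\<close>

lemma length_rules:
  "com_length Skip \<le> 1"
  "com_length (Asg x e) \<le> cost e + 2"
  "com_length (St e e') \<le> cost e + cost e' + 1"
  "com_length P \<le> a \<Longrightarrow> com_length Q \<le> b \<Longrightarrow> com_length (Seq P Q) \<le> a + b"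
  "com_length P \<le> a \<Longrightarrow> com_length Q \<le> b \<Longrightarrow> com_length (Ite e P Q) \<le> cost e + 1 + a + b"
  "com_length P \<le> a \<Longrightarrow> com_length (For x e P) \<le> 2 * cost e + a + 18"
  using com_length_Asg[of x e] com_length_St[of e e'] com_length_Ite[of e P Q] com_length_For[of x e P]
  by auto

text \<open>\<open>cost\<close> bounds the length of compiled expressions as well as their time, and
  loops repeat no text. So the length is a constant number of table sizes, independent of
  \<open>n\<close>.\<close>

lemma com_length_main: "com_length (prog_main k) \<le> 30 * cmax k"
  unfolding prog_main_def prog_output_def prog_vertex_def prog_search_def prog_place_def prog_acc_def
    prog_dp_def prog_find_def prog_trace_def prog_indeg_def prog_sort_def prog_column_def
    prog_choice_def prog_letters_def prog_count_def prog_source_def prog_update_def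
  by (rule order_trans, (rule length_rules)+) (simp add: cmax_def)

definition size_bound :: "nat \<Rightarrow> nat" where
  "size_bound k = 2 ^ (60 * (k ^ 2 * 2 ^ (2 * k)))"

text \<open>With \<open>Y = 2 ^ (k ^ 4)\<close>, the number \<open>k\<close> and the number of
  decoders are at most \<open>Y\<close>, the states number at most \<open>Y ^ 12\<close>, and every
  other quantity is a small product of these. The running time ends up at \<open>Y ^ 45\<close>, and
  the 60 in \<open>size_bound\<close> leaves room for strict inequalities.\<close>

lemma bounds:
  assumes k: "1 \<le> k"
  shows "2 \<le> size_bound k" "main_time k \<le> size_bound k" "30 * cmax k \<le> size_bound k"
    "9 * nst k + k * k + 20 < size_bound k"
    "nst k * (2 * k * k) < size_bound k" "ndec k * (ndec k * k) < size_bound k"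
    "ndec k * (k * k * 2) < size_bound k"
proof -
  define Y :: nat where "Y = 2 ^ (k ^ 4)"
  have k4: "1 \<le> k ^ 4" "k ^ 2 \<le> k ^ 4" "k \<le> k ^ 4"
    using k by (auto intro: power_increasing self_le_power)
  have Y2: "2 \<le> Y" using power_increasing[of 1 "k ^ 4" "2::nat"] k4 by (simp add: Y_def)
  have kY: "k \<le> Y"
    using less_exp[of k] power_increasing[of k "k ^ 4" "2::nat"] k4 unfolding Y_def by linarith
  have dY: "ndec k \<le> Y"
    unfolding Y_def using k4 by (intro power_increasing) (auto simp: power2_eq_square)
  have nY: "nst k \<le> Y ^ 12"
    using card_astates[OF k] by (simp add: Y_def power_mult[symmetric] mult.commute)
  \<comment> \<open>Numerical factors are absorbed by further powers of \<open>Y\<close>, since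
    \<open>2 \<le> Y\<close>.\<close>
  have c: "2 ^ a * Y ^ b \<le> Y ^ (a + b)" for a b :: nat
    using power_mono[OF Y2, of a] by (simp add: power_add)
  have mono: "Y ^ a \<le> Y ^ b" if "a \<le> b" for a b using that Y2 by (intro power_increasing) auto
  have Y0: "1 \<le> Y ^ a" for a using Y2 by simp
  have 1: "nst k * (2 * k * k) \<le> Y ^ 15"
  proof -
    have "nst k * (2 * k * k) \<le> Y ^ 12 * (Y * Y * Y)" using nY Y2 kY by (intro mult_le_mono)
    then show ?thesis by (simp add: power_add[symmetric] power3_eq_cube[symmetric] numeral_eq_Suc mult.assoc)
  qed
  have 2: "ndec k * (ndec k * k) \<le> Y ^ 15"
  proof -
    have "ndec k * (ndec k * k) \<le> Y * (Y * Y)" using dY kY by (intro mult_le_mono)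
    also have "\<dots> = Y ^ 3" by (simp add: power3_eq_cube)
    also have "\<dots> \<le> Y ^ 15" by (rule mono) simp
    finally show ?thesis .
  qed
  have 3: "ndec k * (k * k * 2) \<le> Y ^ 15"
  proof -
    have "ndec k * (k * k * 2) \<le> Y * (Y * Y * Y)" using dY kY Y2 by (intro mult_le_mono)
    also have "\<dots> = Y ^ 4" by (simp add: power4_eq_xxxx)
    also have "\<dots> \<le> Y ^ 15" by (rule mono) simp
    finally show ?thesis .
  qed
  have 4: "ndec k * (k * k) \<le> Y ^ 15" using 3 by (rule order_trans[rotated]) simp
  have 5: "nst k \<le> Y ^ 15" using nY mono[of 12 15] by simp
  have cm: "cmax k \<le> Y ^ 23"
  proof -
    have sum: "4 * (a + b + c + d + e) + 200 \<le> 4 * (5 * z) + 200"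
      if "a \<le> z" "b \<le> z" "c \<le> z" "d \<le> z" "e \<le> z" for a b c d e z :: nat
      using that by simp
    have "cmax k \<le> 4 * (5 * Y ^ 15) + 200" unfolding cmax_def by (rule sum[OF 1 5 2 3 4])
    also have "\<dots> \<le> 2 ^ 8 * Y ^ 15" using Y0[of 15] by simp
    also have "\<dots> \<le> Y ^ 23" using c[of 8 15] by simp
    finally show ?thesis .
  qed
  have kk: "k * k \<le> Y ^ 15"
  proof -
    have "k * k \<le> Y * Y" using kY by (intro mult_le_mono)
    also have "\<dots> = Y ^ 2" by (simp add: power2_eq_square)
    also have "\<dots> \<le> Y ^ 15" by (rule mono) simp
    finally show ?thesis .
  qed
  have nk: "nst k * k \<le> Y ^ 15"
    using 1 k by (intro order_trans[OF _ 1] mult_le_mono2) simp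
  have dk: "ndec k * k \<le> Y ^ 15"
    by (rule order_trans[OF _ 2]) simp
  have vt: "vertex_time k \<le> Y ^ 44"
  proof -
    have "nst k * (k * 13) + ndec k * k * 4 + 30 = 13 * (nst k * k) + 4 * (ndec k * k) + 30" by simp
    also have "\<dots> \<le> 13 * Y ^ 15 + 4 * Y ^ 15 + 30 * Y ^ 15"
      using nk dk Y0[of 15] by (intro add_mono mult_le_mono) auto
    also have "\<dots> \<le> 2 ^ 6 * Y ^ 15" by simp
    also have "\<dots> \<le> Y ^ 21" using c[of 6 15] by simp
    finally have "vertex_time k \<le> Y ^ 21 * Y ^ 23"
      unfolding vertex_time_def using cm by (intro mult_le_mono)
    then show ?thesis by (simp add: power_add[symmetric])
  qed
  have mt: "main_time k \<le> Y ^ 45"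
  proof -
    have "2 * (k * k) + 10 \<le> 2 * Y ^ 15 + 10 * Y ^ 15" using kk Y0[of 15] by (intro add_mono) auto
    also have "\<dots> \<le> 2 ^ 4 * Y ^ 15" by simp
    also have "\<dots> \<le> Y ^ 19" using c[of 4 15] by simp
    finally have "(2 * (k * k) + 10) * cmax k \<le> Y ^ 19 * Y ^ 23" using cm by (intro mult_le_mono)
    also have "\<dots> \<le> Y ^ 44" using mono[of 42 44] by (simp add: power_add[symmetric])
    finally have "main_time k \<le> 2 ^ 1 * Y ^ 44" using vt by (simp add: main_time_def)
    also have "\<dots> \<le> Y ^ 45" using c[of 1 44] by simp
    finally show ?thesis .
  qed
  have size: "Y ^ 60 \<le> size_bound k"
  proof -
    \<comment> \<open>From k < 2^k follows k^4 \<le> k^2 2^(2k), which carries the bound over to the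
      required exponent.\<close>
    have "k ^ 2 \<le> (2 ^ k) ^ 2" using less_exp[of k] by (intro power_mono) auto
    then have "k ^ 2 * k ^ 2 \<le> k ^ 2 * 2 ^ (2 * k)"
      by (intro mult_le_mono2) (simp add: power_mult[symmetric] mult.commute)
    then have "k ^ 4 \<le> k ^ 2 * 2 ^ (2 * k)" by (simp add: power_add[symmetric])
    then have "k ^ 4 * 60 \<le> 60 * (k ^ 2 * 2 ^ (2 * k))" by simp
    then show ?thesis unfolding Y_def size_bound_def power_mult[symmetric] by (intro power_increasing) auto
  qed
  have lt: "x < size_bound k" if "x \<le> Y ^ a" "a < 60" for x a
  proof -
    have "Y ^ a < Y ^ 60" using Y2 that(2) by (intro power_strict_increasing) auto
    then show ?thesis using that(1) size by linarith
  qed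
  show "2 \<le> size_bound k" using lt[of "Y" 1] Y2 by simp
  show "main_time k \<le> size_bound k" using lt[OF mt] by simp
  have "30 * cmax k \<le> 2 ^ 5 * Y ^ 23" using cm by simp
  also have "\<dots> \<le> Y ^ 28" using c[of 5 23] by simp
  finally show "30 * cmax k \<le> size_bound k" using lt[of "30 * cmax k" 28] by simp
  have "9 * nst k + k * k + 20 \<le> 9 * Y ^ 15 + Y ^ 15 + 20 * Y ^ 15"
    using 5 kk Y0[of 15] by (intro add_mono) auto
  also have "\<dots> \<le> 2 ^ 5 * Y ^ 15" by simp
  also have "\<dots> \<le> Y ^ 20" using c[of 5 15] by simp
  finally show "9 * nst k + k * k + 20 < size_bound k" by (rule lt) simp
  show "nst k * (2 * k * k) < size_bound k" "ndec k * (ndec k * k) < size_bound k"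
    "ndec k * (k * k * 2) < size_bound k" using lt[OF 1] lt[OF 2] lt[OF 3] by simp_all
qed

section \<open>Correctness of the whole program\<close>

lemma output_realisation:
  fixes G :: "nat pair_pre_digraph"
  assumes G: "pair_graph G" "pverts G = {0..<n}"
    and real: "realises (\<lambda>x y. (x, y) \<in> parcs G) k n D l p" and D: "D \<subseteq> {..<k} \<times> {..<k}"
    and dec: "\<And>e. e < k * k \<Longrightarrow> M e = of_bool ((e div k, e mod k) \<in> D)"
    and lets: "\<And>x. x < n \<Longrightarrow> M (k * k + x) = l x"
    and pos: "\<And>t. t < n \<Longrightarrow> M (k * k + (n + p t)) = Suc t"
  shows "k_letter_realisation k G (output_decoder k M) (output_letter k M) (output_position k n M)"
proof -
  interpret pair_graph G by fact
  have sym: "(x, y) \<in> parcs G \<longleftrightarrow> (y, x) \<in> parcs G" for x y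
    using arcs_symmetric by blast
  have p: "inj_on p {..<n}" "p ` {..<n} = {..<n}" and l: "\<And>x. x < n \<Longrightarrow> l x < k"
    and adj: "\<And>a b. a < b \<Longrightarrow> b < n \<Longrightarrow> (p a, p b) \<in> parcs G \<longleftrightarrow> (l (p a), l (p b)) \<in> D"
    using real by (auto simp: realises_def bij_betw_def)
  have parcs: "parcs (output_decoder k M) = D"
  proof -
    have "M (a * k + b) \<noteq> 0 \<longleftrightarrow> (a, b) \<in> D" if "a < k" "b < k" for a b
      using dec[OF index_less[OF that]] that by simp
    then show ?thesis using D by (auto simp: output_decoder_def)
  qed
  have pverts: "pverts (output_decoder k M) = {0..<k}" by (simp add: output_decoder_def)
  have "pair_fin_digraph (output_decoder k M)"
    by unfold_locales (use D in \<open>auto simp: parcs pverts intro: finite_subset\<close>)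
  moreover have "output_letter k M ` pverts G \<subseteq> pverts (output_decoder k M)"
    using l lets by (auto simp: output_letter_def G pverts)
  moreover have c: "output_position k n M (p t) = Suc t" if "t < n" for t
    using pos[OF that] by (simp add: output_position_def add.assoc)
  have "bij_betw (output_position k n M) (pverts G) {1..card (pverts G)}"
  proof -
    have "inj_on (output_position k n M) (p ` {..<n})"
      by (rule inj_onI) (auto simp: c)
    moreover have "output_position k n M ` p ` {..<n} = Suc ` {..<n}"
      unfolding image_image using c by (intro image_cong) auto
    ultimately show ?thesis unfolding p bij_betw_def
      by (simp add: G atLeast0LessThan image_Suc_lessThan)
  qed
  moreover have "(x, y) \<in> parcs G \<longleftrightarrow>
      (output_letter k M x, output_letter k M y) \<in> D \<and> output_position k n M x < output_position k n M y \<or>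
      (output_letter k M y, output_letter k M x) \<in> D \<and> output_position k n M y < output_position k n M x"
    if xy: "x < n" "y < n" "x \<noteq> y" for x y
  proof -
    obtain a b where a: "x = p a" "a < n" and b: "y = p b" "b < n" using p(2) xy by blast
    have "output_letter k M x = l x" "output_letter k M y = l y" using lets xy by (simp_all add: output_letter_def)
    moreover have "a \<noteq> b" using a b xy by auto
    ultimately show ?thesis using adj[of a b] adj[of b a] sym[of "p a" "p b"] a b c
      by (cases "a < b") auto
  qed
  ultimately show ?thesis
    by (simp add: k_letter_realisation_def letter_realisation_def G parcs pverts)
qed

lemma program_correct:
  fixes G :: "nat pair_pre_digraph"
  assumes k: "1 \<le> k" and n: "1 \<le> n" and G: "pair_graph G" "pverts G = {0..<n}"
  shows "\<exists>R M. halts_within 2 (prog_main k) (graph_input n G) (real (size_bound k * n ^ 3)) (R, M) \<and>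
    R 0 = (if lettericity G \<le> k then 1 else 0) \<and>
    (lettericity G \<le> k \<longrightarrow> k_letter_realisation k G (output_decoder k M)
       (output_letter k M) (output_position k n M))"
proof -
  define T where "T = size_bound k * n ^ 3"
  note B = bounds[OF k]
  have n3: "1 \<le> n ^ 3" "n \<le> n ^ 3" "n * n \<le> n ^ 3"
    using n by (auto simp: self_le_power power3_eq_cube)
  have sT: "size_bound k \<le> T" using n3(1) mult_le_mono2[of 1 "n ^ 3" "size_bound k"] by (simp add: T_def)
  have T2: "2 \<le> T" using sT B(1) by simp
  \<comment> \<open>The least word length with \<open>T \<le> 2 ^ w\<close>. As
    \<open>log 2 T\<close> is at least 1, rounding up at most doubles it, whence the factor 2 in
    \<open>halts_within\<close>.\<close>
  define w where "w = nat \<lceil>log 2 (real T)\<rceil>"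
  have lT: "1 \<le> log 2 (real T)" using T2 by (simp add: le_log_iff)
  have w: "log 2 (real T) \<le> real w" "real w \<le> 2 * log 2 (real T)" "1 \<le> w"
    using lT unfolding w_def by linarith+
  have "real T = 2 powr log 2 (real T)" using T2 by simp
  also have "\<dots> \<le> 2 powr real w" using w(1) by simp
  also have "\<dots> = real (2 ^ w)" by (simp add: powr_realpow)
  finally have Tw: "T \<le> 2 ^ w" by (simp only: of_nat_le_iff)
  define adj where "adj = (\<lambda>x y. (x, y) \<in> parcs G)"
  have mem: "n * n + (k * k + 2 * n) + ((nst k + 3) * (n + 1) + n) < T"
  proof -
    have m: "z * n \<le> z * n ^ 3" "z \<le> z * n ^ 3" for z :: nat using n3 by auto
    have "n * n + (k * k + 2 * n) + ((nst k + 3) * (n + 1) + n) =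
        n * n + k * k + 2 * n + nst k * n + nst k + 3 * n + 3 + n" by (simp add: algebra_simps)
    also have "\<dots> \<le> n ^ 3 + k * k * n ^ 3 + 2 * n ^ 3 + nst k * n ^ 3 + nst k * n ^ 3 + 3 * n ^ 3 + 3 * n ^ 3 + n ^ 3"
      by (intro add_mono m n3 mult_le_mono) (use n3 in auto)
    also have "\<dots> = (2 * nst k + k * k + 10) * n ^ 3" by (simp add: algebra_simps)
    also have "\<dots> < size_bound k * n ^ 3"
      using B(4) n by (intro mult_less_mono1) auto
    finally show ?thesis by (simp add: T_def)
  qed
  interpret ram k n w adj
  proof
    interpret G: pair_graph G by fact
    show "adj x y = adj y x" for x y unfolding adj_def using G.arcs_symmetric by blast
  qed (use k n w(3) mem B(5-7) sT Tw in auto)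
  let ?R0 = "\<lambda>r :: nat. if r = 0 then n else 0"
  obtain M0 where inp: "graph_input n G = (?R0, M0)" and M0: "M0 = snd (graph_input n G)"
    by (simp add: graph_input_def)
  have M0b: "M0 a \<le> 1" for a by (simp add: M0 graph_input_def)
  have M0adj: "M0 (x * n + y) = of_bool (adj x y)" if "x < n" "y < n" for x y
    using that index_less[OF that] by (simp add: M0 graph_input_def adj_def)
  have b0: "bnd w ?R0 M0"
    using n_less[of n] one_less M0b by (auto simp: bnd_def intro: le_less_trans)
  have clr0: "clr ?R0 = ?R0" by (auto simp: clr_def)
  have "\<exists>t R M. exec w (prog_main k) (?R0, M0) t (R, M) \<and> t \<le> n ^ 3 * main_time k \<and>
    (clr R 0 = 1 \<and> (\<exists>d l p. d < ndec k \<and> realises adj k n (dec k d) l p \<and> written d l p M) \<or>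
      clr R 0 = 0 \<and> \<not> solvable adj k n)"
    by (rule prog_main[OF M0adj, unfolded hoare_def, rule_format, OF _ _ b0]) (simp_all add: clr0)
  then obtain t R M where ex: "exec w (prog_main k) (?R0, M0) t (R, M)" and t: "t \<le> n ^ 3 * main_time k"
    and post: "clr R 0 = 1 \<and> (\<exists>d l p. d < ndec k \<and> realises adj k n (dec k d) l p \<and> written d l p M) \<or>
      clr R 0 = 0 \<and> \<not> solvable adj k n"
    by (elim exE conjE)
  have "t \<le> T" using le_trans[OF t mult_le_mono2[OF B(2)]] by (simp add: T_def mult.commute)
  moreover have "com_length (prog_main k) \<le> 2 ^ w" using com_length_main[of k] B(3) sT Tw by linarith
  ultimately have halts: "halts_within 2 (prog_main k) (graph_input n G) (real T) (R, M)"
    unfolding halts_within_def inp fst_conv snd_conv using ex w(2) b0[unfolded bnd_def]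
    by - (rule exI[of _ w], rule exI[of _ t], simp)
  have R0: "clr R 0 = R 0" by (simp add: clr_def)
  have "R 0 = (if lettericity G \<le> k then 1 else 0) \<and>
    (lettericity G \<le> k \<longrightarrow> k_letter_realisation k G (output_decoder k M)
       (output_letter k M) (output_position k n M))"
    using post unfolding R0
  proof (elim disjE conjE exE)
    fix d l p assume "R 0 = 1" and *: "d < ndec k" "realises adj k n (dec k d) l p" "written d l p M"
    have "k_letter_realisation k G (output_decoder k M) (output_letter k M) (output_position k n M)"
      by (rule output_realisation[OF G *(2)[unfolded adj_def] dec_subset[OF *(1)]])
        (use *(3) in \<open>auto simp: written_def\<close>)
    \<comment> \<open>The realisation that was written is itself the witness for
      \<open>lettericity G \<le> k\<close>, so a positive answer is always right.\<close>
    moreover from this have "\<exists>(D :: nat pair_pre_digraph) l c. k_letter_realisation k G D l c" by blast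
    then have "lettericity G \<le> k" unfolding lettericity_def by (rule Least_le)
    ultimately show ?thesis using \<open>R 0 = 1\<close> by simp
  next
    assume "R 0 = 0" "\<not> solvable adj k n"
    moreover have "solvable adj k n" if le: "lettericity G \<le> k"
      by (rule lettericity_le_imp_acyclic[OF G le]) (unfold solvable_def adj_def, blast)
    ultimately show ?thesis by auto
  qed
  then show ?thesis using halts unfolding T_def by blast
qed

theorem theoremA6:
  shows "\<exists>f \<in> O(\<lambda>k::nat. real k ^ 3). \<exists>g \<in> O(\<lambda>k::nat. real k ^ 2 * 2 ^ (2 * k)). \<exists>c::real.
    \<forall>k \<ge> 1. \<exists>P::com. \<forall>n \<ge> 1. \<forall>G::nat pair_pre_digraph.
      pair_graph G \<and> pverts G = {0..<n} \<longrightarrow>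
      (\<exists>R M. halts_within c P (graph_input n G)
                (2 powr f k * 2 powr g k * real n ^ 3) (R, M) \<and>
         R 0 = (if lettericity G \<le> k then 1 else 0) \<and>
         (lettericity G \<le> k \<longrightarrow>
            k_letter_realisation k G (output_decoder k M)
              (output_letter k M) (output_position k n M)))"
proof -
  \<comment> \<open>\<open>?g\<close> is the exponent in \<open>size_bound\<close>, so the whole
    dependence on \<open>k\<close> is charged to it.\<close>
  let ?f = "\<lambda>k::nat. 0 :: real" and ?g = "\<lambda>k::nat. 60 * (real k ^ 2 * 2 ^ (2 * k))"
  have size: "real (size_bound k * n ^ 3) = 2 powr ?f k * 2 powr ?g k * real n ^ 3" for k n
  proof -
    have "2 powr ?g k = 2 powr real (60 * (k ^ 2 * 2 ^ (2 * k)))" by simp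
    also have "\<dots> = real (size_bound k)" unfolding size_bound_def by (subst powr_realpow) auto
    finally show ?thesis by simp
  qed
  show ?thesis
  proof (rule bexI[of _ ?f], rule bexI[of _ ?g], rule exI[of _ 2], intro allI impI,
      rule exI[of _ "prog_main _"], intro allI impI)
    fix k n :: nat and G :: "nat pair_pre_digraph"
    assume "1 \<le> k" "1 \<le> n" "pair_graph G \<and> pverts G = {0..<n}"
    then show "\<exists>R M. halts_within 2 (prog_main k) (graph_input n G)
        (2 powr ?f k * 2 powr ?g k * real n ^ 3) (R, M) \<and>
      R 0 = (if lettericity G \<le> k then 1 else 0) \<and>
      (lettericity G \<le> k \<longrightarrow> k_letter_realisation k G (output_decoder k M)
         (output_letter k M) (output_position k n M))"
      using program_correct[of k n G] unfolding size by blast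
  qed simp_all
qed

end
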